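(* Let $A=\mathcal{A}(E,\sigma)$ be a $3$-dimensional standard AS-regular algebra of one of the types P, S, S', T, T', NC, CC (that is, not of Type EC). Let $D=\left\{\begin{pmatrix}1&0&0\\0&e&0\\0&0&i\end{pmatrix}\;\middle|\; ei\neq0\right\}$ and let $\varepsilon$ be a primitive cube root of unity. Then $Z(E,\sigma)$ and $M(E,\sigma)$, as subsets of ${\rm PGL}_3(k)={\rm Aut}_k\mathbb{P}^2$, are as follows. Type P: $Z(E,\sigma)=M(E,\sigma)={\rm PGL}_3(k)$. Type T: $Z(E,\sigma)=M(E,\sigma)=\left\{\begin{pmatrix}1&0&0\\ 0&e&0\\ g&h&e^2\end{pmatrix}\;\middle|\; e^3=1,\ g,h\in k\right\}\rtimes\left\langle\begin{pmatrix}0&1&0\\1&0&0\\0&0&-1\end{pmatrix}\right\rangle$. Type T': $Z(E,\sigma)=M(E,\sigma)=\left\{\begin{pmatrix}1&0&0\\ d&1&0\\ d^2&2d&1\end{pmatrix}\;\middle|\; d\in k\right\}$. Type CC: $Z(E,\sigma)=M(E,\sigma)=\{{\rm id}\}$. Type S: $Z(E,\sigma)=D\rtimes\left\langle\begin{pmatrix}0&1&0\\0&0&1\\1&0&0\end{pmatrix}\right\rangle$ if $\sigma^2\neq{\rm id}$, and $Z(E,\sigma)={\rm Aut}_k(\mathbb{P}^2\downarrow E)$ if $\sigma^2={\rm id}$; $M(E,\sigma)=D\rtimes\left\langle\begin{pmatrix}0&1&0\\0&0&1\\1&0&0\end{pmatrix}\right\rangle$ if $\sigma^6\neq{\rm id}$,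 and $M(E,\sigma)={\rm Aut}_k(\mathbb{P}^2\downarrow E)$ if $\sigma^6={\rm id}$. Type S': $Z(E,\sigma)=\left\{\begin{pmatrix}1&0&0\\0&e&0\\0&0&e^{-1}\end{pmatrix}\;\middle|\; e\neq0\right\}$ if $\sigma^2\neq{\rm id}$, and $Z(E,\sigma)={\rm Aut}_k(\mathbb{P}^2\downarrow E)$ if $\sigma^2={\rm id}$; $M(E,\sigma)=\left\{\begin{pmatrix}1&0&0\\0&e&0\\0&0&e^{-1}\end{pmatrix}\;\middle|\; e\neq0\right\}$ if $\sigma^6\neq{\rm id}$, and $M(E,\sigma)={\rm Aut}_k(\mathbb{P}^2\downarrow E)$ if $\sigma^6={\rm id}$. Type NC: $Z(E,\sigma)=\left\langle\begin{pmatrix}1&0&0\\0&\varepsilon&0\\0&0&\varepsilon^2\end{pmatrix}\right\rangle$ if $\sigma^2\neq{\rm id}$, and $Z(E,\sigma)={\rm Aut}_k(\mathbb{P}^2\downarrow E)$ if $\sigma^2={\rm id}$; $M(E,\sigma)=\left\langle\begin{pmatrix}1&0&0\\0&\varepsilon&0\\0&0&\varepsilon^2\end{pmatrix}\right\rangle$ if $\sigma^6\neq{\rm id}$, and $M(E,\sigma)={\rm Aut}_k(\mathbb{P}^2\downarrow E)$ if $\sigma^6={\rm id}$.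
   Context: $k$ is an algebraically closed field of characteristic zero. Matrices act on points $(a,b,c)\in\mathbb{P}^2$ regarded as column vectors. For a projective variety $E\subset\mathbb{P}^2$ (reduced, not necessarily irreducible) and $\sigma\in{\rm Aut}_kE$: ${\rm Aut}_k(E\uparrow\mathbb{P}^2)=\{\tau\in{\rm Aut}_kE\mid\tau=\overline{\tau}|_E\text{ for some }\overline{\tau}\in{\rm Aut}_k\mathbb{P}^2\}$; ${\rm Aut}_k(\mathbb{P}^2\downarrow E)=\{\tau\in{\rm Aut}_k\mathbb{P}^2\mid\tau|_E\in{\rm Aut}_kE\}$; $Z(E,\sigma)=\{\tau\in{\rm Aut}_k(\mathbb{P}^2\downarrow E)\mid\sigma\tau|_E\sigma^{-1}=\tau|_E\}$; $M(E,\sigma)=\{\tau\in{\rm Aut}_k(\mathbb{P}^2\downarrow E)\mid(\tau|_E\sigma)^i\sigma^{-i}\in{\rm Aut}_k(E\uparrow\mathbb{P}^2)\ \forall i\in\mathbb{Z}\}$. $\mathcal{A}(E,\sigma)$ denotes $k\langle x,y,z\rangle/(R)$, where $R$ is the space of degree-two elements $g$ (viewed as bilinear forms) with $g(p,\sigma(p))=0$ for all $p\in E$. The $3$-dimensional standard AS-regular algebras not of Type EC are the algebras $\mathcal{A}(E,\sigma)$ for the following pairs (with $\varepsilon$ a primitive cube root of unity; $\mathcal{V}(\cdot)$ is the zero locus in $\mathbb{P}^2$): - Type P: $E=\mathbb{P}^2$, $\sigma={\rm id}$. - Type S ($\alpha\in k$, $\alpha^3\neq0,1$): $E=\mathcal{V}(x)\cup\mathcal{V}(y)\cup\mathcal{V}(z)$,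 $\sigma(0,b,c)=(0,b,\alpha c)$, $\sigma(a,0,c)=(\alpha a,0,c)$, $\sigma(a,b,0)=(a,\alpha b,0)$. - Type S' ($\alpha^3\neq0,1$, $\lambda=\frac{\alpha^3-1}{\alpha}$): $E=\mathcal{V}(x)\cup\mathcal{V}(x^2-\lambda yz)$, $\sigma(0,b,c)=(0,b,\alpha c)$ on $\mathcal{V}(x)$, $\sigma(a,b,c)=(a,\alpha b,\alpha^{-1}c)$ on $\mathcal{V}(x^2-\lambda yz)$. - Type T: $E=\mathcal{V}(x+y)\cup\mathcal{V}(\varepsilon x+y)\cup\mathcal{V}(\varepsilon^2x+y)$, $\sigma(a,-a,c)=(a,-a,a+c)$, $\sigma(a,-\varepsilon a,c)=(a,-\varepsilon a,\varepsilon^2a+c)$, $\sigma(a,-\varepsilon^2a,c)=(a,-\varepsilon^2a,\varepsilon a+c)$. - Type T': $E=\mathcal{V}(x)\cup\mathcal{V}(y^2-xz)$, $\sigma(0,b,c)=(0,b,b+c)$ on $\mathcal{V}(x)$, $\sigma(a,b,c)=(a,-a+b,a-2b+c)$ on $\mathcal{V}(y^2-xz)$. - Type NC ($\alpha^3\neq0,1$, $\lambda=\frac{\alpha^3-1}{\alpha}$): $E=\mathcal{V}(x^3+y^3-\lambda xyz)$, $\sigma(a,b,c)=(a,\alpha b,-\frac{a^2}{b}+\alpha^2c)$ for $b\neq 0$, and $\sigma(0,0,1)=(0,0,1)$. - Type CC: $E=\mathcal{V}(x^3-y^2z)$, $\sigma(a,b,c)=(a-b,b,-3\frac{a^2}{b}+3a-b+c)$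 for $b\neq0$, and $\sigma(0,0,1)=(0,0,1)$. *)

theory Defs
  imports "HOL-Analysis.Analysis" "HOL-Algebra.Coset" "HOL-Algebra.Generated_Groups"
    "HOL-Algebra.Bij" "HOL-Computational_Algebra.Polynomial"
begin

section \<open>The projective plane and its linear automorphisms\<close>

definition proportional :: "'k::field ^ 3 \<Rightarrow> 'k ^ 3 \<Rightarrow> bool" where
  "proportional u v \<longleftrightarrow> u \<noteq> 0 \<and> v \<noteq> 0 \<and> (\<exists>c. c \<noteq> 0 \<and> v = c *s u)"

quotient_type (overloaded) 'k P2 = "'k::field ^ 3" / partial: proportional
proof (rule part_equivpI)
  have "(1 :: 'k ^ 3) \<noteq> 0"
    by (simp add: vec_eq_iff)
  then have "proportional (1 :: 'k ^ 3) 1"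
    unfolding proportional_def by (auto intro!: exI[of _ 1])
  then show "\<exists>v :: 'k ^ 3. proportional v v" by blast
  show "symp (proportional :: 'k ^ 3 \<Rightarrow> _)"
  proof (rule sympI)
    fix u v :: "'k ^ 3"
    assume "proportional u v"
    then obtain c where "u \<noteq> 0" "v \<noteq> 0" "c \<noteq> 0" "v = c *s u"
      unfolding proportional_def by blast
    moreover from this have "u = inverse c *s v"
      by (simp add: vector_smult_assoc)
    ultimately show "proportional v u"
      unfolding proportional_def using nonzero_imp_inverse_nonzero by blast
  qed
  show "transp (proportional :: 'k ^ 3 \<Rightarrow> _)"
  proof (rule transpI)
    fix u v w :: "'k ^ 3"
    assume "proportional u v" "proportional v w"
    then obtain c d where "u \<noteq> 0" "w \<noteq> 0" "c \<noteq> 0" "d \<noteq> 0" "w = (d * c) *s u"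
      unfolding proportional_def by (auto simp: vector_smult_assoc)
    then show "proportional u w"
      unfolding proportional_def by (metis mult_eq_0_iff)
  qed
qed

text \<open>\<open>pt a b c\<close> is the point with homogeneous coordinates \<open>(a, b, c)\<close>. It is only meaningful
  when the coordinates are not all zero; every use below guards against that case.\<close>

abbreviation pt :: "'k::field \<Rightarrow> 'k \<Rightarrow> 'k \<Rightarrow> 'k P2" where
  "pt a b c \<equiv> abs_P2 (vector [a, b, c])"

text \<open>For invertible \<open>A\<close> the value does not depend on the chosen representative of \<open>p\<close>.\<close>

definition proj_map :: "'k::field ^ 3 ^ 3 \<Rightarrow> 'k P2 \<Rightarrow> 'k P2" where
  "proj_map A p = abs_P2 (A *v rep_P2 p)"

abbreviation mat3 :: "'k::field \<Rightarrow> 'k \<Rightarrow> 'k \<Rightarrow> 'k \<Rightarrow> 'k \<Rightarrow> 'k \<Rightarrow> 'k \<Rightarrow> 'k \<Rightarrow> 'k \<Rightarrow> 'k ^ 3 ^ 3" where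
  "mat3 a b c d e f g h i \<equiv> vector [vector [a, b, c], vector [d, e, f], vector [g, h, i]]"

text \<open>The group \<open>PGL\<^sub>3(k) = Aut\<^sub>k \<bbbP>\<^sup>2\<close>, realised as the transformations of the plane induced by
  invertible matrices, so that two matrices are identified iff they are proportional.\<close>

definition PGL3 :: "('k::field P2 \<Rightarrow> 'k P2) monoid" where
  "PGL3 = \<lparr>carrier = {proj_map A | A. invertible A}, mult = (\<circ>), one = id\<rparr>"

section \<open>Projective sets and their automorphisms\<close>

definition zero_locus :: "('k::field \<Rightarrow> 'k \<Rightarrow> 'k \<Rightarrow> 'k) \<Rightarrow> 'k P2 set" where
  "zero_locus f = {pt x y z | x y z. (x, y, z) \<noteq> (0, 0, 0) \<and> f x y z = 0}"

definition homogeneous :: "nat \<Rightarrow> ('k::field ^ 3 \<Rightarrow> 'k) \<Rightarrow> bool" where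
  "homogeneous d f \<longleftrightarrow>
     (\<exists>c. \<forall>v. f v = (\<Sum>i\<le>d. \<Sum>j\<le>d - i. c i j * (v $ 1) ^ i * (v $ 2) ^ j * (v $ 3) ^ (d - i - j)))"

text \<open>Morphisms of reduced varieties: locally on \<open>E\<close>, i.e. on a neighbourhood \<open>h \<noteq> 0\<close> of any given
  point, the map is given by three forms of the same degree without common zero.\<close>

definition regular_on :: "'k::field P2 set \<Rightarrow> ('k P2 \<Rightarrow> 'k P2) \<Rightarrow> bool" where
  "regular_on E \<phi> \<longleftrightarrow>
     (\<forall>u. u \<noteq> 0 \<and> abs_P2 u \<in> E \<longrightarrow>
        (\<exists>e h d F. homogeneous e h \<and> (\<forall>i. homogeneous d (\<lambda>v. F v $ i)) \<and> h u \<noteq> 0 \<and>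
           (\<forall>v. v \<noteq> 0 \<and> abs_P2 v \<in> E \<and> h v \<noteq> 0 \<longrightarrow>
              F v \<noteq> 0 \<and> \<phi> (abs_P2 v) = abs_P2 (F v :: 'k ^ 3))))"

text \<open>Maps \<open>E \<rightarrow> E\<close> are represented by functions that are \<open>undefined\<close> outside \<open>E\<close>, as in
  \<^const>\<open>BijGroup\<close>; composition, inverses and powers of automorphisms of \<open>E\<close> are those of
  \<open>BijGroup E\<close>, and restriction to \<open>E\<close> is \<^const>\<open>restrict\<close>.\<close>

definition Aut :: "'k::field P2 set \<Rightarrow> ('k P2 \<Rightarrow> 'k P2) set" where
  "Aut E = {\<phi> \<in> Bij E. regular_on E \<phi> \<and> regular_on E (inv_into E \<phi>)}"

definition Aut_up :: "'k::field P2 set \<Rightarrow> ('k P2 \<Rightarrow> 'k P2) set" where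
  "Aut_up E = {\<tau> \<in> Aut E. \<exists>\<tau>' \<in> carrier PGL3. \<tau> = restrict \<tau>' E}"

definition Aut_down :: "'k::field P2 set \<Rightarrow> ('k P2 \<Rightarrow> 'k P2) set" where
  "Aut_down E = {\<tau> \<in> carrier PGL3. restrict \<tau> E \<in> Aut E}"

definition Z_set :: "'k::field P2 set \<Rightarrow> ('k P2 \<Rightarrow> 'k P2) \<Rightarrow> ('k P2 \<Rightarrow> 'k P2) set" where
  "Z_set E \<sigma> = {\<tau> \<in> Aut_down E.
     \<sigma> \<otimes>\<^bsub>BijGroup E\<^esub> restrict \<tau> E \<otimes>\<^bsub>BijGroup E\<^esub> inv\<^bsub>BijGroup E\<^esub> \<sigma> = restrict \<tau> E}"

definition M_set :: "'k::field P2 set \<Rightarrow> ('k P2 \<Rightarrow> 'k P2) \<Rightarrow> ('k P2 \<Rightarrow> 'k P2) set" where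
  "M_set E \<sigma> = {\<tau> \<in> Aut_down E. \<forall>i::int.
     ((restrict \<tau> E \<otimes>\<^bsub>BijGroup E\<^esub> \<sigma>) [^]\<^bsub>BijGroup E\<^esub> i) \<otimes>\<^bsub>BijGroup E\<^esub> (\<sigma> [^]\<^bsub>BijGroup E\<^esub> (- i))
       \<in> Aut_up E}"

text \<open>\<open>K = N \<rtimes> H\<close> as an internal semidirect product of subgroups of \<open>G\<close>.\<close>

definition semidirect :: "('a, 'b) monoid_scheme \<Rightarrow> 'a set \<Rightarrow> 'a set \<Rightarrow> 'a set \<Rightarrow> bool" where
  "semidirect G K N H \<longleftrightarrow>
     subgroup K G \<and> subgroup H G \<and> N \<lhd> G\<lparr>carrier := K\<rparr> \<and>
     N \<inter> H = {\<one>\<^bsub>G\<^esub>} \<and> K = N <#>\<^bsub>G\<^esub> H"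

section \<open>The pairs defining the standard algebras not of Type EC\<close>

definition primitive_cube_root :: "'k::field \<Rightarrow> bool" where
  "primitive_cube_root \<epsilon> \<longleftrightarrow> \<epsilon> ^ 3 = 1 \<and> \<epsilon> \<noteq> 1 \<and> \<epsilon> ^ 2 \<noteq> 1"

text \<open>Since \<open>\<sigma> \<in> Aut E\<close> is undefined outside \<open>E\<close>, the listed values determine \<open>\<sigma>\<close> completely.\<close>

definition type_P :: "'k::field P2 set \<Rightarrow> ('k P2 \<Rightarrow> 'k P2) \<Rightarrow> bool" where
  "type_P E \<sigma> \<longleftrightarrow> E = UNIV \<and> \<sigma> = id"

definition type_S :: "'k::field \<Rightarrow> 'k P2 set \<Rightarrow> ('k P2 \<Rightarrow> 'k P2) \<Rightarrow> bool" where
  "type_S \<alpha> E \<sigma> \<longleftrightarrow> \<alpha> ^ 3 \<noteq> 0 \<and> \<alpha> ^ 3 \<noteq> 1 \<and>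
     E = zero_locus (\<lambda>x y z. x) \<union> zero_locus (\<lambda>x y z. y) \<union> zero_locus (\<lambda>x y z. z) \<and>
     \<sigma> \<in> Aut E \<and>
     (\<forall>b c. (b, c) \<noteq> (0, 0) \<longrightarrow> \<sigma> (pt 0 b c) = pt 0 b (\<alpha> * c)) \<and>
     (\<forall>a c. (a, c) \<noteq> (0, 0) \<longrightarrow> \<sigma> (pt a 0 c) = pt (\<alpha> * a) 0 c) \<and>
     (\<forall>a b. (a, b) \<noteq> (0, 0) \<longrightarrow> \<sigma> (pt a b 0) = pt a (\<alpha> * b) 0)"

definition type_S' :: "'k::field \<Rightarrow> 'k P2 set \<Rightarrow> ('k P2 \<Rightarrow> 'k P2) \<Rightarrow> bool" where
  "type_S' \<alpha> E \<sigma> \<longleftrightarrow> \<alpha> ^ 3 \<noteq> 0 \<and> \<alpha> ^ 3 \<noteq> 1 \<and>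
     (let \<mu> = (\<alpha> ^ 3 - 1) / \<alpha> in
        E = zero_locus (\<lambda>x y z. x) \<union> zero_locus (\<lambda>x y z. x ^ 2 - \<mu> * y * z) \<and>
        \<sigma> \<in> Aut E \<and>
        (\<forall>b c. (b, c) \<noteq> (0, 0) \<longrightarrow> \<sigma> (pt 0 b c) = pt 0 b (\<alpha> * c)) \<and>
        (\<forall>a b c. (a, b, c) \<noteq> (0, 0, 0) \<and> a ^ 2 - \<mu> * b * c = 0 \<longrightarrow>
           \<sigma> (pt a b c) = pt a (\<alpha> * b) (inverse \<alpha> * c)))"

definition type_T :: "'k::field \<Rightarrow> 'k P2 set \<Rightarrow> ('k P2 \<Rightarrow> 'k P2) \<Rightarrow> bool" where
  "type_T \<epsilon> E \<sigma> \<longleftrightarrow>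
     E = zero_locus (\<lambda>x y z. x + y) \<union> zero_locus (\<lambda>x y z. \<epsilon> * x + y) \<union>
         zero_locus (\<lambda>x y z. \<epsilon> ^ 2 * x + y) \<and>
     \<sigma> \<in> Aut E \<and>
     (\<forall>a c. (a, c) \<noteq> (0, 0) \<longrightarrow> \<sigma> (pt a (- a) c) = pt a (- a) (a + c)) \<and>
     (\<forall>a c. (a, c) \<noteq> (0, 0) \<longrightarrow>
        \<sigma> (pt a (- \<epsilon> * a) c) = pt a (- \<epsilon> * a) (\<epsilon> ^ 2 * a + c)) \<and>
     (\<forall>a c. (a, c) \<noteq> (0, 0) \<longrightarrow>
        \<sigma> (pt a (- (\<epsilon> ^ 2) * a) c) = pt a (- (\<epsilon> ^ 2) * a) (\<epsilon> * a + c))"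

definition type_T' :: "'k::field P2 set \<Rightarrow> ('k P2 \<Rightarrow> 'k P2) \<Rightarrow> bool" where
  "type_T' E \<sigma> \<longleftrightarrow>
     E = zero_locus (\<lambda>x y z. x) \<union> zero_locus (\<lambda>x y z. y ^ 2 - x * z) \<and>
     \<sigma> \<in> Aut E \<and>
     (\<forall>b c. (b, c) \<noteq> (0, 0) \<longrightarrow> \<sigma> (pt 0 b c) = pt 0 b (b + c)) \<and>
     (\<forall>a b c. (a, b, c) \<noteq> (0, 0, 0) \<and> b ^ 2 - a * c = 0 \<longrightarrow>
        \<sigma> (pt a b c) = pt a (- a + b) (a - 2 * b + c))"

definition type_NC :: "'k::field \<Rightarrow> 'k P2 set \<Rightarrow> ('k P2 \<Rightarrow> 'k P2) \<Rightarrow> bool" where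
  "type_NC \<alpha> E \<sigma> \<longleftrightarrow> \<alpha> ^ 3 \<noteq> 0 \<and> \<alpha> ^ 3 \<noteq> 1 \<and>
     (let \<mu> = (\<alpha> ^ 3 - 1) / \<alpha> in
        E = zero_locus (\<lambda>x y z. x ^ 3 + y ^ 3 - \<mu> * x * y * z) \<and>
        \<sigma> \<in> Aut E \<and>
        (\<forall>a b c. a ^ 3 + b ^ 3 - \<mu> * a * b * c = 0 \<and> b \<noteq> 0 \<longrightarrow>
           \<sigma> (pt a b c) = pt a (\<alpha> * b) (- (a ^ 2 / b) + \<alpha> ^ 2 * c)) \<and>
        \<sigma> (pt 0 0 1) = pt 0 0 1)"

definition type_CC :: "'k::field P2 set \<Rightarrow> ('k P2 \<Rightarrow> 'k P2) \<Rightarrow> bool" where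
  "type_CC E \<sigma> \<longleftrightarrow>
     E = zero_locus (\<lambda>x y z. x ^ 3 - y ^ 2 * z) \<and>
     \<sigma> \<in> Aut E \<and>
     (\<forall>a b c. a ^ 3 - b ^ 2 * c = 0 \<and> b \<noteq> 0 \<longrightarrow>
        \<sigma> (pt a b c) = pt (a - b) b (- 3 * (a ^ 2 / b) + 3 * a - b + c)) \<and>
     \<sigma> (pt 0 0 1) = pt 0 0 1"

definition D_set :: "('k::field P2 \<Rightarrow> 'k P2) set" where
  "D_set = {proj_map (mat3 1 0 0  0 e 0  0 0 i) | e i. e * i \<noteq> 0}"

end

theory Submission
  imports Defs
begin

text \<open>
  The member \<open>i = 2\<close> of the family defining \<open>M(E, \<sigma>)\<close> is \<open>\<tau> (\<sigma> \<tau> \<sigma>\<^sup>-\<^sup>1)\<close>, so \<open>\<tau> \<in> M(E, \<sigma>)\<close>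
  forces \<open>\<sigma> \<tau> \<sigma>\<^sup>-\<^sup>1\<close> to be linear, while \<open>Z(E, \<sigma>) \<subseteq> M(E, \<sigma>)\<close> always holds.
  For the types T, T' and CC a comparison of the action on the components of \<open>E\<close> shows that
  \<open>\<sigma> \<tau> \<sigma>\<^sup>-\<^sup>1\<close> is linear only if \<open>\<tau>\<close> commutes with \<open>\<sigma>\<close>. For the types S, S' and NC every linear
  automorphism \<open>\<tau>\<close> of \<open>E\<close> satisfies \<open>\<tau> \<sigma> \<tau>\<^sup>-\<^sup>1 = \<sigma>\<close> or \<open>\<tau> \<sigma> \<tau>\<^sup>-\<^sup>1 = \<sigma>\<^sup>-\<^sup>1\<close>; those of the second kind
  lie in \<open>Z\<close> iff \<open>\<sigma>\<^sup>2 = id\<close>, and in \<open>M\<close> iff \<open>\<sigma>\<^sup>2\<close> is linear, which means \<open>\<alpha>\<^sup>6 = 1\<close>, that is, \<open>\<sigma>\<^sup>6 = id\<close>.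
  The group of linear automorphisms of \<open>E\<close> is found by substituting a parametrization of \<open>E\<close> into
  its equation and comparing coefficients.
\<close>

section \<open>Points and matrices\<close>

text \<open>The exponent 6 has the same origin in types S, S' and NC. \<sigma> multiplies a
  coordinate of each component, or of its normalization, by \<alpha>, so a linear map agreeing with
  \<sigma>^2 has to multiply it by \<alpha>^2. Linear automorphisms of E leave less freedom. For
  diag(1, e, i) the factors i/e, 1/i and e on the sides of the triangle have product 1; diag(1, e,
  1/e) acts by e on the conic and by 1/e^2 on the line; on the nodal cubic only factors e with e^3 =
  1 occur. Each time \<alpha>^6 = 1 is the exact condition. In types T, T' and CC \<sigma> acts by
  translations, which a linear map rescales. The conjugate of \<tau> is never computed: its
  linearity is used in the form \<sigma> (\<tau> p) = \<rho> (\<sigma> p) with \<rho> linear, which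
  compares two rescaled translations and needs no formula for \<sigma>^-1.\<close>

lemma vector3_eq_iff [simp]:
  "(vector [a, b, c] :: 'a::zero ^ 3) = vector [a', b', c'] \<longleftrightarrow> a = a' \<and> b = b' \<and> c = c'"
  by (metis vector_3)

lemma vector3_eq_0_iff [simp]: "(vector [a, b, c] :: 'a::zero ^ 3) = 0 \<longleftrightarrow> a = 0 \<and> b = 0 \<and> c = 0"
  by (auto simp: vec_eq_iff forall_3)

lemma vector3_exhaust:
  obtains a b c where "(v :: 'a::zero ^ 3) = vector [a, b, c]"
proof -
  have "\<forall>v :: 'a ^ 3. \<exists>a b c. v = vector [a, b, c]"
    by (auto simp: forall_vector_3)
  with that show thesis by blast
qed

lemma mat3_exhaust:
  obtains a b c d e f g h i where "(A :: 'k::field ^ 3 ^ 3) = mat3 a b c d e f g h i"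
  by (metis vector3_exhaust)

lemma mat3_mult_vector [simp]:
  "mat3 a b c d e f g h i *v vector [x, y, z] =
    (vector [a * x + b * y + c * z, d * x + e * y + f * z, g * x + h * y + i * z] :: 'k::field ^ 3)"
  by (simp add: vec_eq_iff forall_3 matrix_vector_mult_def sum_3)

lemma scale_vector3 [simp]: "k *s vector [x, y, z] = (vector [k * x, k * y, k * z] :: 'k::field ^ 3)"
  by (simp add: vec_eq_iff forall_3)

lemma invertible_mat3:
  "invertible (mat3 a b c d e f g h i :: 'k::field ^ 3 ^ 3) \<longleftrightarrow>
     a * (e * i - f * h) - b * (d * i - f * g) + c * (d * h - e * g) \<noteq> 0"
  by (simp add: invertible_det_nz det_3 algebra_simps)

lemma invertible_mult_eq_0 [simp]:
  "invertible A \<Longrightarrow> A *v v = 0 \<longleftrightarrow> v = 0" for A :: "'k::field ^ 3 ^ 3"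
  by (metis invertible_def matrix_left_invertible_ker matrix_vector_mult_0_right)

text \<open>\<open>proportional\<close> is reflexive only on nonzero vectors, so the quotient is
  partial and zero has to be excluded before classes are compared.\<close>

lemma abs_P2_eq_iff:
  "u \<noteq> 0 \<Longrightarrow> v \<noteq> 0 \<Longrightarrow> abs_P2 u = abs_P2 v \<longleftrightarrow> proportional u v"
  using Quotient3_rel[OF Quotient3_P2, of u v]
  by (metis one_neq_zero proportional_def vector_smult_lid)

text \<open>Vanishing 2x2 minors replace the unknown scalar, so that an equality of points becomes
  three polynomial equations.\<close>

lemma proportional_vector3:
  assumes "(x, y, z) \<noteq> (0, 0, 0)" "(x', y', z') \<noteq> (0, 0, 0)"
  shows "proportional (vector [x, y, z]) (vector [x', y', z'] :: 'k::field ^ 3) \<longleftrightarrow>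
    x * y' = y * x' \<and> x * z' = z * x' \<and> y * z' = z * y'" (is "?L = ?R")
proof
  show "?L \<Longrightarrow> ?R"
    by (auto simp: proportional_def)
next
  assume R: ?R
  consider "x \<noteq> 0" | "y \<noteq> 0" | "z \<noteq> 0"
    using assms by auto
  then show ?L
  proof cases
    case 1
    then have "x' \<noteq> 0"
      using R assms by auto
    then show ?thesis
      using 1 R by (auto simp: proportional_def divide_simps mult.commute intro!: exI[of _ "x' / x"])
  next
    case 2
    then have "y' \<noteq> 0"
      using R assms by auto
    then show ?thesis
      using 2 R by (auto simp: proportional_def divide_simps mult.commute intro!: exI[of _ "y' / y"])
  next
    case 3
    then have "z' \<noteq> 0"
      using R assms by auto
    then show ?thesis
      using 3 R by (auto simp: proportional_def divide_simps mult.commute intro!: exI[of _ "z' / z"])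
  qed
qed

lemma pt_eq_iff:
  assumes "(x, y, z) \<noteq> (0, 0, 0)" "(x', y', z') \<noteq> (0, 0, 0)"
  shows "pt x y z = pt x' y' (z' :: 'k::field) \<longleftrightarrow> x * y' = y * x' \<and> x * z' = z * x' \<and> y * z' = z * y'"
  using assms by (subst abs_P2_eq_iff) (auto simp: proportional_vector3)

lemma pt_scale: "k \<noteq> 0 \<Longrightarrow> (x, y, z) \<noteq> (0, 0, 0) \<Longrightarrow> pt (k * x) (k * y) (k * z) = pt x y (z :: 'k::field)"
  by (subst pt_eq_iff) auto

lemma P2_exhaust:
  obtains v where "v \<noteq> 0" "p = abs_P2 v"
proof -
  have "\<exists>v. v \<noteq> 0 \<and> p = abs_P2 v"
    by (rule P2.abs_induct[where x = p]) (auto simp: proportional_def)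
  with that show thesis by blast
qed

lemma pt_exhaust:
  obtains x y z where "(x, y, z) \<noteq> (0, 0, 0)" "p = pt x y z"
proof -
  obtain v where v: "v \<noteq> 0" "p = abs_P2 v"
    by (rule P2_exhaust)
  obtain x y z where "v = vector [x, y, z]"
    by (rule vector3_exhaust)
  with v that show thesis by auto
qed

section \<open>The projective linear group\<close>

text \<open>The representative chosen by \<open>rep_P2\<close> differs from v by a nonzero scalar,
  and A carries that scalar along.\<close>

lemma proj_map_abs:
  assumes "invertible A" "v \<noteq> 0"
  shows "proj_map A (abs_P2 v) = abs_P2 (A *v v)"
proof -
  let ?w = "rep_P2 (abs_P2 v)"
  have "proportional v v"
    using assms by (auto simp: proportional_def intro!: exI[of _ 1])
  then have "proportional v ?w"
    using Quotient3_rep_abs[OF Quotient3_P2, of v] by (meson P2_equivp part_equivp_symp)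
  then obtain c where c: "?w \<noteq> 0" "c \<noteq> 0" "?w = c *s v"
    by (auto simp: proportional_def)
  have "proportional (A *v v) (A *v ?w)"
    using assms c by (auto simp: proportional_def vector_scalar_commute)
  then show ?thesis
    using assms c(1) by (simp add: proj_map_def abs_P2_eq_iff[symmetric])
qed

lemma proj_map_pt:
  assumes "invertible (mat3 a b c d e f g h i :: 'k::field ^ 3 ^ 3)" "(x, y, z) \<noteq> (0, 0, 0)"
  shows "proj_map (mat3 a b c d e f g h i) (pt x y z) =
    pt (a * x + b * y + c * z) (d * x + e * y + f * z) (g * x + h * y + i * z)"
  using assms by (subst proj_map_abs) auto

lemma mat3_mult:
  "mat3 a b c d e f g h i ** mat3 a' b' c' d' e' f' g' h' i' = (mat3
     (a * a' + b * d' + c * g') (a * b' + b * e' + c * h') (a * c' + b * f' + c * i')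
     (d * a' + e * d' + f * g') (d * b' + e * e' + f * h') (d * c' + e * f' + f * i')
     (g * a' + h * d' + i * g') (g * b' + h * e' + i * h') (g * c' + h * f' + i * i')
   :: 'k::field ^ 3 ^ 3)"
  by (simp add: vec_eq_iff forall_3 matrix_matrix_mult_def sum_3)

lemma proj_map_comp:
  fixes A B :: "'k::field ^ 3 ^ 3"
  assumes "invertible A" "invertible B"
  shows "proj_map A \<circ> proj_map B = proj_map (A ** B)"
proof
  fix p :: "'k P2"
  obtain v where "v \<noteq> 0" "p = abs_P2 v"
    by (rule P2_exhaust)
  with assms show "(proj_map A \<circ> proj_map B) p = proj_map (A ** B) p"
    by (simp add: proj_map_abs invertible_mult matrix_vector_mul_assoc)
qed

lemma proj_map_scale:
  assumes "k \<noteq> 0" "invertible (mat3 a b c d e f g h i :: 'k::field ^ 3 ^ 3)"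
  shows "proj_map (mat3 (k * a) (k * b) (k * c) (k * d) (k * e) (k * f) (k * g) (k * h) (k * i)) =
         proj_map (mat3 a b c d e f g h i)"
proof
  fix p :: "'k P2"
  obtain x y z where p: "(x, y, z) \<noteq> (0, 0, 0)" "p = pt x y z"
    by (rule pt_exhaust)
  have "invertible (mat3 (k * a) (k * b) (k * c) (k * d) (k * e) (k * f) (k * g) (k * h) (k * i))"
  proof -
    have "k * a * (k * e * (k * i) - k * f * (k * h)) - k * b * (k * d * (k * i) - k * f * (k * g)) +
      k * c * (k * d * (k * h) - k * e * (k * g)) =
      k ^ 3 * (a * (e * i - f * h) - b * (d * i - f * g) + c * (d * h - e * g))"
      by algebra
    with assms show ?thesis
      by (simp add: invertible_mat3)
  qed
  moreover have "mat3 a b c d e f g h i *v vector [x, y, z] \<noteq> 0"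
    using assms(2) p(1) by (subst invertible_mult_eq_0) auto
  moreover have "k * r * x + k * s * y + k * t * z = k * (r * x + s * y + t * z)" for r s t
    by (simp add: algebra_simps)
  ultimately show "proj_map (mat3 (k * a) (k * b) (k * c) (k * d) (k * e) (k * f) (k * g) (k * h) (k * i)) p =
         proj_map (mat3 a b c d e f g h i) p"
    unfolding p(2) using assms(1) by (subst (1 2) proj_map_pt) (auto simp: assms p pt_scale)
qed

lemma invertible_mat1: "invertible (mat 1 :: 'k::field ^ 'n ^ 'n)"
  by (auto simp: invertible_def)

lemma proj_map_mat_1 [simp]: "proj_map (mat 1 :: 'k::field ^ 3 ^ 3) = id"
proof
  fix p :: "'k P2"
  obtain v where "v \<noteq> 0" "p = abs_P2 v"
    by (rule P2_exhaust)
  then show "proj_map (mat 1) p = id p"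
    by (simp add: proj_map_abs invertible_mat1)
qed

lemma mat3_1: "mat3 1 0 0 0 1 0 0 0 1 = (mat 1 :: 'k::field ^ 3 ^ 3)"
  by (simp add: vec_eq_iff forall_3 mat_def)

lemma proj_map_mat3_1 [simp]: "proj_map (mat3 1 0 0 0 1 0 0 0 1) = id"
  by (simp add: mat3_1)

lemma proj_map_inverse:
  fixes A :: "'k::field ^ 3 ^ 3"
  assumes "invertible A"
  obtains B where "invertible B" "proj_map B \<circ> proj_map A = id" "proj_map A \<circ> proj_map B = id"
proof -
  obtain B where "A ** B = mat 1" "B ** A = mat 1"
    using assms by (auto simp: invertible_def)
  moreover from this have "invertible B"
    by (auto simp: invertible_def)
  ultimately show thesis
    using assms that by (simp add: proj_map_comp)
qed

lemma PGL3_simps [simp]: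
  "x \<otimes>\<^bsub>PGL3\<^esub> y = x \<circ> y" "\<one>\<^bsub>PGL3\<^esub> = id"
  by (simp_all add: PGL3_def)

lemma carrier_PGL3: "carrier PGL3 = {proj_map A | A. invertible A}"
  by (simp add: PGL3_def)

lemma group_PGL3: "group (PGL3 :: ('k::field P2 \<Rightarrow> 'k P2) monoid)"
proof (rule groupI)
  fix x y :: "'k P2 \<Rightarrow> 'k P2"
  assume "x \<in> carrier PGL3" "y \<in> carrier PGL3"
  then show "x \<otimes>\<^bsub>PGL3\<^esub> y \<in> carrier PGL3"
    using proj_map_comp invertible_mult by (fastforce simp: carrier_PGL3)
next
  show "\<one>\<^bsub>PGL3\<^esub> \<in> carrier (PGL3 :: ('k P2 \<Rightarrow> 'k P2) monoid)"
    using invertible_mat1 proj_map_mat_1[symmetric] by (force simp: carrier_PGL3)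
next
  fix x :: "'k P2 \<Rightarrow> 'k P2"
  assume "x \<in> carrier PGL3"
  then obtain A where A: "invertible A" "x = proj_map A"
    by (auto simp: carrier_PGL3)
  obtain B where "invertible B" "proj_map B \<circ> proj_map A = id"
    using A(1) by (rule proj_map_inverse)
  with A show "\<exists>y\<in>carrier PGL3. y \<otimes>\<^bsub>PGL3\<^esub> x = \<one>\<^bsub>PGL3\<^esub>"
    by (auto simp: carrier_PGL3)
qed (auto simp: comp_assoc)

lemma PGL3_exhaust:
  assumes "\<tau> \<in> carrier PGL3"
  obtains a b c d e f g h i where
    "invertible (mat3 a b c d e f g h (i :: 'k::field))" "\<tau> = proj_map (mat3 a b c d e f g h i)"
proof -
  obtain A where A: "invertible A" "\<tau> = proj_map A"
    using assms by (auto simp: carrier_PGL3)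
  obtain a b c d e f g h i where "A = mat3 a b c d e f g h i"
    by (rule mat3_exhaust)
  with A that show thesis by blast
qed

section \<open>Automorphisms of a projective set\<close>

lemma homogeneous_const: "homogeneous 0 (\<lambda>v. c)"
  unfolding homogeneous_def by (rule exI[of _ "\<lambda>i j. c"]) simp

lemma homogeneous_linear: "homogeneous 1 (\<lambda>v. a * v $ 1 + b * v $ 2 + c * v $ 3)"
  unfolding homogeneous_def
  \<comment> \<open>In degree 1 only the index pairs (1,0), (0,1), (0,0) occur; the last one carries
    the third variable.\<close>
  by (rule exI[of _ "\<lambda>i j. if i = 1 then a else if j = 1 then b else c"])
     (simp add: atMost_Suc algebra_simps)

lemma regular_on_proj_map:
  assumes "invertible A" "\<And>p. p \<in> E \<Longrightarrow> \<phi> p = proj_map A p"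
  shows "regular_on E \<phi>"
  unfolding regular_on_def
proof (intro allI impI)
  fix u
  assume "u \<noteq> 0 \<and> abs_P2 u \<in> E"
  have "homogeneous 1 (\<lambda>v. (A *v v) $ i)" for i
    using homogeneous_linear[of "A $ i $ 1" "A $ i $ 2" "A $ i $ 3"]
    by (simp add: matrix_vector_mult_def sum_3)
  then show "\<exists>e h d F. homogeneous e h \<and> (\<forall>i. homogeneous d (\<lambda>v. F v $ i)) \<and> h u \<noteq> 0 \<and>
      (\<forall>v. v \<noteq> 0 \<and> abs_P2 v \<in> E \<and> h v \<noteq> 0 \<longrightarrow> F v \<noteq> 0 \<and> \<phi> (abs_P2 v) = abs_P2 (F v))"
    using assms homogeneous_const[of 1]
    \<comment> \<open>One chart covers E: the denominator is the constant form 1 of degree 0, and A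
      v vanishes nowhere because A is invertible.\<close>
    by (intro exI[of _ 0] exI[of _ "\<lambda>v. 1"] exI[of _ 1] exI[of _ "\<lambda>v. A *v v"])
       (auto simp: proj_map_abs)
qed

text \<open>A linear automorphism and its inverse are given by global forms, so regularity is
  automatic and only the set E has to be preserved.\<close>

lemma Aut_down_iff: "\<tau> \<in> Aut_down E \<longleftrightarrow> \<tau> \<in> carrier PGL3 \<and> \<tau> ` E = E"
proof
  assume "\<tau> \<in> Aut_down E"
  then show "\<tau> \<in> carrier PGL3 \<and> \<tau> ` E = E"
    by (auto simp: Aut_down_def Aut_def Bij_def bij_betw_def)
next
  assume \<tau>: "\<tau> \<in> carrier PGL3 \<and> \<tau> ` E = E"
  then obtain A where A: "invertible A" "\<tau> = proj_map A"
    by (auto simp: carrier_PGL3)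
  obtain B where B: "invertible B" "proj_map B \<circ> proj_map A = id"
    using A(1) by (rule proj_map_inverse)
  then have inv: "proj_map B (\<tau> p) = p" for p
    using A(2) by (metis comp_apply id_apply)
  then have "inj \<tau>"
    by (metis injI)
  then have bij: "restrict \<tau> E \<in> Bij E"
    using \<tau> by (auto simp: Bij_def bij_betw_def inj_on_def)
  have "inv_into E (restrict \<tau> E) p = proj_map B p" if "p \<in> E" for p
  proof -
    have "p \<in> \<tau> ` E"
      using \<tau> that by simp
    then obtain q where q: "q \<in> E" "p = \<tau> q"
      by blast
    have "inv_into E (restrict \<tau> E) (restrict \<tau> E q) = q"
      using bij q by (intro inv_into_f_f) (auto simp: Bij_def bij_betw_def)
    with q inv show ?thesis
      by simp
  qed
  then have "regular_on E (inv_into E (restrict \<tau> E))"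
    using B by (intro regular_on_proj_map) auto
  moreover have "regular_on E (restrict \<tau> E)"
    using A by (intro regular_on_proj_map) auto
  ultimately show "\<tau> \<in> Aut_down E"
    using bij \<tau> by (auto simp: Aut_down_def Aut_def)
qed

lemma Aut_down_memD:
  "\<tau> \<in> Aut_down E \<Longrightarrow> p \<in> E \<Longrightarrow> \<tau> p \<in> E"
  by (auto simp: Aut_down_iff)

lemma Aut_up_eq: "Aut_up E = (\<lambda>\<tau>. restrict \<tau> E) ` Aut_down E"
  by (auto simp: Aut_up_def Aut_down_def)

lemma subgroup_Aut_down: "subgroup (Aut_down E) PGL3"
proof -
  interpret group "PGL3 :: ('a P2 \<Rightarrow> 'a P2) monoid"
    by (rule group_PGL3)
  have "id \<in> Aut_down E"
    using one_closed by (simp add: Aut_down_iff)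
  show ?thesis
  proof (rule subgroupI)
    show "Aut_down E \<noteq> {}"
      using \<open>id \<in> Aut_down E\<close> by blast
  next
    fix x
    assume x: "x \<in> Aut_down E"
    then have "inv\<^bsub>PGL3\<^esub> x \<circ> x = id"
      using l_inv[of x] by (simp add: Aut_down_iff)
    then have "(inv\<^bsub>PGL3\<^esub> x) ` x ` E = E"
      by (simp add: image_comp)
    with x show "inv\<^bsub>PGL3\<^esub> x \<in> Aut_down E"
      by (auto simp: Aut_down_iff)
  next
    fix x y
    assume xy: "x \<in> Aut_down E" "y \<in> Aut_down E"
    then have "x \<otimes>\<^bsub>PGL3\<^esub> y \<in> carrier PGL3"
      by (meson Aut_down_iff m_closed)
    with xy show "x \<otimes>\<^bsub>PGL3\<^esub> y \<in> Aut_down E"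
      by (simp only: Aut_down_iff PGL3_simps image_comp[symmetric])
  qed (auto simp: Aut_down_iff)
qed

section \<open>Restriction to E as a group homomorphism\<close>

lemma BijGroup_simps:
  "carrier (BijGroup E) = Bij E" "\<one>\<^bsub>BijGroup E\<^esub> = (\<lambda>x\<in>E. x)"
  "f \<in> Bij E \<Longrightarrow> g \<in> Bij E \<Longrightarrow> f \<otimes>\<^bsub>BijGroup E\<^esub> g = compose E f g"
  by (simp_all add: BijGroup_def)

lemma restrict_hom: "(\<lambda>\<tau>. restrict \<tau> E) \<in> hom (PGL3\<lparr>carrier := Aut_down E\<rparr>) (BijGroup E)"
proof (rule homI)
  fix x y
  assume xy: "x \<in> carrier (PGL3\<lparr>carrier := Aut_down E\<rparr>)" "y \<in> carrier (PGL3\<lparr>carrier := Aut_down E\<rparr>)"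
  then have "restrict x E \<in> Bij E" "restrict y E \<in> Bij E"
    by (auto simp: Aut_down_def Aut_def)
  with xy show "restrict (x \<otimes>\<^bsub>PGL3\<lparr>carrier := Aut_down E\<rparr>\<^esub> y) E = restrict x E \<otimes>\<^bsub>BijGroup E\<^esub> restrict y E"
    by (auto simp: BijGroup_simps compose_def Aut_down_memD)
qed (auto simp: Aut_down_def Aut_def BijGroup_simps)

text \<open>As the image of a homomorphism, the linear maps on E are closed under products and
  inverses; this allows factors to be cancelled in the conditions defining M.\<close>

lemma subgroup_Aut_up: "subgroup (Aut_up E) (BijGroup E)"
proof -
  interpret group_hom "PGL3\<lparr>carrier := Aut_down E\<rparr>" "BijGroup E" "\<lambda>\<tau>. restrict \<tau> E"
    by (intro group_hom.intro group_hom_axioms.intro restrict_hom group_BijGroup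
        group.subgroup_imp_group[OF group_PGL3 subgroup_Aut_down])
  show ?thesis
    using img_is_subgroup by (simp add: Aut_up_eq)
qed

section \<open>The sets Z and M\<close>

lemma Aut_imp_Bij: "\<sigma> \<in> Aut E \<Longrightarrow> \<sigma> \<in> Bij E"
  by (simp add: Aut_def)

lemma Aut_down_restrict_Bij: "\<tau> \<in> Aut_down E \<Longrightarrow> restrict \<tau> E \<in> Bij E"
  by (auto simp: Aut_down_def Aut_def)

lemma compose_eq_iff: "compose E f g = compose E f' g' \<longleftrightarrow> (\<forall>p\<in>E. f (g p) = f' (g' p))"
  by (auto simp: compose_def fun_eq_iff)

lemma Bij_carrier: "\<sigma> \<in> Bij E \<Longrightarrow> \<sigma> \<in> carrier (BijGroup E)"
  by (simp add: BijGroup_simps)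

lemma Bij_mem: "\<sigma> \<in> Bij E \<Longrightarrow> p \<in> E \<Longrightarrow> \<sigma> p \<in> E"
  using Bij_imp_funcset by fastforce

text \<open>Allowing \<rho> to differ from \<tau> expresses that \<sigma> \<tau> \<sigma>^-1 is
  linear; \<rho> = \<tau> is the condition for Z.\<close>

lemma commute_BijGroup_iff:
  assumes "\<sigma> \<in> Bij E" "\<tau> \<in> Aut_down E" "\<rho> \<in> Aut_down E"
  shows "\<sigma> \<otimes>\<^bsub>BijGroup E\<^esub> restrict \<tau> E = restrict \<rho> E \<otimes>\<^bsub>BijGroup E\<^esub> \<sigma> \<longleftrightarrow>
    (\<forall>p\<in>E. \<sigma> (\<tau> p) = \<rho> (\<sigma> p))"
  using assms by (simp add: BijGroup_simps compose_eq_iff Aut_down_restrict_Bij Bij_mem)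

lemma Z_set_iff:
  assumes "\<sigma> \<in> Bij E"
  shows "\<tau> \<in> Z_set E \<sigma> \<longleftrightarrow> \<tau> \<in> Aut_down E \<and> (\<forall>p\<in>E. \<sigma> (\<tau> p) = \<tau> (\<sigma> p))"
proof (cases "\<tau> \<in> Aut_down E")
  case True
  interpret group "BijGroup E"
    by (rule group_BijGroup)
  let ?t = "restrict \<tau> E"
  have "\<sigma> \<otimes>\<^bsub>BijGroup E\<^esub> ?t \<otimes>\<^bsub>BijGroup E\<^esub> inv\<^bsub>BijGroup E\<^esub> \<sigma> = ?t \<longleftrightarrow>
      \<sigma> \<otimes>\<^bsub>BijGroup E\<^esub> ?t = ?t \<otimes>\<^bsub>BijGroup E\<^esub> \<sigma>"
    using assms True by (intro inv_solve_right' m_closed Bij_carrier Aut_down_restrict_Bij)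
  then show ?thesis
    using assms True by (simp add: Z_set_def commute_BijGroup_iff)
qed (auto simp: Z_set_def)

text \<open>With x the restriction of \<tau> and y = \<sigma>, the members of the family defining M
  become plain powers of \<tau> as soon as the two commute.\<close>

lemma (in group) commuting_mult_int_pow:
  assumes "x \<in> carrier G" "y \<in> carrier G" "x \<otimes> y = y \<otimes> x"
  shows "(x \<otimes> y) [^] i \<otimes> y [^] (- i) = x [^] (i :: int)"
  unfolding int_pow_mult_distrib[OF assms(3,1,2)] using assms(1,2) by (simp add: m_assoc int_pow_neg)

lemma (in group) square_mult_int_pow:
  assumes "x \<in> carrier G" "y \<in> carrier G"
  shows "(x \<otimes> y) [^] (2 :: int) \<otimes> y [^] (- 2 :: int) = x \<otimes> (y \<otimes> x \<otimes> inv y)"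
proof -
  have sq: "z [^] (2 :: int) = z \<otimes> z" if "z \<in> carrier G" for z
    using that int_pow_mult[of z 1 1] by simp
  have "y [^] (- 2 :: int) = inv y \<otimes> inv y"
    using assms by (simp add: int_pow_neg sq inv_mult_group)
  then show ?thesis
    using assms by (simp add: sq m_assoc) (simp add: assms flip: m_assoc)
qed

text \<open>Cancelling \<tau> inside the group of linear maps leaves its conjugate alone;
  multiplying by \<sigma> then turns this into an identity between points.\<close>

lemma M_setD:
  assumes "\<sigma> \<in> Bij E" "\<tau> \<in> M_set E \<sigma>"
  obtains \<rho> where "\<rho> \<in> Aut_down E" "\<And>p. p \<in> E \<Longrightarrow> \<sigma> (\<tau> p) = \<rho> (\<sigma> p)"
proof -
  interpret group "BijGroup E"
    by (rule group_BijGroup)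
  interpret U: subgroup "Aut_up E" "BijGroup E"
    by (rule subgroup_Aut_up)
  let ?t = "restrict \<tau> E" and ?s = "\<sigma> \<otimes>\<^bsub>BijGroup E\<^esub> restrict \<tau> E \<otimes>\<^bsub>BijGroup E\<^esub> inv\<^bsub>BijGroup E\<^esub> \<sigma>"
  have \<tau>: "\<tau> \<in> Aut_down E"
    using assms(2) by (simp add: M_set_def)
  then have t: "?t \<in> Aut_up E"
    by (auto simp: Aut_up_eq)
  have s: "\<sigma> \<in> carrier (BijGroup E)"
    using assms by (intro Bij_carrier)
  have "(?t \<otimes>\<^bsub>BijGroup E\<^esub> \<sigma>) [^]\<^bsub>BijGroup E\<^esub> (2::int) \<otimes>\<^bsub>BijGroup E\<^esub> \<sigma> [^]\<^bsub>BijGroup E\<^esub> (- 2 :: int) \<in> Aut_up E"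
    using assms(2) unfolding M_set_def by blast
  then have "?t \<otimes>\<^bsub>BijGroup E\<^esub> ?s \<in> Aut_up E"
    using t s by (simp add: square_mult_int_pow)
  then have "inv\<^bsub>BijGroup E\<^esub> ?t \<otimes>\<^bsub>BijGroup E\<^esub> (?t \<otimes>\<^bsub>BijGroup E\<^esub> ?s) \<in> Aut_up E"
    using t by blast
  then have "?s \<in> Aut_up E"
    using t s by (simp flip: m_assoc)
  then obtain \<rho> where \<rho>: "\<rho> \<in> Aut_down E" "?s = restrict \<rho> E"
    by (auto simp: Aut_up_eq)
  have "\<sigma> \<otimes>\<^bsub>BijGroup E\<^esub> ?t = restrict \<rho> E \<otimes>\<^bsub>BijGroup E\<^esub> \<sigma>"
    using t s by (simp add: m_assoc flip: \<rho>(2))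
  then show thesis
    using that \<rho>(1) \<tau> assms(1) by (simp add: commute_BijGroup_iff)
qed

lemma Z_subset_M:
  assumes "\<sigma> \<in> Bij E"
  shows "Z_set E \<sigma> \<subseteq> M_set E \<sigma>"
proof
  interpret group "BijGroup E"
    by (rule group_BijGroup)
  fix \<tau>
  assume \<tau>: "\<tau> \<in> Z_set E \<sigma>"
  let ?t = "restrict \<tau> E"
  have t: "\<tau> \<in> Aut_down E" "?t \<in> Aut_up E" "?t \<in> carrier (BijGroup E)"
    using \<tau> by (auto simp: Z_set_def Aut_up_eq intro!: Bij_carrier Aut_down_restrict_Bij)
  have "?t \<otimes>\<^bsub>BijGroup E\<^esub> \<sigma> = \<sigma> \<otimes>\<^bsub>BijGroup E\<^esub> ?t"
    using \<tau> t assms by (intro commute_BijGroup_iff[THEN iffD2, symmetric]) (auto simp: Z_set_iff)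
  then have "(?t \<otimes>\<^bsub>BijGroup E\<^esub> \<sigma>) [^]\<^bsub>BijGroup E\<^esub> i \<otimes>\<^bsub>BijGroup E\<^esub> \<sigma> [^]\<^bsub>BijGroup E\<^esub> (- i)
      = ?t [^]\<^bsub>BijGroup E\<^esub> i" for i :: int
    using t assms by (intro commuting_mult_int_pow) (auto intro: Bij_carrier)
  moreover have "?t [^]\<^bsub>BijGroup E\<^esub> i \<in> Aut_up E" for i :: int
    using t subgroup_int_pow_closed[OF subgroup_Aut_up] by blast
  ultimately show "\<tau> \<in> M_set E \<sigma>"
    using t by (simp add: M_set_def)
qed

text \<open>The member \<open>i = 2\<close> of the family defining \<open>M\<close> says that \<open>\<sigma> \<tau> \<sigma>\<^sup>-\<^sup>1\<close> is again linear;
  when this already forces \<open>\<tau>\<close> and \<open>\<sigma>\<close> to commute, \<open>Z\<close> and \<open>M\<close> coincide.\<close>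

lemma Z_M_eq_if_rigid:
  assumes \<sigma>: "\<sigma> \<in> Bij E"
    and "K \<subseteq> Aut_down E"
    and "\<And>\<tau> p. \<tau> \<in> K \<Longrightarrow> p \<in> E \<Longrightarrow> \<sigma> (\<tau> p) = \<tau> (\<sigma> p)"
    and rigid: "\<And>\<tau> \<rho>. \<tau> \<in> Aut_down E \<Longrightarrow> \<rho> \<in> Aut_down E \<Longrightarrow>
      (\<And>p. p \<in> E \<Longrightarrow> \<sigma> (\<tau> p) = \<rho> (\<sigma> p)) \<Longrightarrow> \<tau> \<in> K"
  shows "Z_set E \<sigma> = K" "M_set E \<sigma> = K"
proof -
  have "K \<subseteq> Z_set E \<sigma>"
    using assms by (auto simp: Z_set_iff)
  moreover have "Z_set E \<sigma> \<subseteq> M_set E \<sigma>"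
    using \<sigma> by (rule Z_subset_M)
  moreover have "M_set E \<sigma> \<subseteq> K"
  proof
    fix \<tau>
    assume \<tau>: "\<tau> \<in> M_set E \<sigma>"
    then have "\<tau> \<in> Aut_down E"
      by (simp add: M_set_def)
    with \<tau> show "\<tau> \<in> K"
      using M_setD[OF \<sigma>] rigid by metis
  qed
  ultimately show "Z_set E \<sigma> = K" "M_set E \<sigma> = K"
    by auto
qed

section \<open>Powers of a bijection of E\<close>

lemma BijGroup_pow_closed:
  assumes "\<sigma> \<in> Bij E"
  shows "\<sigma> [^]\<^bsub>BijGroup E\<^esub> (n::nat) \<in> Bij E"
proof -
  interpret group "BijGroup E"
    by (rule group_BijGroup)
  show ?thesis
    using nat_pow_closed[OF Bij_carrier[OF assms], of n] by (simp add: BijGroup_simps)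
qed

text \<open>Explicit formulas are available for iterates of functions. The two notions are compared
  on E only, since powers in \<open>BijGroup\<close> are undefined elsewhere.\<close>

lemma BijGroup_pow_apply:
  assumes "\<sigma> \<in> Bij E" "p \<in> E"
  shows "(\<sigma> [^]\<^bsub>BijGroup E\<^esub> (n::nat)) p = (\<sigma> ^^ n) p"
proof -
  interpret group "BijGroup E"
    by (rule group_BijGroup)
  show ?thesis
    using assms(2)
  proof (induction n arbitrary: p)
    case (Suc n)
    then show ?case
      using assms(1)
      by (simp add: BijGroup_simps BijGroup_pow_closed Bij_mem compose_def funpow_swap1)
  qed (simp add: BijGroup_simps)
qed

lemma BijGroup_pow_eq_one_iff:
  assumes "\<sigma> \<in> Bij E"
  shows "\<sigma> [^]\<^bsub>BijGroup E\<^esub> (n::nat) = \<one>\<^bsub>BijGroup E\<^esub> \<longleftrightarrow> (\<forall>p\<in>E. (\<sigma> ^^ n) p = p)"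
proof -
  have ext: "\<sigma> [^]\<^bsub>BijGroup E\<^esub> n \<in> extensional E"
    using BijGroup_pow_closed[OF assms] by (rule Bij_imp_extensional)
  have "\<sigma> [^]\<^bsub>BijGroup E\<^esub> n = (\<lambda>x\<in>E. x) \<longleftrightarrow> (\<forall>p\<in>E. (\<sigma> [^]\<^bsub>BijGroup E\<^esub> n) p = p)"
  proof
    assume "\<forall>p\<in>E. (\<sigma> [^]\<^bsub>BijGroup E\<^esub> n) p = p"
    then show "\<sigma> [^]\<^bsub>BijGroup E\<^esub> n = (\<lambda>x\<in>E. x)"
      by (intro extensionalityI[OF ext restrict_extensional]) simp
  qed simp
  with assms show ?thesis
    by (simp add: BijGroup_pow_apply BijGroup_simps(2))
qed

lemma (in group) commuting_int_pow:
  assumes "x \<in> carrier G" "y \<in> carrier G" "x \<otimes> y = y \<otimes> x"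
  shows "x \<otimes> y [^] i = y [^] (i :: int) \<otimes> x"
proof (cases "i \<ge> 0")
  case True
  have "y [^] nat i \<otimes> x = x \<otimes> y [^] nat i"
    by (rule group_commutes_pow[OF assms(3)[symmetric] assms(2,1)])
  with True show ?thesis
    by (simp only: int_pow_def2 not_less[symmetric] if_False)
next
  case False
  let ?z = "y [^] nat (- i)"
  have z: "?z \<in> carrier G"
    using assms by simp
  have zx: "?z \<otimes> x = x \<otimes> ?z"
    using assms(3)[symmetric] assms(2,1) by (rule group_commutes_pow)
  \<comment> \<open>For a negative exponent, z^-1 z is inserted in front of x and the natural power
    z is moved across.\<close>
  have "x \<otimes> inv ?z = inv ?z \<otimes> (?z \<otimes> x) \<otimes> inv ?z"
    by (simp add: z assms(1) flip: m_assoc)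
  also have "\<dots> = inv ?z \<otimes> (x \<otimes> ?z) \<otimes> inv ?z"
    by (simp only: zx)
  also have "\<dots> = inv ?z \<otimes> x"
    by (simp add: m_assoc z assms(1))
  finally show ?thesis
    using False by (simp only: int_pow_def2 not_le if_True)
qed

text \<open>From s t s = t follows (t s)^2 = t (s t s) = t^2. Even powers of t s are thus powers of
  t, and odd ones are a power of t times s. Once this single s is cancelled against s^-i, only
  powers of s^2 remain, so t and s^2 in U suffice.\<close>

lemma (in group) inverting_mult_int_pow:
  fixes i :: int
  assumes "subgroup U G" "t \<in> U" "s \<in> carrier G" "s \<otimes> t \<otimes> s = t" "s \<otimes> s \<in> U"
  shows "(t \<otimes> s) [^] i \<otimes> s [^] (- i) \<in> U"
proof -
  interpret U: subgroup U G by fact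
  have t: "t \<in> carrier G"
    using assms(2) by (rule U.mem_carrier)
  note ts = t \<open>s \<in> carrier G\<close>
  define b where "b = t \<otimes> t"
  have b: "b [^] j \<in> carrier G" "b \<in> carrier G" "b [^] j \<in> U" for j :: int
    using assms t by (auto simp: b_def intro!: subgroup_int_pow_closed)
  have ss: "(s \<otimes> s) [^] j \<in> U" for j :: int
    using assms by (auto intro!: subgroup_int_pow_closed)
  have sq: "(t \<otimes> s) \<otimes> (t \<otimes> s) = b"
    unfolding b_def using ts assms(4) by (simp add: m_assoc)
  \<comment> \<open>t^2 commutes with s although t need not: writing t^2 as (t s)^2 lets the
    relation s t s = t apply at the front.\<close>
  have bs: "s \<otimes> b = b \<otimes> s"
  proof -
    have "s \<otimes> b = s \<otimes> ((t \<otimes> s) \<otimes> (t \<otimes> s))"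
      by (simp only: sq)
    also have "\<dots> = (s \<otimes> t \<otimes> s) \<otimes> t \<otimes> s"
      using ts by (simp add: m_assoc)
    also have "\<dots> = b \<otimes> s"
      unfolding assms(4) b_def ..
    finally show ?thesis .
  qed
  have two: "x [^] (2 * j) = (x \<otimes> x) [^] j" if "x \<in> carrier G" for x and j :: int
    using that int_pow_pow[of x 2 j] int_pow_mult[of x 1 1] by simp
  consider j where "i = 2 * j" | j where "i = 2 * j + 1"
    by (cases "Parity.even i") (auto elim!: evenE oddE)
  then show ?thesis
  proof cases
    case 1
    have "(t \<otimes> s) [^] i \<otimes> s [^] (- i) = b [^] j \<otimes> (s \<otimes> s) [^] (- j)"
      using ts two[of s "- j"] by (simp add: 1 two sq)
    then show ?thesis
      using b ss by simp
  next
    case 2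
    have "(t \<otimes> s) [^] (1 + 2 * j) = t \<otimes> s \<otimes> b [^] j"
      using ts by (subst int_pow_mult) (simp_all add: two sq)
    also have "\<dots> = t \<otimes> b [^] j \<otimes> s"
      using ts b commuting_int_pow[OF _ _ bs, of j] by (simp add: m_assoc)
    finally have 3: "(t \<otimes> s) [^] i = t \<otimes> b [^] j \<otimes> s"
      by (simp add: 2 add.commute)
    \<comment> \<open>The odd exponent is split with -1 in front so that s^-1 meets the s left over
      from (t s)^i.\<close>
    have "s [^] (- 1 + 2 * (- j)) = inv s \<otimes> (s \<otimes> s) [^] (- j)"
      using ts by (subst int_pow_mult) (simp_all only: two, simp_all add: int_pow_neg)
    moreover have "- i = - 1 + 2 * (- j)"
      by (simp add: 2)
    ultimately have 4: "s [^] (- i) = inv s \<otimes> (s \<otimes> s) [^] (- j)"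
      by (simp only:)
    have "s \<otimes> (inv s \<otimes> (s \<otimes> s) [^] (- j)) = (s \<otimes> s) [^] (- j)"
      using ts by (simp flip: m_assoc)
    then have "(t \<otimes> s) [^] i \<otimes> s [^] (- i) = t \<otimes> b [^] j \<otimes> (s \<otimes> s) [^] (- j)"
      unfolding 3 4 using ts b by (simp add: m_assoc)
    then show ?thesis
      using b ss assms(2) by simp
  qed
qed

lemma Aut_down_comp: "\<tau> \<in> Aut_down E \<Longrightarrow> \<rho> \<in> Aut_down E \<Longrightarrow> \<tau> \<circ> \<rho> \<in> Aut_down E"
  using subgroup.m_closed[OF subgroup_Aut_down, of \<tau> E \<rho>] by simp

lemma Aut_down_inverse:
  assumes "\<tau> \<in> Aut_down E"
  obtains \<tau>' where "\<tau>' \<in> Aut_down E" "\<And>p. \<tau>' (\<tau> p) = p"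
proof
  have \<tau>: "\<tau> \<in> carrier PGL3"
    using assms by (simp add: Aut_down_iff)
  show "inv\<^bsub>PGL3\<^esub> \<tau> \<in> Aut_down E"
    using subgroup_Aut_down assms by (rule subgroup.m_inv_closed)
  have "inv\<^bsub>PGL3\<^esub> \<tau> \<circ> \<tau> = id"
    using group.l_inv[OF group_PGL3 \<tau>] by simp
  then show "(inv\<^bsub>PGL3\<^esub> \<tau>) (\<tau> p) = p" for p
    by (metis comp_apply id_apply)
qed

text \<open>If every linear automorphism of \<open>E\<close> outside \<open>K\<close> conjugates \<open>\<sigma>\<close> to its inverse, then such
  an automorphism lies in \<open>Z\<close> iff \<open>\<sigma>\<^sup>2 = id\<close>, and in \<open>M\<close> iff \<open>\<sigma>\<^sup>2\<close> is linear.\<close>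

lemma Z_M_if_commute_or_invert:
  assumes \<sigma>: "\<sigma> \<in> Bij E"
    and K: "K \<subseteq> Aut_down E" "\<And>\<tau> p. \<tau> \<in> K \<Longrightarrow> p \<in> E \<Longrightarrow> \<sigma> (\<tau> p) = \<tau> (\<sigma> p)"
    and inv: "\<And>\<tau> p. \<tau> \<in> Aut_down E - K \<Longrightarrow> p \<in> E \<Longrightarrow> \<sigma> (\<tau> (\<sigma> p)) = \<tau> p"
    and lin: "(\<exists>\<rho>\<in>Aut_down E. \<forall>p\<in>E. \<rho> p = \<sigma> (\<sigma> p)) \<longleftrightarrow>
      \<sigma> [^]\<^bsub>BijGroup E\<^esub> (6::nat) = \<one>\<^bsub>BijGroup E\<^esub>"
  shows "\<sigma> [^]\<^bsub>BijGroup E\<^esub> (2::nat) \<noteq> \<one>\<^bsub>BijGroup E\<^esub> \<Longrightarrow> Z_set E \<sigma> = K"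
    "\<sigma> [^]\<^bsub>BijGroup E\<^esub> (2::nat) = \<one>\<^bsub>BijGroup E\<^esub> \<Longrightarrow> Z_set E \<sigma> = Aut_down E"
    "\<sigma> [^]\<^bsub>BijGroup E\<^esub> (6::nat) \<noteq> \<one>\<^bsub>BijGroup E\<^esub> \<Longrightarrow> M_set E \<sigma> = K"
    "\<sigma> [^]\<^bsub>BijGroup E\<^esub> (6::nat) = \<one>\<^bsub>BijGroup E\<^esub> \<Longrightarrow> M_set E \<sigma> = Aut_down E"
proof -
  interpret group "BijGroup E"
    by (rule group_BijGroup)
  have two: "\<sigma> [^]\<^bsub>BijGroup E\<^esub> (2::nat) = \<one>\<^bsub>BijGroup E\<^esub> \<longleftrightarrow> (\<forall>p\<in>E. \<sigma> (\<sigma> p) = p)"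
    using BijGroup_pow_eq_one_iff[OF \<sigma>, of 2] by (simp add: numeral_2_eq_2)
  have inj: "inj_on \<sigma> E" and \<sigma>_onto: "\<sigma> ` E = E"
    using \<sigma> by (auto simp: Bij_def bij_betw_def)
  have KZ: "K \<subseteq> Z_set E \<sigma>"
    using K \<sigma> by (auto simp: Z_set_iff)
  have ZM: "Z_set E \<sigma> \<subseteq> M_set E \<sigma>"
    using \<sigma> by (rule Z_subset_M)
  have ZA: "Z_set E \<sigma> \<subseteq> Aut_down E" and MA: "M_set E \<sigma> \<subseteq> Aut_down E"
    by (auto simp: Z_set_def M_set_def)
  show "Z_set E \<sigma> = K" if "\<sigma> [^]\<^bsub>BijGroup E\<^esub> (2::nat) \<noteq> \<one>\<^bsub>BijGroup E\<^esub>"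
  proof (rule ccontr)
    assume "Z_set E \<sigma> \<noteq> K"
    then obtain \<tau> where \<tau>: "\<tau> \<in> Z_set E \<sigma>" "\<tau> \<notin> K"
      using KZ by auto
    \<comment> \<open>A map that both commutes with \<sigma> and inverts it satisfies \<sigma>^2
      \<tau> = \<tau> on E, and \<tau> is onto E.\<close>
    have "\<sigma> (\<sigma> q) = q" if "q \<in> E" for q
    proof -
      have "q \<in> \<tau> ` E"
        using \<tau>(1) ZA that by (auto simp: Aut_down_iff)
      then obtain p where p: "p \<in> E" "q = \<tau> p"
        by blast
      have "\<sigma> (\<tau> (\<sigma> p)) = \<sigma> (\<sigma> (\<tau> p))"
        using \<tau>(1) \<sigma> p by (simp add: Z_set_iff)
      with inv[of \<tau> p] \<tau> ZA p show ?thesis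
        by auto
    qed
    with that two show False by blast
  qed
  show "Z_set E \<sigma> = Aut_down E" if "\<sigma> [^]\<^bsub>BijGroup E\<^esub> (2::nat) = \<one>\<^bsub>BijGroup E\<^esub>"
  proof
    show "Aut_down E \<subseteq> Z_set E \<sigma>"
    proof
      fix \<tau>
      assume \<tau>: "\<tau> \<in> Aut_down E"
      show "\<tau> \<in> Z_set E \<sigma>"
      proof (cases "\<tau> \<in> K")
        case False
        have "\<sigma> (\<tau> p) = \<tau> (\<sigma> p)" if "p \<in> E" for p
          using inv[of \<tau> "\<sigma> p"] \<tau> False two \<open>\<sigma> [^]\<^bsub>BijGroup E\<^esub> 2 = _\<close> that \<sigma>
          by (simp add: Bij_mem)
        with \<tau> show ?thesis
          using \<sigma> by (simp add: Z_set_iff)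
      qed (use KZ in blast)
    qed
  qed (rule ZA)
  have lin': "\<sigma> \<otimes>\<^bsub>BijGroup E\<^esub> \<sigma> \<in> Aut_up E \<longleftrightarrow> (\<exists>\<rho>\<in>Aut_down E. \<forall>p\<in>E. \<rho> p = \<sigma> (\<sigma> p))"
  proof -
    have "restrict \<rho> E = compose E \<sigma> \<sigma> \<longleftrightarrow> (\<forall>p\<in>E. \<rho> p = \<sigma> (\<sigma> p))" for \<rho>
      unfolding compose_def using restrict_apply' restrict_ext by metis
    then show ?thesis
      using \<sigma> by (simp add: Aut_up_eq BijGroup_simps image_iff eq_commute[of "compose E \<sigma> \<sigma>"])
  qed
  show "M_set E \<sigma> = K" if "\<sigma> [^]\<^bsub>BijGroup E\<^esub> (6::nat) \<noteq> \<one>\<^bsub>BijGroup E\<^esub>"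
  proof (rule ccontr)
    assume "M_set E \<sigma> \<noteq> K"
    then obtain \<tau> where \<tau>: "\<tau> \<in> M_set E \<sigma>" "\<tau> \<in> Aut_down E - K"
      using KZ ZM MA by blast
    obtain \<rho> where \<rho>: "\<rho> \<in> Aut_down E" "\<And>p. p \<in> E \<Longrightarrow> \<sigma> (\<tau> p) = \<rho> (\<sigma> p)"
      using M_setD[OF \<sigma> \<tau>(1)] by metis
    obtain \<rho>' where \<rho>': "\<rho>' \<in> Aut_down E" "\<And>p. \<rho>' (\<rho> p) = p"
      using Aut_down_inverse[OF \<rho>(1)] by metis
    \<comment> \<open>The relations \<sigma> \<tau> \<sigma> = \<tau> and \<sigma> \<tau> = \<rho>
      \<sigma> give \<rho> \<sigma>^2 = \<tau>, so \<rho>^-1 \<tau> is a linear map agreeing with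
      \<sigma>^2.\<close>
    have "(\<rho>' \<circ> \<tau>) p = \<sigma> (\<sigma> p)" if "p \<in> E" for p
      using \<rho>(2)[of "\<sigma> p"] inv[OF \<tau>(2) that] \<rho>'(2)[of "\<sigma> (\<sigma> p)"] that \<sigma> by (simp add: Bij_mem)
    moreover have "\<rho>' \<circ> \<tau> \<in> Aut_down E"
      using \<rho>' \<tau> by (simp add: Aut_down_comp)
    ultimately show False
      using lin that by blast
  qed
  show "M_set E \<sigma> = Aut_down E" if six: "\<sigma> [^]\<^bsub>BijGroup E\<^esub> (6::nat) = \<one>\<^bsub>BijGroup E\<^esub>"
  proof
    show "Aut_down E \<subseteq> M_set E \<sigma>"
    proof
      fix \<tau>
      assume \<tau>: "\<tau> \<in> Aut_down E"
      show "\<tau> \<in> M_set E \<sigma>"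
      proof (cases "\<tau> \<in> K")
        case False
        let ?t = "restrict \<tau> E"
        have t: "?t \<in> Bij E"
          using \<tau> by (rule Aut_down_restrict_Bij)
        have "compose E (compose E \<sigma> ?t) \<sigma> = ?t"
          using inv[of \<tau>] \<tau> False \<sigma> by (auto simp: compose_def fun_eq_iff Bij_mem)
        then have "\<sigma> \<otimes>\<^bsub>BijGroup E\<^esub> ?t \<otimes>\<^bsub>BijGroup E\<^esub> \<sigma> = ?t"
          using \<sigma> t by (simp add: BijGroup_simps compose_Bij)
        moreover have "\<sigma> \<otimes>\<^bsub>BijGroup E\<^esub> \<sigma> \<in> Aut_up E"
          using lin six lin' by blast
        moreover have "?t \<in> Aut_up E"
          using \<tau> by (simp add: Aut_up_eq)
        ultimately show ?thesis
          using \<tau> \<sigma> unfolding M_set_def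
          by (blast intro: inverting_mult_int_pow[OF subgroup_Aut_up] Bij_carrier)
      qed (use KZ ZM in blast)
    qed
  qed (rule MA)
qed

section \<open>Semidirect products and cyclic subgroups\<close>

text \<open>Conjugation by n h is conjugation by h followed by conjugation by n, and N absorbs the
  latter; hence normality in K only has to be checked against H.\<close>

lemma (in group) semidirectI:
  assumes N: "subgroup N G" and H: "subgroup H G"
    and conj: "\<And>n h. n \<in> N \<Longrightarrow> h \<in> H \<Longrightarrow> h \<otimes> n \<otimes> inv h \<in> N"
    and NH: "N \<inter> H = {\<one>}" "K = N <#> H"
  shows "semidirect G K N H"
proof -
  interpret N: subgroup N G by fact
  interpret H: subgroup H G by fact
  note [simp] = N.mem_carrier H.mem_carrier
  have K: "x \<in> K \<longleftrightarrow> (\<exists>n\<in>N. \<exists>h\<in>H. x = n \<otimes> h)" for x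
    unfolding NH set_mult_def by auto
  have subK: "subgroup K G"
  proof (rule subgroupI)
    show "K \<subseteq> carrier G"
      by (auto simp: K)
    have "\<one> \<otimes> \<one> \<in> K"
      unfolding K using N.one_closed H.one_closed by blast
    then show "K \<noteq> {}"
      by blast
  next
    fix x
    assume "x \<in> K"
    then obtain n h where x: "n \<in> N" "h \<in> H" "x = n \<otimes> h"
      by (auto simp: K)
    have "inv x = (inv h \<otimes> inv n \<otimes> inv (inv h)) \<otimes> inv h"
      unfolding x(3) using x(1,2) by (simp add: inv_mult_group m_assoc)
    moreover have "inv h \<otimes> inv n \<otimes> inv (inv h) \<in> N"
      using x(1,2) by (intro conj) auto
    ultimately show "inv x \<in> K"
      unfolding K using x(2) by blast
  next
    fix x y
    assume "x \<in> K" "y \<in> K"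
    then obtain n h n' h' where x: "n \<in> N" "h \<in> H" "x = n \<otimes> h" "n' \<in> N" "h' \<in> H" "y = n' \<otimes> h'"
      by (auto simp: K)
    have "(n \<otimes> (h \<otimes> n' \<otimes> inv h)) \<otimes> (h \<otimes> h') = n \<otimes> h \<otimes> n' \<otimes> (inv h \<otimes> h) \<otimes> h'"
      using x(1,2,4,5) by (simp only: m_assoc N.mem_carrier H.mem_carrier m_closed inv_closed)
    then have "x \<otimes> y = (n \<otimes> (h \<otimes> n' \<otimes> inv h)) \<otimes> (h \<otimes> h')"
      unfolding x(3,6) using x(1,2,4,5) by (simp add: m_assoc)
    moreover have "n \<otimes> (h \<otimes> n' \<otimes> inv h) \<in> N" "h \<otimes> h' \<in> H"
      using x conj by auto
    ultimately show "x \<otimes> y \<in> K"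
      unfolding K by blast
  qed
  interpret K: subgroup K G by (rule subK)
  have "N \<subseteq> K"
  proof
    fix n
    assume "n \<in> N"
    then have "n = n \<otimes> \<one>"
      by simp
    with \<open>n \<in> N\<close> show "n \<in> K"
      unfolding K using H.one_closed by blast
  qed
  moreover have "x \<otimes> m \<otimes> inv x \<in> N" if xm: "x \<in> K" "m \<in> N" for x m
  proof -
    obtain n h where x: "n \<in> N" "h \<in> H" "x = n \<otimes> h"
      using xm(1) unfolding K by blast
    have "x \<otimes> m \<otimes> inv x = n \<otimes> (h \<otimes> m \<otimes> inv h) \<otimes> inv n"
      unfolding x(3) using x(1,2) xm(2) by (simp add: inv_mult_group m_assoc)
    also have "\<dots> \<in> N"
      using x(1,2) xm(2) conj by auto
    finally show ?thesis .
  qed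
  ultimately have "N \<lhd> G\<lparr>carrier := K\<rparr>"
    by (subst group.normal_inv_iff[OF subgroup_imp_group[OF subK]])
       (simp add: subgroup_incl N subK m_inv_consistent)
  with subK H NH show ?thesis
    by (simp add: semidirect_def)
qed

lemma (in group) generate_order_2:
  assumes "c \<in> carrier G" "c \<otimes> c = \<one>"
  shows "generate G {c} = {\<one>, c}"
proof -
  have "inv c = c"
    using assms by (intro inv_equality)
  then have "subgroup {\<one>, c} G"
    using assms by (intro subgroupI) auto
  then show ?thesis
    using generate.incl[of c "{c}" G] generate.one[of G "{c}"]
    by (intro subset_antisym generate_subgroup_incl) auto
qed

lemma (in group) generate_order_3:
  assumes "c \<in> carrier G" "c \<otimes> c \<otimes> c = \<one>"
  shows "generate G {c} = {\<one>, c, c \<otimes> c}"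
proof -
  have c3: "c \<otimes> (c \<otimes> c) = \<one>"
    using assms by (simp add: m_assoc)
  then have c4: "c \<otimes> (c \<otimes> (c \<otimes> c)) = c"
    using assms(1) by simp
  have "inv c = c \<otimes> c"
    using assms by (intro inv_equality) auto
  moreover have "inv (c \<otimes> c) = c"
    using assms c3 by (intro inv_equality) auto
  ultimately have "subgroup {\<one>, c, c \<otimes> c} G"
    using assms(1) c3 c4 by (intro subgroupI) (auto simp: m_assoc)
  moreover have "c \<otimes> c \<in> generate G {c}"
    by (intro generate.eng generate.incl) simp_all
  ultimately show ?thesis
    using generate.incl[of c "{c}" G] generate.one[of G "{c}"]
    by (intro subset_antisym generate_subgroup_incl) auto
qed

lemma subgroup_PGL3I:
  assumes "N \<subseteq> carrier PGL3" "id \<in> N" "\<And>x y. x \<in> N \<Longrightarrow> y \<in> N \<Longrightarrow> x \<circ> y \<in> N"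
    and "\<And>x. x \<in> N \<Longrightarrow> \<exists>y\<in>N. y \<circ> x = id"
  shows "subgroup N PGL3"
proof -
  interpret group PGL3
    by (rule group_PGL3)
  show ?thesis
  proof (rule subgroupI)
    fix x
    assume "x \<in> N"
    then obtain y where y: "y \<in> N" "y \<circ> x = id"
      using assms(4) by blast
    then have "inv\<^bsub>PGL3\<^esub> x = y"
      using \<open>x \<in> N\<close> assms(1) by (intro inv_equality) auto
    with y show "inv\<^bsub>PGL3\<^esub> x \<in> N"
      by simp
  qed (use assms in auto)
qed

section \<open>Sets given by equations\<close>

text \<open>\<open>zero_locus\<close> only asks for some representative that solves the equation;
  homogeneity transfers this to every representative.\<close>

lemma pt_mem_zero_locus:
  assumes "\<And>k x y z. F (k * x) (k * y) (k * z) = k ^ n * F x y z" "(x, y, z) \<noteq> (0, 0, 0)"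
  shows "pt x y z \<in> zero_locus F \<longleftrightarrow> F x y z = (0 :: 'k::field)"
proof
  assume "pt x y z \<in> zero_locus F"
  then obtain x' y' z' where *: "(x', y', z') \<noteq> (0, 0, 0)" "F x' y' z' = 0" "pt x' y' z' = pt x y z"
    by (force simp: zero_locus_def)
  then have "proportional (vector [x', y', z']) (vector [x, y, z])"
    using assms(2) by (subst (asm) abs_P2_eq_iff) auto
  then obtain k where "k \<noteq> 0" "x = k * x'" "y = k * y'" "z = k * z'"
    by (auto simp: proportional_def)
  with assms(1) *(2) show "F x y z = 0"
    by simp
qed (use assms in \<open>auto simp: zero_locus_def\<close>)

text \<open>P is preserved in both directions, so the preimage of a point of E under the matrix lies
  in E as well and the image is all of E.\<close>

lemma proj_map_in_Aut_down:
  assumes inv: "invertible (mat3 a b c d e f g h i)"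
    and E: "\<And>x y z. (x, y, z) \<noteq> (0, 0, 0) \<Longrightarrow> pt x y z \<in> E \<longleftrightarrow> P x y z"
    and P: "\<And>x y z. P (a * x + b * y + c * z) (d * x + e * y + f * z) (g * x + h * y + i * z) \<longleftrightarrow> P x y (z :: 'k::field)"
  shows "proj_map (mat3 a b c d e f g h i) \<in> Aut_down E"
proof -
  let ?A = "mat3 a b c d e f g h i"
  have mem: "proj_map ?A p \<in> E \<longleftrightarrow> p \<in> E" for p
  proof -
    obtain x y z where p: "(x, y, z) \<noteq> (0, 0, 0)" "p = pt x y z"
      by (rule pt_exhaust)
    then have "?A *v vector [x, y, z] \<noteq> 0"
      using inv by (subst invertible_mult_eq_0) auto
    then have nz: "(a * x + b * y + c * z, d * x + e * y + f * z, g * x + h * y + i * z) \<noteq> (0, 0, 0)"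
      by simp
    show ?thesis
      unfolding p(2) proj_map_pt[OF inv p(1)] E[OF nz] E[OF p(1)] by (rule P)
  qed
  obtain B where B: "proj_map ?A \<circ> proj_map B = id"
    using inv by (rule proj_map_inverse)
  have "p \<in> proj_map ?A ` E" if "p \<in> E" for p
  proof -
    have "proj_map ?A (proj_map B p) = p"
      using B by (metis comp_apply id_apply)
    with that mem show ?thesis
      by (metis imageI)
  qed
  then have "proj_map ?A ` E = E"
    using mem by blast
  moreover have "proj_map ?A \<in> carrier PGL3"
    using inv by (auto simp: carrier_PGL3)
  ultimately show ?thesis
    by (simp add: Aut_down_iff)
qed

text \<open>Substituting parametrized points of E into the last conclusion yields the coefficient
  identities that determine the matrix.\<close>

lemma Aut_downE:
  assumes "\<tau> \<in> Aut_down E" "\<And>x y z. (x, y, z) \<noteq> (0, 0, 0) \<Longrightarrow> pt x y z \<in> E \<longleftrightarrow> P x y z"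
  obtains a b c d e f g h i where
    "invertible (mat3 a b c d e f g h (i :: 'k::field))" "\<tau> = proj_map (mat3 a b c d e f g h i)"
    "\<And>x y z. (x, y, z) \<noteq> (0, 0, 0) \<Longrightarrow> P x y z \<Longrightarrow>
      P (a * x + b * y + c * z) (d * x + e * y + f * z) (g * x + h * y + i * z)"
proof -
  have "\<tau> \<in> carrier PGL3"
    using assms(1) by (simp add: Aut_down_iff)
  then obtain a b c d e f g h i where
    A: "invertible (mat3 a b c d e f g h (i :: 'k::field))" "\<tau> = proj_map (mat3 a b c d e f g h i)"
    by (rule PGL3_exhaust)
  have "P (a * x + b * y + c * z) (d * x + e * y + f * z) (g * x + h * y + i * z)"
    if xyz: "(x, y, z) \<noteq> (0, 0, 0)" "P x y z" for x y z
  proof -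
    have "mat3 a b c d e f g h i *v vector [x, y, z] \<noteq> 0"
      using A(1) xyz(1) by (subst invertible_mult_eq_0) auto
    moreover have "\<tau> (pt x y z) \<in> E"
      using assms xyz Aut_down_memD by blast
    ultimately show ?thesis
      using A xyz(1) assms(2) by (simp add: proj_map_pt)
  qed
  with A that show thesis by blast
qed

text \<open>Cramer's rule for a row vector orthogonal to all columns. It is applied to the gradient
  of the equation of E at the image of a singular point, to show that this point is fixed.\<close>

lemma invertible_mat3_rows:
  assumes "invertible (mat3 a b c d e f g h (i :: 'k::field))"
    "u * a + v * d + w * g = 0" "u * b + v * e + w * h = 0" "u * c + v * f + w * i = 0"
  shows "u = 0" "v = 0" "w = 0"
proof -
  let ?D = "a * (e * i - f * h) - b * (d * i - f * g) + c * (d * h - e * g)"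
  have "u * ?D = 0" "v * ?D = 0" "w * ?D = 0"
    using assms(2-4) by algebra+
  then show "u = 0" "v = 0" "w = 0"
    using assms(1) by (auto simp: invertible_mat3)
qed

text \<open>Provides a point with prescribed image, at which a quadratic form pulled back along the
  matrix cannot vanish.\<close>

lemma invertible_mat3_solve:
  assumes "invertible (mat3 a b c d e f g h (i :: 'k::field))"
  obtains x y z where "a * x + b * y + c * z = u" "d * x + e * y + f * z = v" "g * x + h * y + i * z = w"
proof -
  obtain B where "mat3 a b c d e f g h i ** B = mat 1"
    using assms by (auto simp: invertible_def)
  then have *: "mat3 a b c d e f g h i *v (B *v vector [u, v, w]) = vector [u, v, w]"
    by (simp add: matrix_vector_mul_assoc)
  obtain x y z where "B *v vector [u, v, w] = vector [x, y, z]"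
    by (rule vector3_exhaust)
  with * show thesis
    by (intro that[of x y z]) simp_all
qed

lemma proj_map_normalize:
  assumes "k \<noteq> 0" "invertible (mat3 a b c d e f g h (i :: 'k::field))"
  shows "proj_map (mat3 a b c d e f g h i) =
    proj_map (mat3 (a / k) (b / k) (c / k) (d / k) (e / k) (f / k) (g / k) (h / k) (i / k))"
  using proj_map_scale[of "inverse k"] assms by (simp add: field_simps)

text \<open>A field of characteristic zero is infinite, so a polynomial with all values zero has
  zero coefficients.\<close>

lemma cubic_eq_0:
  assumes "\<And>t. k0 + k1 * t + k2 * t ^ 2 + k3 * t ^ 3 = (0 :: 'k::field_char_0)"
  shows "k0 = 0" "k1 = 0" "k2 = 0" "k3 = 0"
proof -
  have "poly [:k0, k1, k2, k3:] t = 0" for t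
    using assms[of t] by (simp add: algebra_simps power2_eq_square power3_eq_cube)
  then have "[:k0, k1, k2, k3:] = 0"
    using poly_all_0_iff_0 by blast
  then show "k0 = 0" "k1 = 0" "k2 = 0" "k3 = 0"
    by auto
qed

section \<open>Type CC\<close>

text \<open>The smooth points are (t : 1 : t^3), so the equation pulled back along the matrix is a
  polynomial of degree at most 9 in t. Once the cusp is known to be fixed, the remaining
  coefficients force a diagonal matrix.\<close>

lemma Aut_down_cuspidal:
  fixes \<tau> :: "'k::field_char_0 P2 \<Rightarrow> 'k P2"
  assumes "\<tau> \<in> Aut_down (zero_locus (\<lambda>x y z. x ^ 3 - y ^ 2 * z))"
  obtains s where "s \<noteq> 0" "\<tau> = proj_map (mat3 s 0 0  0 1 0  0 0 (s ^ 3))"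
proof -
  have "pt x y z \<in> zero_locus (\<lambda>x y z. x ^ 3 - y ^ 2 * z) \<longleftrightarrow> x ^ 3 - y ^ 2 * z = 0"
    if "(x, y, z) \<noteq> (0, 0, 0)" for x y z :: 'k
    using that by (intro pt_mem_zero_locus[where n = 3])
      (simp_all add: algebra_simps power2_eq_square power3_eq_cube)
  with assms obtain a b c d e f g h i where
    inv: "invertible (mat3 a b c d e f g h (i :: 'k))" and \<tau>: "\<tau> = proj_map (mat3 a b c d e f g h i)"
    and P: "\<And>x y z. (x, y, z) \<noteq> (0, 0, 0) \<Longrightarrow> x ^ 3 - y ^ 2 * z = 0 \<Longrightarrow>
      (a * x + b * y + c * z) ^ 3 - (d * x + e * y + f * z) ^ 2 * (g * x + h * y + i * z) = 0"
    by (rule Aut_downE[where P = "\<lambda>x y z. x ^ 3 - y ^ 2 * z = 0"]) blast+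
  \<comment> \<open>The cusp (0 : 0 : 1) is the point t = infinity, hence the coefficients of degree
    9, 7 and 6 describe the equation near its image (c, f, i).\<close>
  define F where "F = [:b, a, 0, c:] ^ 3 - [:e, d, 0, f:] ^ 2 * [:h, g, 0, i:]"
  have "poly F t = 0" for t
    using P[of t 1 "t ^ 3"] by (simp add: F_def algebra_simps power3_eq_cube)
  then have F: "coeff F n = 0" for n
    using poly_all_0_iff_0[of F] by simp
  note coeffs = F_def power2_eq_square power3_eq_cube coeff_pCons numeral_eq_Suc
  have c9: "c ^ 3 = f ^ 2 * i"
    using F[of 9] by (simp add: coeffs algebra_simps)
  have c7: "3 * c ^ 2 * a = 2 * f * d * i + f ^ 2 * g"
    using F[of 7] by (simp add: coeffs algebra_simps)
  have c6: "3 * c ^ 2 * b = 2 * f * e * i + f ^ 2 * h"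
    using F[of 6] by (simp add: coeffs algebra_simps)
  txt \<open>These relations say that the gradient of the cubic at the image \<open>(c, f, i)\<close> of the cusp is
    orthogonal to all columns of the invertible matrix; hence the gradient vanishes and the cusp is fixed.\<close>
  have "3 * c ^ 2 * c + (- 2 * f * i) * f + (- (f ^ 2)) * i = 0"
    "3 * c ^ 2 * a + (- 2 * f * i) * d + (- (f ^ 2)) * g = 0"
    "3 * c ^ 2 * b + (- 2 * f * i) * e + (- (f ^ 2)) * h = 0"
    using c9 c7 c6 by algebra+
  from invertible_mat3_rows[OF inv this(2,3,1)] have [simp]: "c = 0" "f = 0"
    by simp_all
  have i: "i \<noteq> 0"
    using inv by (auto simp: invertible_mat3)
  have "d ^ 2 * i = 0"
    using F[of 5] by (simp add: coeffs algebra_simps)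
  with i have [simp]: "d = 0"
    by simp
  have ae: "a \<noteq> 0" "e \<noteq> 0"
    using inv by (auto simp: invertible_mat3)
  have "3 * a ^ 2 * b = 0"
    using F[of 2] by (simp add: coeffs algebra_simps)
  with ae have [simp]: "b = 0"
    by simp
  have "e ^ 2 * h = 0" "e ^ 2 * g = 0" and a3: "a ^ 3 = e ^ 2 * i"
    using F[of 0] F[of 1] F[of 3] by (simp_all add: coeffs algebra_simps)
  with ae have [simp]: "h = 0" "g = 0"
    by simp_all
  have "i / e = (a / e) ^ 3"
    using a3 ae by (simp add: field_simps power2_eq_square power3_eq_cube)
  with ae have "\<tau> = proj_map (mat3 (a / e) 0 0  0 1 0  0 0 ((a / e) ^ 3))"
    unfolding \<tau> using inv by (subst proj_map_normalize[of e]) simp_all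
  with ae that[of "a / e"] show thesis
    by simp
qed

text \<open>In the coordinate t of (t : 1 : t^3), \<sigma> is the translation t |-> t - 1 and a
  linear automorphism is a scaling t |-> s t.\<close>

lemma type_CC_Z_M:
  fixes E :: "'k::field_char_0 P2 set"
  assumes "type_CC E \<sigma>"
  shows "Z_set E \<sigma> = {id}" "M_set E \<sigma> = {id}"
proof -
  have E: "E = zero_locus (\<lambda>x y z. x ^ 3 - y ^ 2 * z)" and \<sigma>: "\<sigma> \<in> Bij E"
    and act: "\<And>a b c. a ^ 3 - b ^ 2 * c = 0 \<Longrightarrow> b \<noteq> 0 \<Longrightarrow>
        \<sigma> (pt a b c) = pt (a - b) b (- 3 * (a ^ 2 / b) + 3 * a - b + c)"
    using assms by (auto simp: type_CC_def intro: Aut_imp_Bij)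
  have id: "id \<in> Aut_down E"
    using subgroup.one_closed[OF subgroup_Aut_down, of E] by simp
  have rigid: "\<tau> \<in> {id}" if \<tau>: "\<tau> \<in> Aut_down E" and \<rho>: "\<rho> \<in> Aut_down E"
      and eq: "\<And>p. p \<in> E \<Longrightarrow> \<sigma> (\<tau> p) = \<rho> (\<sigma> p)" for \<tau> \<rho>
  proof -
    obtain s where s: "s \<noteq> 0" "\<tau> = proj_map (mat3 s 0 0  0 1 0  0 0 (s ^ 3))"
      using \<tau> unfolding E by (rule Aut_down_cuspidal)
    obtain r where r: "r \<noteq> 0" "\<rho> = proj_map (mat3 r 0 0  0 1 0  0 0 (r ^ 3))"
      using \<rho> unfolding E by (rule Aut_down_cuspidal)
    have "s * t - 1 = r * (t - 1)" for t
    proof -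
      have "pt t 1 (t ^ 3) \<in> E"
        unfolding E zero_locus_def by force
      then have "\<sigma> (\<tau> (pt t 1 (t ^ 3))) = \<rho> (\<sigma> (pt t 1 (t ^ 3)))"
        by (rule eq)
      then show ?thesis
        using s r by (simp add: proj_map_pt invertible_mat3 act power_mult_distrib pt_eq_iff)
    qed
    \<comment> \<open>\<sigma> sends the point t = 1 to t = 0, which every scaling fixes.\<close>
    from this[of 1] have "s = 1"
      by simp
    with s show ?thesis
      by simp
  qed
  show "Z_set E \<sigma> = {id}" "M_set E \<sigma> = {id}"
    using id by (intro Z_M_eq_if_rigid[OF \<sigma> _ _ rigid]; simp)+
qed

section \<open>Type P\<close>

lemma type_P_Z_M:
  assumes "type_P E \<sigma>"
  shows "Z_set E \<sigma> = carrier PGL3" "M_set E \<sigma> = carrier PGL3"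
proof -
  have E: "E = UNIV" "\<sigma> = id"
    using assms by (simp_all add: type_P_def)
  have "\<tau> \<in> Aut_down E" if \<tau>: "\<tau> \<in> carrier PGL3" for \<tau> :: "'a P2 \<Rightarrow> 'a P2"
  proof -
    obtain A where A: "invertible A" "\<tau> = proj_map A"
      using \<tau> by (auto simp: carrier_PGL3)
    obtain B where "proj_map A \<circ> proj_map B = id"
      using A(1) by (rule proj_map_inverse)
    then have "surj \<tau>"
      unfolding A(2) by (intro surjI[where f = "proj_map B"]) (simp add: pointfree_idE)
    with \<tau> E show ?thesis
      by (simp add: Aut_down_iff)
  qed
  moreover have "\<sigma> \<in> Bij E"
    using E by (simp add: Bij_def)
  moreover have "Aut_down E \<subseteq> carrier PGL3"
    by (auto simp: Aut_down_iff)
  ultimately show "Z_set E \<sigma> = carrier PGL3" "M_set E \<sigma> = carrier PGL3"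
    by (intro Z_M_eq_if_rigid; auto simp: E)+
qed

section \<open>Type T'\<close>

text \<open>Along each component the pulled back equation is a product of polynomials in t, so its
  linear or its quadratic factor vanishes. The conic (1 : t : t^2) spans the plane and cannot go
  into a line; then the line (0 : 1 : t) cannot go into the conic as well.\<close>

lemma Aut_down_conic_tangent:
  fixes \<tau> :: "'k::field_char_0 P2 \<Rightarrow> 'k P2"
  assumes "\<tau> \<in> Aut_down (zero_locus (\<lambda>x y z. x) \<union> zero_locus (\<lambda>x y z. y ^ 2 - x * z))"
  obtains d e where "e \<noteq> 0" "\<tau> = proj_map (mat3 1 0 0  d e 0  (d ^ 2) (2 * d * e) (e ^ 2))"
proof -
  have "pt x y z \<in> zero_locus (\<lambda>x y z. x) \<union> zero_locus (\<lambda>x y z. y ^ 2 - x * z) \<longleftrightarrow>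
      x * (y ^ 2 - x * z) = 0"
    if "(x, y, z) \<noteq> (0, 0, 0)" for x y z :: 'k
  proof -
    have "pt x y z \<in> zero_locus (\<lambda>x y z. x) \<longleftrightarrow> x = 0"
      using that by (intro pt_mem_zero_locus[where n = 1]) simp_all
    moreover have "pt x y z \<in> zero_locus (\<lambda>x y z. y ^ 2 - x * z) \<longleftrightarrow> y ^ 2 - x * z = 0"
      using that by (intro pt_mem_zero_locus[where n = 2])
        (simp_all add: algebra_simps power2_eq_square)
    ultimately show ?thesis by simp
  qed
  with assms obtain a b c d e f g h i where
    inv: "invertible (mat3 a b c d e f g h (i :: 'k))" and \<tau>: "\<tau> = proj_map (mat3 a b c d e f g h i)"
    and P: "\<And>x y z. (x, y, z) \<noteq> (0, 0, 0) \<Longrightarrow> x * (y ^ 2 - x * z) = 0 \<Longrightarrow>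
      (a * x + b * y + c * z) * ((d * x + e * y + f * z) ^ 2 - (a * x + b * y + c * z) * (g * x + h * y + i * z)) = 0"
    by (rule Aut_downE[where P = "\<lambda>x y z. x * (y ^ 2 - x * z) = 0"]) blast+
  define F where "F = [:d, e, f:] ^ 2 - [:a, b, c:] * [:g, h, i:]"
  have "poly ([:a, b, c:] * F) t = 0" for t
    using P[of 1 t "t ^ 2"] by (simp add: F_def algebra_simps power2_eq_square)
  then have "[:a, b, c:] * F = 0"
    using poly_all_0_iff_0 by blast
  moreover have "[:a, b, c:] \<noteq> 0"
    using inv by (auto simp: invertible_mat3)
  ultimately have "F = 0"
    by (simp only: mult_eq_0_iff simp_thms)
  then have F: "d ^ 2 = a * g" "2 * d * e = a * h + b * g" "e ^ 2 + 2 * d * f = a * i + b * h + c * g"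
      "2 * e * f = b * i + c * h" "f ^ 2 = c * i"
    by (simp_all add: F_def power2_eq_square algebra_simps)
  define G where "G = [:e, f:] ^ 2 - [:b, c:] * [:h, i:]"
  have "poly ([:b, c:] * G) t = 0" for t
    using P[of 0 1 t] by (simp add: G_def algebra_simps power2_eq_square)
  then have "[:b, c:] * G = 0"
    using poly_all_0_iff_0 by blast
  moreover have "G \<noteq> 0"
  proof
    \<comment> \<open>F = 0 kills the coefficients of the pulled back form y^2 - x z, up to one
      relation between those of y^2 and x z. G = 0 kills these too, so the form would vanish
      identically, against its value 1 at a preimage of (0, 1, 0).\<close>
    assume "G = 0"
    then have "e ^ 2 = b * h"
      by (simp add: G_def power2_eq_square algebra_simps)
    moreover obtain x y z where "a * x + b * y + c * z = 0" "d * x + e * y + f * z = 1" "g * x + h * y + i * z = 0"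
      using inv by (rule invertible_mat3_solve)
    ultimately show False
      using F by algebra
  qed
  ultimately have "[:b, c:] = 0"
    by (simp only: mult_eq_0_iff simp_thms)
  then have [simp]: "b = 0" "c = 0"
    by simp_all
  have [simp]: "f = 0"
    using F by simp
  have nz: "a \<noteq> 0" "e \<noteq> 0"
    using inv by (auto simp: invertible_mat3)
  have "g / a = (d / a) ^ 2" "h / a = 2 * (d / a) * (e / a)" "i / a = (e / a) ^ 2"
    using F nz by (simp_all add: field_simps power2_eq_square)
  then have "\<tau> = proj_map (mat3 1 0 0  (d / a) (e / a) 0  ((d / a) ^ 2) (2 * (d / a) * (e / a)) ((e / a) ^ 2))"
    unfolding \<tau> using inv nz by (subst proj_map_normalize[of a]) simp_all
  with nz that[of "e / a" "d / a"] show thesis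
    by simp
qed

text \<open>On the conic (1 : t : t^2) \<sigma> is t |-> t - 1 and on the line (0 : 1 : u) it is u
  |-> u + 1, while \<tau> acts by t |-> d + e t and u |-> 2 d + e u. The conic alone admits every
  \<tau>; both components together force e = 1.\<close>

lemma type_T'_Z_M:
  fixes E :: "'k::field_char_0 P2 set"
  assumes "type_T' E \<sigma>"
  shows "Z_set E \<sigma> = {proj_map (mat3 1 0 0  d 1 0  (d ^ 2) (2 * d) 1) | d. True}" (is "_ = ?K")
    and "M_set E \<sigma> = {proj_map (mat3 1 0 0  d 1 0  (d ^ 2) (2 * d) 1) | d. True}"
proof -
  have E: "E = zero_locus (\<lambda>x y z. x) \<union> zero_locus (\<lambda>x y z. y ^ 2 - x * z)" and \<sigma>: "\<sigma> \<in> Bij E"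
    and line: "\<And>b c. (b, c) \<noteq> (0, 0) \<Longrightarrow> \<sigma> (pt 0 b c) = pt 0 b (b + c)"
    and conic: "\<And>a b c. (a, b, c) \<noteq> (0, 0, 0) \<Longrightarrow> b ^ 2 - a * c = 0 \<Longrightarrow>
        \<sigma> (pt a b c) = pt a (- a + b) (a - 2 * b + c)"
    using assms by (auto simp: type_T'_def intro: Aut_imp_Bij)
  have mem: "pt x y z \<in> E \<longleftrightarrow> x = 0 \<or> y ^ 2 - x * z = 0" if "(x, y, z) \<noteq> (0, 0, 0)" for x y z
  proof -
    have "pt x y z \<in> zero_locus (\<lambda>x y z. x) \<longleftrightarrow> x = 0"
      using that by (intro pt_mem_zero_locus[where n = 1]) simp_all
    moreover have "pt x y z \<in> zero_locus (\<lambda>x y z. y ^ 2 - x * z) \<longleftrightarrow> y ^ 2 - x * z = 0"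
      using that by (intro pt_mem_zero_locus[where n = 2])
        (simp_all add: algebra_simps power2_eq_square)
    ultimately show ?thesis
      unfolding E by simp
  qed
  have inv: "invertible (mat3 1 0 0  d 1 0  (d ^ 2) (2 * d) (1 :: 'k))" for d
    by (simp add: invertible_mat3)
  have K: "?K \<subseteq> Aut_down E"
  proof safe
    fix d :: 'k
    have "(d * x + 1 * y + 0 * z) ^ 2 - (1 * x + 0 * y + 0 * z) * (d ^ 2 * x + 2 * d * y + 1 * z) =
        y ^ 2 - x * z" for x y z
      by (simp add: algebra_simps power2_eq_square)
    then show "proj_map (mat3 1 0 0  d 1 0  (d ^ 2) (2 * d) 1) \<in> Aut_down E"
      by (intro proj_map_in_Aut_down[OF inv mem]) simp_all
  qed
  have comm: "\<sigma> (\<tau> p) = \<tau> (\<sigma> p)" if \<tau>: "\<tau> \<in> ?K" and p: "p \<in> E" for \<tau> p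
  proof -
    obtain d where d: "\<tau> = proj_map (mat3 1 0 0  d 1 0  (d ^ 2) (2 * d) 1)"
      using \<tau> by auto
    obtain x y z where xyz: "(x, y, z) \<noteq> (0, 0, 0)" "p = pt x y z"
      by (rule pt_exhaust)
    with p mem consider "x = 0" | "y ^ 2 - x * z = 0" "x \<noteq> 0"
      by blast
    then show ?thesis
    proof cases
      case 1
      with xyz show ?thesis
        by (simp add: d proj_map_pt inv line) (simp add: algebra_simps)
    next
      case 2
      then have "(d * x + y) ^ 2 - x * (d ^ 2 * x + 2 * d * y + z) = 0"
        by algebra
      then show ?thesis
        using 2 xyz by (simp add: d proj_map_pt inv conic) (simp add: algebra_simps power2_eq_square)
    qed
  qed
  have rigid: "\<tau> \<in> ?K" if \<tau>: "\<tau> \<in> Aut_down E" and \<rho>: "\<rho> \<in> Aut_down E"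
      and eq: "\<And>p. p \<in> E \<Longrightarrow> \<sigma> (\<tau> p) = \<rho> (\<sigma> p)" for \<tau> \<rho>
  proof -
    obtain d e where d: "e \<noteq> 0" "\<tau> = proj_map (mat3 1 0 0  d e 0  (d ^ 2) (2 * d * e) (e ^ 2))"
      using \<tau> unfolding E by (rule Aut_down_conic_tangent)
    obtain r s where r: "s \<noteq> 0" "\<rho> = proj_map (mat3 1 0 0  r s 0  (r ^ 2) (2 * r * s) (s ^ 2))"
      using \<rho> unfolding E by (rule Aut_down_conic_tangent)
    have 1: "d + e * t - 1 = r + s * (t - 1)" for t
    proof -
      have "(d + e * t) ^ 2 - (d ^ 2 + 2 * d * e * t + e ^ 2 * t ^ 2) = 0"
        by algebra
      moreover have "\<sigma> (\<tau> (pt 1 t (t ^ 2))) = \<rho> (\<sigma> (pt 1 t (t ^ 2)))"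
        by (intro eq) (simp add: mem)
      ultimately show ?thesis
        using d r by (simp add: proj_map_pt invertible_mat3 conic pt_eq_iff)
    qed
    have "\<sigma> (\<tau> (pt 0 1 0)) = \<rho> (\<sigma> (pt 0 1 0))"
      by (intro eq) (simp add: mem)
    then have "e * (2 * r * s + s ^ 2) = (e + 2 * d * e) * s"
      using d r by (simp add: proj_map_pt invertible_mat3 line pt_eq_iff)
    moreover have "e = s" "r = d + e - 1"
      using 1[of 0, simplified] 1[of 1, simplified] by algebra+
    \<comment> \<open>The conic gives r = d + e - 1, the line gives 2 d + 1 = 2 r + e; together 3 e
      = 3.\<close>
    ultimately have "e ^ 2 * (3 * (e - 1)) = 0"
      by algebra
    with d have "e = 1"
      by simp
    with d show ?thesis
      by auto
  qed
  show "Z_set E \<sigma> = ?K" "M_set E \<sigma> = ?K"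
    using K comm rigid by (intro Z_M_eq_if_rigid[OF \<sigma>]; blast)+
qed

section \<open>Type T\<close>

lemma primitive_cube_root_sum:
  "primitive_cube_root (\<epsilon> :: 'k::field) \<Longrightarrow> \<epsilon> ^ 2 + \<epsilon> + 1 = 0"
proof -
  assume \<epsilon>: "primitive_cube_root \<epsilon>"
  then have "(\<epsilon> - 1) * (\<epsilon> ^ 2 + \<epsilon> + 1) = 0"
    by (simp add: primitive_cube_root_def power2_eq_square power3_eq_cube algebra_simps)
  with \<epsilon> show ?thesis
    by (simp add: primitive_cube_root_def)
qed

lemma cube_eq_one_iff:
  assumes "primitive_cube_root (\<epsilon> :: 'k::field)"
  shows "e ^ 3 = 1 \<longleftrightarrow> e = 1 \<or> e = \<epsilon> \<or> e = \<epsilon> ^ 2"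
proof -
  have "e ^ 3 - 1 = (e - 1) * ((e - \<epsilon>) * (e - \<epsilon> ^ 2))"
    using primitive_cube_root_sum[OF assms] by algebra
  then have "e ^ 3 - 1 = 0 \<longleftrightarrow> (e - 1) * ((e - \<epsilon>) * (e - \<epsilon> ^ 2)) = 0"
    by simp
  then show ?thesis
    by simp
qed

text \<open>Gives the three lines of type T one common equation that treats them alike.\<close>

lemma three_lines_eq:
  assumes "primitive_cube_root (\<epsilon> :: 'k::field)"
  shows "x ^ 3 + y ^ 3 = (x + y) * ((\<epsilon> * x + y) * (\<epsilon> ^ 2 * x + y))"
  using primitive_cube_root_sum[OF assms] by algebra

text \<open>The cube roots of -1 are the values of y on the three lines at x = 1. There are three of
  them, too many for a nonzero polynomial of degree 2.\<close>

lemma quadratic_roots_eq_0: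
  assumes "primitive_cube_root (\<epsilon> :: 'k::field_char_0)"
    and "\<And>y :: 'k. y ^ 3 = - 1 \<Longrightarrow> A + B * y + C * y ^ 2 = 0"
  shows "A = 0" "B = 0" "C = 0"
proof -
  note \<epsilon> = primitive_cube_root_sum[OF assms(1)]
  have "(- \<epsilon>) ^ 3 = - 1" "(- (\<epsilon> ^ 2)) ^ 3 = - 1"
    using \<epsilon> by algebra+
  then have *: "A - B + C = 0" "A - B * \<epsilon> + C * \<epsilon> ^ 2 = 0" "A - B * \<epsilon> ^ 2 + C * (\<epsilon> ^ 2) ^ 2 = 0"
    using assms(2)[of "- 1"] assms(2)[of "- \<epsilon>"] assms(2)[of "- (\<epsilon> ^ 2)"] by simp_all
  have "3 * A = 0" "3 * B = 0" "3 * C = 0"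
    using * \<epsilon> by algebra+
  then show "A = 0" "B = 0" "C = 0"
    by simp_all
qed

text \<open>Substituting (1, y, z) with y^3 = -1 gives a cubic in z whose coefficients are
  polynomials in y modulo y^3 + 1. Those of z^2 and z^3 show that the common point (0 : 0 : 1) of
  the lines is fixed; the constant one makes the upper left block monomial.\<close>

lemma Aut_down_three_lines:
  fixes \<tau> :: "'k::field_char_0 P2 \<Rightarrow> 'k P2"
  assumes \<epsilon>: "primitive_cube_root (\<epsilon> :: 'k)"
    and mem: "\<And>x y z. (x, y, z) \<noteq> (0, 0, 0) \<Longrightarrow> pt x y z \<in> E \<longleftrightarrow> x ^ 3 + y ^ 3 = 0"
    and "\<tau> \<in> Aut_down E"
  obtains e g h i where "e ^ 3 = 1" "i \<noteq> 0" "\<tau> = proj_map (mat3 1 0 0  0 e 0  g h i)"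
    | e g h i where "e ^ 3 = 1" "i \<noteq> 0" "\<tau> = proj_map (mat3 0 1 0  e 0 0  g h i)"
proof -
  obtain a b c d e f g h i where
    inv: "invertible (mat3 a b c d e f g h (i :: 'k))" and \<tau>: "\<tau> = proj_map (mat3 a b c d e f g h i)"
    and P: "\<And>x y z. (x, y, z) \<noteq> (0, 0, 0) \<Longrightarrow> x ^ 3 + y ^ 3 = 0 \<Longrightarrow>
      (a * x + b * y + c * z) ^ 3 + (d * x + e * y + f * z) ^ 3 = 0"
    using assms(3,2) by (rule Aut_downE[where P = "\<lambda>x y z. x ^ 3 + y ^ 3 = 0"]) blast+
  have coeffs: "(a + b * y) ^ 3 + (d + e * y) ^ 3 = 0" "c ^ 2 * (a + b * y) + f ^ 2 * (d + e * y) = 0"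
      "c ^ 3 + f ^ 3 = 0" if "y ^ 3 = - 1" for y
  proof -
    have "((a + b * y) ^ 3 + (d + e * y) ^ 3) + (3 * (c * (a + b * y) ^ 2 + f * (d + e * y) ^ 2)) * z +
        (3 * (c ^ 2 * (a + b * y) + f ^ 2 * (d + e * y))) * z ^ 2 + (c ^ 3 + f ^ 3) * z ^ 3 = 0" for z
      using P[of 1 y z] that by (simp add: algebra_simps power2_eq_square power3_eq_cube)
    note cub = cubic_eq_0[OF this]
    show "(a + b * y) ^ 3 + (d + e * y) ^ 3 = 0" "c ^ 3 + f ^ 3 = 0"
      by (fact cub)+
    show "c ^ 2 * (a + b * y) + f ^ 2 * (d + e * y) = 0"
      using cub(3) by (simp only: mult_eq_0_iff) simp
  qed
  have "(c ^ 2 * a + f ^ 2 * d) + (c ^ 2 * b + f ^ 2 * e) * y + 0 * y ^ 2 = 0" if "y ^ 3 = - 1" for y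
    using coeffs(2)[OF that] by (simp add: algebra_simps)
  note quad = quadratic_roots_eq_0[OF \<epsilon> this]
  have "c ^ 2 * a + f ^ 2 * d + 0 * g = 0" "c ^ 2 * b + f ^ 2 * e + 0 * h = 0" "c ^ 2 * c + f ^ 2 * f + 0 * i = 0"
    using quad coeffs(3)[of "- 1"] by (simp_all add: power2_eq_square power3_eq_cube)
  \<comment> \<open>Up to the factor 3, (c^2, f^2, 0) is the gradient of x^3 + y^3 at the image of
    the common point.\<close>
  from invertible_mat3_rows[OF inv this] have [simp]: "c = 0" "f = 0"
    by simp_all
  have nz: "i \<noteq> 0" "a * e - b * d \<noteq> 0"
    using inv by (auto simp: invertible_mat3)
  have "(a ^ 3 - b ^ 3 + d ^ 3 - e ^ 3) + (3 * (a ^ 2 * b + d ^ 2 * e)) * y +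
      (3 * (a * b ^ 2 + d * e ^ 2)) * y ^ 2 = 0" if "y ^ 3 = - 1" for y
    using coeffs(1)[OF that] that by algebra
  note quad = quadratic_roots_eq_0[OF \<epsilon> this]
  have 1: "a ^ 2 * b + d ^ 2 * e = 0" "a * b ^ 2 + d * e ^ 2 = 0" "a ^ 3 - b ^ 3 + d ^ 3 - e ^ 3 = 0"
    using quad(2,3) quad(1) by (simp_all only: mult_eq_0_iff) simp_all
  have "(a * e - b * d) * (a * b) = 0" "(a * e - b * d) * (d * e) = 0"
    using 1(1,2) by algebra+
  with nz consider "b = 0" "d = 0" "a \<noteq> 0" "e \<noteq> 0" | "a = 0" "e = 0" "b \<noteq> 0" "d \<noteq> 0"
    by auto
  then show thesis
  proof cases
    case 1
    then have "(e / a) ^ 3 = 1"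
      using \<open>a ^ 3 - b ^ 3 + d ^ 3 - e ^ 3 = 0\<close> by (simp add: power_divide)
    moreover have "\<tau> = proj_map (mat3 1 0 0  0 (e / a) 0  (g / a) (h / a) (i / a))"
      unfolding \<tau> using 1 inv by (subst proj_map_normalize[of a]) simp_all
    ultimately show thesis
      using that(1)[of "e / a" "i / a"] 1 nz by simp
  next
    case 2
    then have "(d / b) ^ 3 = 1"
      using \<open>a ^ 3 - b ^ 3 + d ^ 3 - e ^ 3 = 0\<close> by (simp add: power_divide)
    moreover have "\<tau> = proj_map (mat3 0 1 0  (d / b) 0 0  (g / b) (h / b) (i / b))"
      unfolding \<tau> using 2 inv by (subst proj_map_normalize[of b]) simp_all
    ultimately show thesis
      using that(2)[of "d / b" "i / b"] 2 nz by simp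
  qed
qed

text \<open>\<sigma> preserves every line and shifts z by y^2/x. A linear \<tau> multiplies this
  shift by e^2, or by -e^2 if it interchanges x and y, whereas it multiplies z by i; comparing the
  two factors determines i.\<close>

lemma type_T_Z_M:
  fixes E :: "'k::field_char_0 P2 set"
  assumes \<epsilon>: "primitive_cube_root \<epsilon>" and T: "type_T \<epsilon> E \<sigma>"
  defines "K \<equiv> {proj_map (mat3 1 0 0  0 e 0  g h (e ^ 2)) | e g h. e ^ 3 = 1} \<union>
    {proj_map (mat3 0 1 0  e 0 0  g h (- (e ^ 2))) | e g h. e ^ 3 = 1}"
  shows "Z_set E \<sigma> = K" "M_set E \<sigma> = K"
proof -
  have E: "E = zero_locus (\<lambda>x y z. x + y) \<union> zero_locus (\<lambda>x y z. \<epsilon> * x + y) \<union>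
         zero_locus (\<lambda>x y z. \<epsilon> ^ 2 * x + y)" and \<sigma>: "\<sigma> \<in> Bij E"
    and act': "\<And>a c. (a, c) \<noteq> (0, 0) \<Longrightarrow> \<sigma> (pt a (- a) c) = pt a (- a) (a + c)"
     "\<And>a c. (a, c) \<noteq> (0, 0) \<Longrightarrow> \<sigma> (pt a (- \<epsilon> * a) c) = pt a (- \<epsilon> * a) (\<epsilon> ^ 2 * a + c)"
     "\<And>a c. (a, c) \<noteq> (0, 0) \<Longrightarrow> \<sigma> (pt a (- (\<epsilon> ^ 2) * a) c) = pt a (- (\<epsilon> ^ 2) * a) (\<epsilon> * a + c)"
    using T by (auto simp: type_T_def intro: Aut_imp_Bij)
  note \<epsilon>2 = primitive_cube_root_sum[OF \<epsilon>]
  have mem: "pt x y z \<in> E \<longleftrightarrow> x ^ 3 + y ^ 3 = 0" if "(x, y, z) \<noteq> (0, 0, 0)" for x y z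
  proof -
    have "pt x y z \<in> zero_locus (\<lambda>x y z. k * x + y) \<longleftrightarrow> k * x + y = 0" for k
      using that by (intro pt_mem_zero_locus[where n = 1]) (simp_all add: algebra_simps)
    from this[of 1] this[of \<epsilon>] this[of "\<epsilon> ^ 2"] show ?thesis
      unfolding E by (simp add: three_lines_eq[OF \<epsilon>])
  qed
  \<comment> \<open>One formula for all three lines: y = -w x with w^3 = 1 gives y^2/x = w^2 x. At
    the common point x = y = 0 the convention that division by 0 gives 0 yields the fixed
    point.\<close>
  have act: "\<sigma> (pt x y z) = pt x y (z + y ^ 2 / x)"
    if nz: "(x, y, z) \<noteq> (0, 0, 0)" and "x ^ 3 + y ^ 3 = 0" for x y z
  proof -
    have "x + y = 0 \<or> \<epsilon> * x + y = 0 \<or> \<epsilon> ^ 2 * x + y = 0"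
      using that three_lines_eq[OF \<epsilon>, of x y] by simp
    then consider "y = - x" | "y = - \<epsilon> * x" | "y = - (\<epsilon> ^ 2) * x"
      by (metis add_eq_0_iff mult_minus_left)
    then show ?thesis
    proof cases
      case 1
      then have "y ^ 2 / x = x"
        by (simp add: power2_eq_square)
      with 1 nz act'(1)[of x z] show ?thesis
        by (simp add: add.commute)
    next
      case 2
      then have "y ^ 2 / x = \<epsilon> ^ 2 * x"
        by (simp add: power2_eq_square)
      with 2 nz act'(2)[of x z] show ?thesis
        by (simp add: add.commute)
    next
      case 3
      have "\<epsilon> * (\<epsilon> * \<epsilon>) = 1"
        using \<epsilon>2 by algebra
      with 3 have "y ^ 2 / x = \<epsilon> * x"
        by (simp add: power2_eq_square mult.assoc)
      with 3 nz act'(3)[of x z] show ?thesis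
        by (simp add: add.commute)
    qed
  qed
  have e0: "e \<noteq> 0" if "e ^ 3 = 1" for e :: 'k
    using that by auto
  have invs: "invertible (mat3 1 0 0  0 e 0  g h i)" "invertible (mat3 0 1 0  e 0 0  g h i)"
    if "e ^ 3 = 1" "i \<noteq> 0" for e g h i :: 'k
    using that e0[of e] by (auto simp: invertible_mat3)
  have K: "K \<subseteq> Aut_down E"
    unfolding K_def
  proof safe
    fix e g h :: 'k
    assume e: "e ^ 3 = 1"
    show "proj_map (mat3 1 0 0  0 e 0  g h (e ^ 2)) \<in> Aut_down E"
      using e e0 by (intro proj_map_in_Aut_down[OF invs(1) mem]) (simp_all add: power_mult_distrib)
    show "proj_map (mat3 0 1 0  e 0 0  g h (- (e ^ 2))) \<in> Aut_down E"
      using e e0 by (intro proj_map_in_Aut_down[OF invs(2) mem]) (simp_all add: power_mult_distrib add.commute)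
  qed
  have comm: "\<sigma> (\<tau> p) = \<tau> (\<sigma> p)" if \<tau>: "\<tau> \<in> K" and p: "p \<in> E" for \<tau> p
  proof -
    obtain x y z where xyz: "(x, y, z) \<noteq> (0, 0, 0)" "p = pt x y z"
      by (rule pt_exhaust)
    with p mem have xy: "x ^ 3 + y ^ 3 = 0"
      by blast
    then have x0: "x = 0 \<longleftrightarrow> y = 0"
      by auto
    from \<tau> consider e g h where "e ^ 3 = 1" "\<tau> = proj_map (mat3 1 0 0  0 e 0  g h (e ^ 2))"
      | e g h where "e ^ 3 = 1" "\<tau> = proj_map (mat3 0 1 0  e 0 0  g h (- (e ^ 2)))"
      unfolding K_def by blast
    then show ?thesis
    proof cases
      case 1
      with e0[of e] xyz x0 have "(x, e * y, g * x + h * y + e ^ 2 * z) \<noteq> (0, 0, 0)"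
        by auto
      from act[OF this] 1 e0[of e] xyz xy show ?thesis
        by (simp add: proj_map_pt invs act power_mult_distrib) (simp add: algebra_simps)
    next
      case 2
      \<comment> \<open>The equation x^3 + y^3 = 0 in this form produces the sign of -e^2.\<close>
      have "x ^ 2 / y = - (y ^ 2 / x)"
      proof (cases "x = 0")
        case False
        then show ?thesis
          using xy x0 by (simp add: divide_simps) algebra
      qed simp
      then have "e ^ 2 * x ^ 2 / y = - (e ^ 2 * y ^ 2 / x)"
        by (metis mult_minus_right times_divide_eq_right)
      moreover from 2 e0[of e] xyz x0 have "(y, e * x, g * x + h * y - e ^ 2 * z) \<noteq> (0, 0, 0)"
        by auto
      note act[OF this]
      ultimately show ?thesis
        using 2 e0[of e] xyz xy
        by (simp add: proj_map_pt invs act power_mult_distrib add.commute[of "x ^ 3"]) (simp add: algebra_simps)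
    qed
  qed
  have rigid: "\<tau> \<in> K" if \<tau>: "\<tau> \<in> Aut_down E" and \<rho>: "\<rho> \<in> Aut_down E"
      and eq: "\<And>p. p \<in> E \<Longrightarrow> \<sigma> (\<tau> p) = \<rho> (\<sigma> p)" for \<tau> \<rho>
  proof -
    have pt: "\<sigma> (\<tau> (pt 1 y z)) = \<rho> (\<sigma> (pt 1 y z))" if "y ^ 3 = - 1" for y z
      using that by (intro eq) (simp add: mem)
    have roots: "(- \<epsilon>) ^ 3 = - 1" "(- 1 :: 'k) ^ 3 = - 1" "\<epsilon> \<noteq> 1" "\<epsilon> ^ 2 \<noteq> 1" "\<epsilon> ^ 3 = 1"
      using \<epsilon> by (simp_all add: primitive_cube_root_def)
    consider (11) e g h i e' g' h' i' where "e ^ 3 = 1" "i \<noteq> 0" "\<tau> = proj_map (mat3 1 0 0  0 e 0  g h i)"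
        "e' ^ 3 = 1" "i' \<noteq> 0" "\<rho> = proj_map (mat3 1 0 0  0 e' 0  g' h' i')"
      | (12) e g h i e' g' h' i' where "e ^ 3 = 1" "i \<noteq> 0" "\<tau> = proj_map (mat3 1 0 0  0 e 0  g h i)"
        "e' ^ 3 = 1" "i' \<noteq> 0" "\<rho> = proj_map (mat3 0 1 0  e' 0 0  g' h' i')"
      | (21) e g h i e' g' h' i' where "e ^ 3 = 1" "i \<noteq> 0" "\<tau> = proj_map (mat3 0 1 0  e 0 0  g h i)"
        "e' ^ 3 = 1" "i' \<noteq> 0" "\<rho> = proj_map (mat3 1 0 0  0 e' 0  g' h' i')"
      | (22) e g h i e' g' h' i' where "e ^ 3 = 1" "i \<noteq> 0" "\<tau> = proj_map (mat3 0 1 0  e 0 0  g h i)"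
        "e' ^ 3 = 1" "i' \<noteq> 0" "\<rho> = proj_map (mat3 0 1 0  e' 0 0  g' h' i')"
      using Aut_down_three_lines[OF \<epsilon> mem \<tau>] Aut_down_three_lines[OF \<epsilon> mem \<rho>] by metis
    then show ?thesis
    proof cases
      case 11
      have *: "e = e' \<and> g + h * y + i * z + (e * y) ^ 2 = g' + h' * y + i' * (z + y ^ 2)"
        if "y ^ 3 = - 1" for y z
      proof -
        have "y \<noteq> 0"
          using that by auto
        with 11 pt[OF that, of z] that show ?thesis
          by (simp add: proj_map_pt invs act power_mult_distrib pt_eq_iff)
      qed
      \<comment> \<open>Two values of z on one line isolate the coefficient of z; then z = 0 and the
        coefficient of y^2 give i = e^2.\<close>
      have "i = i'"
        using *[OF roots(2), of 0, THEN conjunct2] *[OF roots(2), of 1, THEN conjunct2]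
        by (simp del: power_mult_distrib) algebra
      then have "(g - g') + (h - h') * y + (e ^ 2 - i) * y ^ 2 = 0" if "y ^ 3 = - 1" for y
        using *[OF that, of 0, THEN conjunct2] by (simp add: algebra_simps power_mult_distrib)
      from quadratic_roots_eq_0(3)[OF \<epsilon> this] have "i = e ^ 2"
        by simp
      with 11 show ?thesis
        by (auto simp: K_def)
    next
      case 12
      \<comment> \<open>\<sigma> maps each line to itself, so \<tau> and \<rho> permute the lines
        alike. Here y |-> e y would equal y |-> e'/y, although y^2 is not constant on the cube roots
        of -1.\<close>
      have "e * y * y = e'" if y: "y ^ 3 = - 1" for y
      proof -
        have "y \<noteq> 0"
          using y by auto
        with 12 pt[OF y, of 0] y show ?thesis
          by (simp add: proj_map_pt invs act power_mult_distrib pt_eq_iff)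
      qed
      from this[OF roots(2)] this[OF roots(1)] e0[of e] 12 roots show ?thesis
        by (simp add: power2_eq_square)
    next
      case 21
      have "e = y * (e' * y)" if y: "y ^ 3 = - 1" for y
      proof -
        have "y \<noteq> 0"
          using y by auto
        with 21 pt[OF y, of 0] y show ?thesis
          by (simp add: proj_map_pt invs act power_mult_distrib pt_eq_iff)
      qed
      from this[OF roots(2)] this[OF roots(1)] e0[of e'] 21 roots show ?thesis
        by (simp add: power2_eq_square)
    next
      case 22
      have *: "e = e' \<and> g + h * y + i * z + e ^ 2 / y = g' + h' * y + i' * (z + y ^ 2)"
        if y: "y ^ 3 = - 1" for y z
      proof -
        have "y \<noteq> 0"
          using y by auto
        with 22 pt[OF y, of z] y show ?thesis
          by (simp add: proj_map_pt invs act power_mult_distrib pt_eq_iff)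
      qed
      have "i = i'"
        using *[OF roots(2), of 0, THEN conjunct2] *[OF roots(2), of 1, THEN conjunct2]
        by (simp del: power_mult_distrib) algebra
      moreover have "e ^ 2 / y = - (e ^ 2) * y ^ 2" if y: "y ^ 3 = - 1" for y
      proof -
        have "y \<noteq> 0"
          using y by auto
        then show ?thesis
          using y by (simp add: divide_simps) algebra
      qed
      ultimately have "(g - g') + (h - h') * y + (- (e ^ 2) - i) * y ^ 2 = 0" if "y ^ 3 = - 1" for y
        using *[OF that, of 0, THEN conjunct2] that by (simp add: algebra_simps)
      from quadratic_roots_eq_0(3)[OF \<epsilon> this] have "i = - (e ^ 2)"
        by simp
      with 22 have "\<tau> = proj_map (mat3 0 1 0  e 0 0  g h (- (e ^ 2)))"
        by simp
      with 22(1) show ?thesis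
        unfolding K_def by blast
    qed
  qed
  show "Z_set E \<sigma> = K" "M_set E \<sigma> = K"
    using K comm rigid by (intro Z_M_eq_if_rigid[OF \<sigma>]; blast)+
qed

text \<open>Multiplying N on the right by the involution gives exactly the second family, with g and
  h exchanged.\<close>

lemma semidirect_three_lines:
  defines "N \<equiv> {proj_map (mat3 1 0 0  0 e 0  g h (e ^ 2)) | e g h :: 'k::field_char_0. e ^ 3 = 1}"
    and "K2 \<equiv> {proj_map (mat3 0 1 0  e 0 0  g h (- (e ^ 2))) | e g h. e ^ 3 = 1}"
  shows "semidirect PGL3 (N \<union> K2) N (generate PGL3 {proj_map (mat3 0 1 0  1 0 0  0 0 (- 1))})"
proof -
  interpret group "PGL3 :: ('k P2 \<Rightarrow> 'k P2) monoid"
    by (rule group_PGL3)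
  let ?n = "\<lambda>e g h. mat3 1 0 0  0 e 0  g h (e ^ 2 :: 'k)" and ?S = "mat3 0 1 0  1 0 0  0 0 (- 1 :: 'k)"
  let ?s = "proj_map ?S"
  have e0: "e \<noteq> 0" if "e ^ 3 = 1" for e :: 'k
    using that by auto
  have inv: "invertible (?n e g h)" if "e ^ 3 = 1" for e g h
    using e0[OF that] by (simp add: invertible_mat3)
  have invS: "invertible ?S"
    by (simp add: invertible_mat3)
  have sS: "?s \<in> carrier PGL3"
    using invS by (auto simp: carrier_PGL3)
  have ss: "?s \<circ> ?s = id"
    by (simp add: proj_map_comp invS mat3_mult)
  have mult: "proj_map (?n e g h) \<circ> proj_map (?n e' g' h') =
      proj_map (?n (e * e') (g + h * 0 + e ^ 2 * g') (h * e' + e ^ 2 * h'))"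
    if "e ^ 3 = 1" "e' ^ 3 = 1" for e e' g g' h h'
    using that by (simp add: proj_map_comp inv mat3_mult power_mult_distrib)
  have N: "subgroup N PGL3"
  proof (rule subgroup_PGL3I)
    show "N \<subseteq> carrier PGL3"
      using inv by (auto simp: N_def carrier_PGL3)
    show "id \<in> N"
      unfolding N_def by (rule CollectI, intro exI[of _ 1] exI[of _ 0]) simp
  next
    fix x y
    assume "x \<in> N" "y \<in> N"
    then obtain e g h e' g' h' where x: "e ^ 3 = 1" "x = proj_map (?n e g h)" "e' ^ 3 = 1" "y = proj_map (?n e' g' h')"
      unfolding N_def by blast
    have "(e * e') ^ 3 = 1"
      using x by (simp add: power_mult_distrib)
    then show "x \<circ> y \<in> N"
      unfolding x(2,4) mult[OF x(1,3)] N_def by blast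
  next
    fix x
    assume "x \<in> N"
    then obtain e g h where x: "e ^ 3 = 1" "x = proj_map (?n e g h)"
      unfolding N_def by blast
    have e: "(e ^ 2) ^ 3 = 1" "e ^ 2 * e = 1" "(e ^ 2) ^ 2 = e"
      using x(1) by algebra+
    \<comment> \<open>The inverse has parameters e^2, -e g and -h, because e^-1 = e^2.\<close>
    have "- (e * g) + - h * 0 + (e ^ 2) ^ 2 * g = 0" "- h * e + (e ^ 2) ^ 2 * h = 0"
      using e by algebra+
    then have "proj_map (?n (e ^ 2) (- (e * g)) (- h)) \<circ> x = id"
      unfolding x(2) mult[OF e(1) x(1)] by (simp only: e(2) power_one proj_map_mat3_1)
    moreover have "proj_map (?n (e ^ 2) (- (e * g)) (- h)) \<in> N"
      unfolding N_def using e(1) by blast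
    ultimately show "\<exists>y\<in>N. y \<circ> x = id"
      by blast
  qed
  have H: "generate PGL3 {?s} = {id, ?s}"
    using generate_order_2[OF sS] ss by simp
  show ?thesis
  proof (rule semidirectI)
    show "subgroup N PGL3" by (rule N)
    show "subgroup (generate PGL3 {?s}) PGL3"
      using sS by (intro generate_is_subgroup) simp
    show "N \<inter> generate PGL3 {?s} = {\<one>\<^bsub>PGL3\<^esub>}"
    proof -
      have "proj_map (?n e g h) (pt 1 0 0) \<noteq> ?s (pt 1 0 0)" if "e ^ 3 = 1" for e g h
        using that by (simp add: proj_map_pt inv invS pt_eq_iff)
      then have "?s \<notin> N"
        unfolding N_def by force
      moreover have "id \<in> N"
        using subgroup.one_closed[OF N] by simp
      ultimately show ?thesis
        by (auto simp: H)
    qed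
    have swap: "proj_map (?n e g h) \<circ> ?s = proj_map (mat3 0 1 0  e 0 0  h g (- (e ^ 2)))" if "e ^ 3 = 1" for e g h
      using that by (simp add: proj_map_comp inv invS mat3_mult)
    have "N <#>\<^bsub>PGL3\<^esub> {id, ?s} = N \<union> (\<lambda>n. n \<circ> ?s) ` N"
      by (auto simp: set_mult_def)
    also have "(\<lambda>n. n \<circ> ?s) ` N = K2"
    proof safe
      fix n
      assume "n \<in> N"
      then show "n \<circ> ?s \<in> K2"
        unfolding N_def K2_def using swap by blast
    next
      fix n
      assume "n \<in> K2"
      then show "n \<in> (\<lambda>n. n \<circ> ?s) ` N"
        unfolding N_def K2_def using swap[symmetric] by blast
    qed
    finally show "N \<union> K2 = N <#>\<^bsub>PGL3\<^esub> generate PGL3 {?s}"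
      unfolding H by (rule sym)
  next
    fix n k
    assume "n \<in> N" and k: "k \<in> generate PGL3 {?s}"
    then obtain e g h where n: "e ^ 3 = 1" "n = proj_map (?n e g h)"
      unfolding N_def by blast
    from k consider "k = id" | "k = ?s"
      unfolding H by blast
    then show "k \<otimes>\<^bsub>PGL3\<^esub> n \<otimes>\<^bsub>PGL3\<^esub> inv\<^bsub>PGL3\<^esub> k \<in> N"
    proof cases
      case 1
      with inv_one \<open>n \<in> N\<close> show ?thesis
        by simp
    next
      case 2
      have e: "(e ^ 2) ^ 3 = 1" "e * e ^ 2 = 1" "(e ^ 2) ^ 2 = e" "e \<noteq> 0"
        using n(1) by (algebra, algebra, algebra, auto)
      have "inv\<^bsub>PGL3\<^esub> k = ?s"
        using 2 sS ss by (intro inv_equality) simp_all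
      then have "k \<otimes>\<^bsub>PGL3\<^esub> n \<otimes>\<^bsub>PGL3\<^esub> inv\<^bsub>PGL3\<^esub> k = proj_map (?S ** ?n e g h ** ?S)"
        using 2 n by (simp add: proj_map_comp inv invS invertible_mult)
      also have "?S ** ?n e g h ** ?S = mat3 e 0 0  0 1 0  (- h) (- g) (e ^ 2)"
        by (simp add: mat3_mult)
      \<comment> \<open>Conjugation has moved e to the first entry; dividing by e brings the matrix
        back to the normal form of N.\<close>
      also have "proj_map \<dots> = proj_map (?n (e ^ 2) (- (e ^ 2 * h)) (- (e ^ 2 * g)))"
      proof -
        have inv': "invertible (?n (e ^ 2) (- (e ^ 2 * h)) (- (e ^ 2 * g)))"
          by (rule inv) (rule e)
        have "e * - (e ^ 2 * h) = - h" "e * - (e ^ 2 * g) = - g" "e * (e ^ 2) ^ 2 = e ^ 2"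
          using e(2) by algebra+
        then show ?thesis
          using proj_map_scale[OF e(4) inv'] by (simp only: e(2) mult_1_right mult_zero_right)
      qed
      also have "\<dots> \<in> N"
        unfolding N_def using e(1) by blast
      finally show ?thesis .
    qed
  qed
qed

section \<open>Type S'\<close>

lemma conic_secant_mem:
  fixes \<mu> :: "'k::field"
  assumes "(x, y, z) \<noteq> (0, 0, 0)"
  shows "pt x y z \<in> zero_locus (\<lambda>x y z. x) \<union> zero_locus (\<lambda>x y z. x ^ 2 - \<mu> * y * z) \<longleftrightarrow>
      x * (x ^ 2 - \<mu> * y * z) = 0"
proof -
  have "pt x y z \<in> zero_locus (\<lambda>x y z. x) \<longleftrightarrow> x = 0"
    using assms by (intro pt_mem_zero_locus[where n = 1]) simp_all
  moreover have "pt x y z \<in> zero_locus (\<lambda>x y z. x ^ 2 - \<mu> * y * z) \<longleftrightarrow> x ^ 2 - \<mu> * y * z = 0"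
    using assms by (intro pt_mem_zero_locus[where n = 2])
      (simp_all add: algebra_simps power2_eq_square)
  ultimately show ?thesis by simp
qed

text \<open>The conic is parametrized by (\<mu> t : \<mu> : t^2) and meets the line in (0 : 1 : 0)
  and (0 : 0 : 1). It spans the plane and cannot be sent into a line, so the line is preserved too,
  and its two points on the conic are fixed or exchanged.\<close>

lemma Aut_down_conic_secant:
  fixes \<tau> :: "'k::field_char_0 P2 \<Rightarrow> 'k P2"
  assumes \<mu>: "\<mu> \<noteq> 0"
    and "\<tau> \<in> Aut_down (zero_locus (\<lambda>x y z. x) \<union> zero_locus (\<lambda>x y z. x ^ 2 - \<mu> * y * z))"
  obtains e where "e \<noteq> 0" "\<tau> = proj_map (mat3 1 0 0  0 e 0  0 0 (inverse e))"
    | e where "e \<noteq> 0" "\<tau> = proj_map (mat3 1 0 0  0 0 e  0 (inverse e) 0)"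
proof -
  obtain a b c d e f g h i where
    inv: "invertible (mat3 a b c d e f g h (i :: 'k))" and \<tau>: "\<tau> = proj_map (mat3 a b c d e f g h i)"
    and P: "\<And>x y z. (x, y, z) \<noteq> (0, 0, 0) \<Longrightarrow> x * (x ^ 2 - \<mu> * y * z) = 0 \<Longrightarrow>
      (a * x + b * y + c * z) * ((a * x + b * y + c * z) ^ 2 - \<mu> * (d * x + e * y + f * z) * (g * x + h * y + i * z)) = 0"
    using assms(2) conic_secant_mem
    by (rule Aut_downE[where P = "\<lambda>x y z. x * (x ^ 2 - \<mu> * y * z) = 0"]) blast+
  define X Y Z where "X = [:\<mu> * b, \<mu> * a, c:]" and "Y = [:\<mu> * e, \<mu> * d, f:]" and "Z = [:\<mu> * h, \<mu> * g, i:]"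
  define F where "F = X ^ 2 - smult \<mu> (Y * Z)"
  have "poly (X * F) t = 0" for t
    using P[of "\<mu> * t" \<mu> "t ^ 2"] \<mu>
    by (simp add: F_def X_def Y_def Z_def algebra_simps power2_eq_square)
  then have "X * F = 0"
    using poly_all_0_iff_0 by blast
  moreover have "X \<noteq> 0"
    using inv \<mu> by (auto simp: invertible_mat3 X_def)
  ultimately have "F = 0"
    by (simp only: mult_eq_0_iff simp_thms)
  then have "coeff F n = 0" for n
    by simp
  from this[of 0] this[of 1] this[of 2] this[of 3] this[of 4]
  have "\<mu> ^ 2 * (b ^ 2 - \<mu> * (e * h)) = 0" "\<mu> ^ 2 * (2 * a * b - \<mu> * (e * g + d * h)) = 0"
    "\<mu> * (\<mu> * a ^ 2 + 2 * b * c - \<mu> * (e * i + f * h) - \<mu> ^ 2 * (d * g)) = 0"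
    "\<mu> * (2 * a * c - \<mu> * (d * i + f * g)) = 0" "c ^ 2 - \<mu> * (f * i) = 0"
    by (simp_all add: F_def X_def Y_def Z_def coeff_pCons numeral_eq_Suc algebra_simps)
  then have F: "b ^ 2 - \<mu> * (e * h) = 0" "2 * a * b - \<mu> * (e * g + d * h) = 0"
    "\<mu> * a ^ 2 + 2 * b * c - \<mu> * (e * i + f * h) - \<mu> ^ 2 * (d * g) = 0"
    "2 * a * c - \<mu> * (d * i + f * g) = 0" "c ^ 2 - \<mu> * (f * i) = 0"
    using \<mu> by (simp_all only: mult_eq_0_iff) simp_all
  define G where "G = [:b, c:] ^ 2 - smult \<mu> ([:e, f:] * [:h, i:])"
  have "poly ([:b, c:] * G) t = 0" for t
    using P[of 0 1 t] by (simp add: G_def algebra_simps power2_eq_square)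
  then have "[:b, c:] * G = 0"
    using poly_all_0_iff_0 by blast
  moreover have "G \<noteq> 0"
  proof
    assume "G = 0"
    \<comment> \<open>F = 0 leaves one relation between the coefficients of x^2 and y z in the
      pulled back form; the middle coefficient of G makes both vanish. The form would be zero, but
      it is 1 at a preimage of (1, 0, 0).\<close>
    then have "coeff G 1 = 0"
      by simp
    then have "2 * b * c = \<mu> * (e * i + f * h)"
      by (simp add: G_def power2_eq_square algebra_simps)
    then have "\<mu> * (a ^ 2 - \<mu> * (d * g)) = 0"
      using F(3) by algebra
    then have "a ^ 2 = \<mu> * (d * g)"
      using \<mu> by simp
    moreover obtain x y z where "a * x + b * y + c * z = 1" "d * x + e * y + f * z = 0" "g * x + h * y + i * z = 0"
      using inv by (rule invertible_mat3_solve)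
    ultimately show False
      using F \<open>2 * b * c = \<mu> * (e * i + f * h)\<close> by algebra
  qed
  ultimately have "[:b, c:] = 0"
    by (simp only: mult_eq_0_iff simp_thms)
  then have [simp]: "b = 0" "c = 0"
    by simp_all
  have 0: "e * h = 0" "f * i = 0" "e * g + d * h = 0" "d * i + f * g = 0"
    using F \<mu> by simp_all
  have "\<mu> * (a ^ 2 - (e * i + f * h) - \<mu> * (d * g)) = 0"
    using F(3) by simp algebra
  then have "a ^ 2 - (e * i + f * h) - \<mu> * (d * g) = 0"
    using \<mu> by (simp only: mult_eq_0_iff) simp
  then have a2: "a ^ 2 = e * i + f * h + \<mu> * (d * g)"
    by algebra
  have nz: "a \<noteq> 0" "e * i - f * h \<noteq> 0"
    using inv by (auto simp: invertible_mat3)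
  show thesis
  proof (cases "e = 0")
    case True
    with 0 nz have [simp]: "i = 0" "d = 0" "g = 0" "f \<noteq> 0" "h \<noteq> 0"
      by auto
    have "h / a = inverse (f / a)"
      using a2 nz True by (simp add: field_simps power2_eq_square)
    then have "\<tau> = proj_map (mat3 1 0 0  0 0 (f / a)  0 (inverse (f / a)) 0)"
      unfolding \<tau> using inv nz True by (subst proj_map_normalize[of a]) simp_all
    then show thesis
      using that(2)[of "f / a"] nz by simp
  next
    case False
    with 0 nz have [simp]: "h = 0" "g = 0" "f = 0" "d = 0" "i \<noteq> 0"
      by auto
    have "i / a = inverse (e / a)"
      using a2 nz False by (simp add: field_simps power2_eq_square)
    then have "\<tau> = proj_map (mat3 1 0 0  0 (e / a) 0  0 0 (inverse (e / a)))"
      unfolding \<tau> using inv nz False by (subst proj_map_normalize[of a]) simp_all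
    then show thesis
      using that(1)[of "e / a"] nz False by simp
  qed
qed

text \<open>\<sigma> acts diagonally on both components, so diagonal maps commute with it;
  exchanging y and z replaces \<alpha> by \<alpha>^-1.\<close>

lemma type_S'_Z_M:
  fixes E :: "'k::field_char_0 P2 set"
  assumes "type_S' \<alpha> E \<sigma>"
  defines "K \<equiv> {proj_map (mat3 1 0 0  0 e 0  0 0 (inverse e)) | e. e \<noteq> 0}"
  shows "\<sigma> [^]\<^bsub>BijGroup E\<^esub> (2::nat) \<noteq> \<one>\<^bsub>BijGroup E\<^esub> \<Longrightarrow> Z_set E \<sigma> = K"
    "\<sigma> [^]\<^bsub>BijGroup E\<^esub> (2::nat) = \<one>\<^bsub>BijGroup E\<^esub> \<Longrightarrow> Z_set E \<sigma> = Aut_down E"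
    "\<sigma> [^]\<^bsub>BijGroup E\<^esub> (6::nat) \<noteq> \<one>\<^bsub>BijGroup E\<^esub> \<Longrightarrow> M_set E \<sigma> = K"
    "\<sigma> [^]\<^bsub>BijGroup E\<^esub> (6::nat) = \<one>\<^bsub>BijGroup E\<^esub> \<Longrightarrow> M_set E \<sigma> = Aut_down E"
proof -
  define \<mu> where "\<mu> = (\<alpha> ^ 3 - 1) / \<alpha>"
  have E: "E = zero_locus (\<lambda>x y z. x) \<union> zero_locus (\<lambda>x y z. x ^ 2 - \<mu> * y * z)" and \<sigma>: "\<sigma> \<in> Bij E"
    and \<alpha>: "\<alpha> \<noteq> 0" and \<mu>: "\<mu> \<noteq> 0"
    and line: "\<And>b c. (b, c) \<noteq> (0, 0) \<Longrightarrow> \<sigma> (pt 0 b c) = pt 0 b (\<alpha> * c)"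
    and conic: "\<And>a b c. (a, b, c) \<noteq> (0, 0, 0) \<Longrightarrow> a ^ 2 - \<mu> * b * c = 0 \<Longrightarrow>
        \<sigma> (pt a b c) = pt a (\<alpha> * b) (inverse \<alpha> * c)"
    using assms by (auto simp: type_S'_def Let_def \<mu>_def intro: Aut_imp_Bij)
  note mem = conic_secant_mem[of _ _ _ \<mu>, folded E]
  have invs: "invertible (mat3 1 0 0  0 e 0  0 0 (inverse e))" "invertible (mat3 1 0 0  0 0 e  0 (inverse e) 0)"
    if "e \<noteq> 0" for e :: 'k
    using that by (auto simp: invertible_mat3)
  have cases: thesis if "p \<in> E"
    "\<And>y z. (y, z) \<noteq> (0, 0) \<Longrightarrow> p = pt 0 y z \<Longrightarrow> thesis"
    "\<And>x y z. x \<noteq> 0 \<Longrightarrow> x ^ 2 = \<mu> * y * z \<Longrightarrow> p = pt x y z \<Longrightarrow> thesis" for p thesis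
  proof -
    obtain x y z where "(x, y, z) \<noteq> (0, 0, 0)" "p = pt x y z"
      by (rule pt_exhaust)
    with that(1) that(2)[of y z] that(3)[of x y z] mem[of x y z] show thesis
      by (cases "x = 0") auto
  qed
  have K: "K \<subseteq> Aut_down E"
    unfolding K_def
  proof safe
    fix e :: 'k
    assume e: "e \<noteq> 0"
    then have [simp]: "\<mu> * (e * y) * (inverse e * z) = \<mu> * y * z" for y z
      by (simp add: field_simps)
    from e show "proj_map (mat3 1 0 0  0 e 0  0 0 (inverse e)) \<in> Aut_down E"
      by (intro proj_map_in_Aut_down[OF invs(1) mem]) simp_all
  qed
  have comm: "\<sigma> (\<tau> p) = \<tau> (\<sigma> p)" if "\<tau> \<in> K" and p: "p \<in> E" for \<tau> p
  proof -
    obtain e where e: "e \<noteq> 0" "\<tau> = proj_map (mat3 1 0 0  0 e 0  0 0 (inverse e))"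
      using \<open>\<tau> \<in> K\<close> by (auto simp: K_def)
    from e have [simp]: "\<mu> * (e * y) * (inverse e * z) = \<mu> * y * z" for y z
      by (simp add: field_simps)
    show ?thesis
      using p
    proof (rule cases)
      fix y z
      assume "(y, z) \<noteq> (0, 0)" "p = pt 0 y z"
      with e \<alpha> show ?thesis
        by (simp add: proj_map_pt invs line mult.left_commute)
    next
      fix x y z
      assume "x \<noteq> 0" "x ^ 2 = \<mu> * y * z" "p = pt x y z"
      with e \<alpha> show ?thesis
        by (simp add: proj_map_pt invs conic mult.left_commute)
    qed
  qed
  have inverts: "\<sigma> (\<tau> (\<sigma> p)) = \<tau> p" if \<tau>: "\<tau> \<in> Aut_down E - K" and p: "p \<in> E" for \<tau> p
  proof -
    have "\<tau> \<in> Aut_down (zero_locus (\<lambda>x y z. x) \<union> zero_locus (\<lambda>x y z. x ^ 2 - \<mu> * y * z))"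
      using \<tau> E by simp
    with \<mu> have "\<exists>e. e \<noteq> 0 \<and> \<tau> = proj_map (mat3 1 0 0  0 0 e  0 (inverse e) 0)"
      by (rule Aut_down_conic_secant) (use \<tau> in \<open>auto simp: K_def\<close>)
    then obtain e where e: "e \<noteq> 0" "\<tau> = proj_map (mat3 1 0 0  0 0 e  0 (inverse e) 0)"
      by blast
    show ?thesis
      using p
    proof (rule cases)
      fix y z
      assume "(y, z) \<noteq> (0, 0)" "p = pt 0 y z"
      with e \<alpha> show ?thesis
        by (auto simp: proj_map_pt invs line pt_eq_iff)
    next
      fix x y z
      assume xyz: "x \<noteq> 0" "x ^ 2 = \<mu> * y * z" "p = pt x y z"
      have [simp]: "\<mu> * (e * (inverse \<alpha> * z)) * (inverse e * (\<alpha> * y)) = \<mu> * y * z"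
        "\<alpha> * (e * (inverse \<alpha> * z)) = e * z" "inverse \<alpha> * (inverse e * (\<alpha> * y)) = inverse e * y"
        using e \<alpha> by (simp_all add: field_simps)
      show ?thesis
        using xyz e \<alpha> by (simp add: proj_map_pt invs conic)
    qed
  qed
  have pow_line: "(\<sigma> ^^ n) (pt 0 y z) = pt 0 y (\<alpha> ^ n * z)" if "(y, z) \<noteq> (0, 0)" for n y z
    using that \<alpha> by (induction n) (auto simp: line mult.assoc)
  have pow_conic: "(\<sigma> ^^ n) (pt x y z) = pt x (\<alpha> ^ n * y) (inverse \<alpha> ^ n * z)"
    if "x \<noteq> 0" "x ^ 2 = \<mu> * y * z" for n x y z
  proof (induction n)
    case (Suc n)
    have "\<mu> * (\<alpha> ^ n * y) * (inverse \<alpha> ^ n * z) = (\<alpha> * inverse \<alpha>) ^ n * (\<mu> * y * z)"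
      unfolding power_mult_distrib by (simp only: ac_simps)
    then have "x ^ 2 - \<mu> * (\<alpha> ^ n * y) * (inverse \<alpha> ^ n * z) = 0"
      using that(2) \<alpha> by simp
    with Suc that(1) show ?case
      by (simp add: conic mult.assoc)
  qed simp
  have six: "\<sigma> [^]\<^bsub>BijGroup E\<^esub> (6::nat) = \<one>\<^bsub>BijGroup E\<^esub> \<longleftrightarrow> \<alpha> ^ 6 = 1"
    unfolding BijGroup_pow_eq_one_iff[OF \<sigma>]
  proof
    assume "\<forall>p\<in>E. (\<sigma> ^^ 6) p = p"
    then have "(\<sigma> ^^ 6) (pt 0 1 1) = pt 0 1 1"
      by (simp add: mem)
    then show "\<alpha> ^ 6 = 1"
      by (simp add: pow_line pt_eq_iff)
  next
    assume \<alpha>6: "\<alpha> ^ 6 = 1"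
    show "\<forall>p\<in>E. (\<sigma> ^^ 6) p = p"
    proof
      fix p
      assume "p \<in> E"
      then show "(\<sigma> ^^ 6) p = p"
        by (rule cases) (simp_all add: pow_line pow_conic \<alpha>6 power_inverse)
    qed
  qed
  have lin: "(\<exists>\<rho>\<in>Aut_down E. \<forall>p\<in>E. \<rho> p = \<sigma> (\<sigma> p)) \<longleftrightarrow> \<alpha> ^ 6 = 1"
  proof
    assume "\<exists>\<rho>\<in>Aut_down E. \<forall>p\<in>E. \<rho> p = \<sigma> (\<sigma> p)"
    then obtain \<rho> where \<rho>: "\<rho> \<in> Aut_down E" "\<forall>p\<in>E. \<rho> p = \<sigma> (\<sigma> p)"
      by blast
    \<comment> \<open>(0 : 1 : 1) tests the line, (\<mu> : \<mu> : 1) the conic, and (0 : 1 : 0)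
      tells diagonal maps from those exchanging the two intersection points.\<close>
    have 1: "\<rho> (pt 0 1 1) = \<sigma> (\<sigma> (pt 0 1 1))" "\<rho> (pt 0 1 0) = \<sigma> (\<sigma> (pt 0 1 0))"
      "\<rho> (pt \<mu> \<mu> 1) = \<sigma> (\<sigma> (pt \<mu> \<mu> 1))"
      using \<rho>(2) \<mu> by (simp_all add: mem power2_eq_square)
    from \<mu> \<rho>(1)[unfolded E] show "\<alpha> ^ 6 = 1"
    proof (rule Aut_down_conic_secant)
      fix e
      assume e: "e \<noteq> 0" "\<rho> = proj_map (mat3 1 0 0  0 e 0  0 0 (inverse e))"
      with 1(3) \<mu> \<alpha> have "e = \<alpha> ^ 2"
        by (simp add: proj_map_pt invs conic pt_eq_iff power2_eq_square)
      moreover from 1(1) e \<alpha> have "e * (\<alpha> * \<alpha>) = inverse e"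
        by (simp add: proj_map_pt invs line pt_eq_iff)
      with e have "(e * (\<alpha> * \<alpha>)) * e = 1"
        by simp
      ultimately show "\<alpha> ^ 6 = 1"
        by algebra
    next
      fix e
      assume e: "e \<noteq> 0" "\<rho> = proj_map (mat3 1 0 0  0 0 e  0 (inverse e) 0)"
      with 1(2) \<alpha> show "\<alpha> ^ 6 = 1"
        by (simp add: proj_map_pt invs line pt_eq_iff)
    qed
  next
    assume \<alpha>6: "\<alpha> ^ 6 = 1"
    \<comment> \<open>This map is \<sigma>^2 on the conic for every \<alpha>. On the line it
      multiplies z/y by \<alpha>^-4, which is \<alpha>^2 because \<alpha>^6 = 1.\<close>
    let ?\<rho> = "proj_map (mat3 1 0 0  0 (\<alpha> ^ 2) 0  0 0 (inverse (\<alpha> ^ 2)))"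
    have "?\<rho> \<in> K"
      unfolding K_def using \<alpha> by (intro CollectI exI[of _ "\<alpha> ^ 2"]) simp
    then have "?\<rho> \<in> Aut_down E"
      using K by blast
    moreover have "?\<rho> p = \<sigma> (\<sigma> p)" if "p \<in> E" for p
      using that
    proof (rule cases)
      fix y z
      assume "(y, z) \<noteq> (0, 0)" "p = pt 0 y z"
      moreover have "\<alpha> ^ 2 * \<alpha> ^ 2 = inverse (\<alpha> ^ 2)"
        using \<alpha>6 \<alpha> by (simp add: field_simps flip: power_add)
      ultimately show ?thesis
        using \<alpha> invs(1)[of "\<alpha> ^ 2"] by (auto simp: proj_map_pt line pt_eq_iff power2_eq_square mult.assoc)
    next
      fix x y z
      assume "x \<noteq> 0" "x ^ 2 = \<mu> * y * z" "p = pt x y z"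
      with \<alpha> invs(1)[of "\<alpha> ^ 2"] show ?thesis
        by (simp add: proj_map_pt conic power2_eq_square mult.assoc)
    qed
    ultimately show "\<exists>\<rho>\<in>Aut_down E. \<forall>p\<in>E. \<rho> p = \<sigma> (\<sigma> p)"
      by blast
  qed
  show "\<sigma> [^]\<^bsub>BijGroup E\<^esub> (2::nat) \<noteq> \<one>\<^bsub>BijGroup E\<^esub> \<Longrightarrow> Z_set E \<sigma> = K"
    "\<sigma> [^]\<^bsub>BijGroup E\<^esub> (2::nat) = \<one>\<^bsub>BijGroup E\<^esub> \<Longrightarrow> Z_set E \<sigma> = Aut_down E"
    "\<sigma> [^]\<^bsub>BijGroup E\<^esub> (6::nat) \<noteq> \<one>\<^bsub>BijGroup E\<^esub> \<Longrightarrow> M_set E \<sigma> = K"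
    "\<sigma> [^]\<^bsub>BijGroup E\<^esub> (6::nat) = \<one>\<^bsub>BijGroup E\<^esub> \<Longrightarrow> M_set E \<sigma> = Aut_down E"
    using Z_M_if_commute_or_invert[OF \<sigma> K comm inverts lin[folded six]] by blast+
qed

section \<open>Type S\<close>

lemma triangle_mem:
  assumes "(x, y, z) \<noteq> (0, 0, 0 :: 'k::field)"
  shows "pt x y z \<in> zero_locus (\<lambda>x y z. x) \<union> zero_locus (\<lambda>x y z. y) \<union> zero_locus (\<lambda>x y z. z) \<longleftrightarrow>
    x * y * z = 0"
proof -
  have "pt x y z \<in> zero_locus (\<lambda>x y z. x) \<longleftrightarrow> x = 0" "pt x y z \<in> zero_locus (\<lambda>x y z. y) \<longleftrightarrow> y = 0"
    "pt x y z \<in> zero_locus (\<lambda>x y z. z) \<longleftrightarrow> z = 0"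
    using assms by (intro pt_mem_zero_locus[where n = 1]; simp)+
  then show ?thesis by simp
qed

text \<open>Polynomials over a field form an integral domain; this sends each side of the triangle
  into a single side.\<close>

lemma three_linear_factors:
  assumes "\<And>t. (a + a' * t) * (b + b' * t) * (c + c' * t) = (0 :: 'k::field_char_0)"
  shows "a = 0 \<and> a' = 0 \<or> b = 0 \<and> b' = 0 \<or> c = 0 \<and> c' = 0"
proof -
  have "poly ([:a, a':] * [:b, b':] * [:c, c':]) t = 0" for t
    using assms[of t] by (simp add: algebra_simps)
  then have "[:a, a':] * [:b, b':] * [:c, c':] = 0"
    using poly_all_0_iff_0 by blast
  then have "[:a, a':] = 0 \<or> [:b, b':] = 0 \<or> [:c, c':] = 0"
    by (simp only: mult_eq_0_iff disj_assoc)
  then show ?thesis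
    by simp
qed

text \<open>Monomial matrices over the cyclic permutations, scaled so that the nonzero entry of the
  first row is 1. The three families are the cosets of \<open>D_set\<close> under powers of the
  cyclic permutation matrix.\<close>

definition triangle_even :: "('k::field P2 \<Rightarrow> 'k P2) set" where
  "triangle_even = {proj_map (mat3 1 0 0  0 e 0  0 0 i) | e i. e \<noteq> 0 \<and> i \<noteq> 0} \<union>
    {proj_map (mat3 0 1 0  0 0 e  i 0 0) | e i. e \<noteq> 0 \<and> i \<noteq> 0} \<union>
    {proj_map (mat3 0 0 1  e 0 0  0 i 0) | e i. e \<noteq> 0 \<and> i \<noteq> 0}"

text \<open>The monomial matrices over transpositions: they reverse the orientation of the triangle
  and so conjugate \<sigma> to its inverse.\<close>

definition triangle_odd :: "('k::field P2 \<Rightarrow> 'k P2) set" where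
  "triangle_odd = {proj_map (mat3 1 0 0  0 0 e  0 i 0) | e i. e \<noteq> 0 \<and> i \<noteq> 0} \<union>
    {proj_map (mat3 0 1 0  e 0 0  0 0 i) | e i. e \<noteq> 0 \<and> i \<noteq> 0} \<union>
    {proj_map (mat3 0 0 1  0 e 0  i 0 0) | e i. e \<noteq> 0 \<and> i \<noteq> 0}"

text \<open>Each side is sent into a side, so for any two columns some row vanishes on both. Of the
  27 combinations invertibility leaves the six permutations.\<close>

lemma Aut_down_triangle:
  fixes \<tau> :: "'k::field_char_0 P2 \<Rightarrow> 'k P2"
  assumes "\<tau> \<in> Aut_down (zero_locus (\<lambda>x y z. x) \<union> zero_locus (\<lambda>x y z. y) \<union> zero_locus (\<lambda>x y z. z))"
  shows "\<tau> \<in> triangle_even \<union> triangle_odd"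
proof -
  obtain a b c d e f g h i where
    inv: "invertible (mat3 a b c d e f g h (i :: 'k))" and \<tau>: "\<tau> = proj_map (mat3 a b c d e f g h i)"
    and P: "\<And>x y z. (x, y, z) \<noteq> (0, 0, 0) \<Longrightarrow> x * y * z = 0 \<Longrightarrow>
      (a * x + b * y + c * z) * (d * x + e * y + f * z) * (g * x + h * y + i * z) = 0"
    using assms triangle_mem
    by (rule Aut_downE[where P = "\<lambda>x y z. x * y * z = 0"]) blast+
  have "(b + c * t) * (e + f * t) * (h + i * t) = 0" "(a + c * t) * (d + f * t) * (g + i * t) = 0"
    "(a + b * t) * (d + e * t) * (g + h * t) = 0" for t
    using P[of 0 1 t] P[of 1 0 t] P[of 1 t 0] by simp_all
  note rows = three_linear_factors[OF this(1)] three_linear_factors[OF this(2)] three_linear_factors[OF this(3)]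
  have det: "a * (e * i - f * h) - b * (d * i - f * g) + c * (d * h - e * g) \<noteq> 0"
    using inv by (simp add: invertible_mat3)
  have "b = 0 \<and> c = 0 \<and> d = 0 \<and> f = 0 \<and> g = 0 \<and> h = 0 \<or> b = 0 \<and> c = 0 \<and> g = 0 \<and> i = 0 \<and> d = 0 \<and> e = 0 \<or>
      e = 0 \<and> f = 0 \<and> a = 0 \<and> c = 0 \<and> g = 0 \<and> h = 0 \<or> e = 0 \<and> f = 0 \<and> g = 0 \<and> i = 0 \<and> a = 0 \<and> b = 0 \<or>
      h = 0 \<and> i = 0 \<and> a = 0 \<and> c = 0 \<and> d = 0 \<and> e = 0 \<or> h = 0 \<and> i = 0 \<and> d = 0 \<and> f = 0 \<and> a = 0 \<and> b = 0"
    using rows det by (elim disjE conjE; simp)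
  then show ?thesis
  proof (elim disjE conjE, goal_cases)
    case 1
    with det have "a \<noteq> 0" "e / a \<noteq> 0" "i / a \<noteq> 0" by auto
    moreover have "\<tau> = proj_map (mat3 1 0 0  0 (e / a) 0  0 0 (i / a))"
      unfolding \<tau> using 1 inv \<open>a \<noteq> 0\<close> by (subst proj_map_normalize[of a]) simp_all
    ultimately show ?thesis
      unfolding triangle_even_def by blast
  next
    case 2
    with det have "a \<noteq> 0" "f / a \<noteq> 0" "h / a \<noteq> 0" by auto
    moreover have "\<tau> = proj_map (mat3 1 0 0  0 0 (f / a)  0 (h / a) 0)"
      unfolding \<tau> using 2 inv \<open>a \<noteq> 0\<close> by (subst proj_map_normalize[of a]) simp_all
    ultimately show ?thesis
      unfolding triangle_odd_def by blast
  next
    case 3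
    with det have "b \<noteq> 0" "d / b \<noteq> 0" "i / b \<noteq> 0" by auto
    moreover have "\<tau> = proj_map (mat3 0 1 0  (d / b) 0 0  0 0 (i / b))"
      unfolding \<tau> using 3 inv \<open>b \<noteq> 0\<close> by (subst proj_map_normalize[of b]) simp_all
    ultimately show ?thesis
      unfolding triangle_odd_def by blast
  next
    case 4
    with det have "c \<noteq> 0" "d / c \<noteq> 0" "h / c \<noteq> 0" by auto
    moreover have "\<tau> = proj_map (mat3 0 0 1  (d / c) 0 0  0 (h / c) 0)"
      unfolding \<tau> using 4 inv \<open>c \<noteq> 0\<close> by (subst proj_map_normalize[of c]) simp_all
    ultimately show ?thesis
      unfolding triangle_even_def by blast
  next
    case 5
    with det have "b \<noteq> 0" "f / b \<noteq> 0" "g / b \<noteq> 0" by auto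
    moreover have "\<tau> = proj_map (mat3 0 1 0  0 0 (f / b)  (g / b) 0 0)"
      unfolding \<tau> using 5 inv \<open>b \<noteq> 0\<close> by (subst proj_map_normalize[of b]) simp_all
    ultimately show ?thesis
      unfolding triangle_even_def by blast
  next
    case 6
    with det have "c \<noteq> 0" "e / c \<noteq> 0" "g / c \<noteq> 0" by auto
    moreover have "\<tau> = proj_map (mat3 0 0 1  0 (e / c) 0  (g / c) 0 0)"
      unfolding \<tau> using 6 inv \<open>c \<noteq> 0\<close> by (subst proj_map_normalize[of c]) simp_all
    ultimately show ?thesis
      unfolding triangle_odd_def by blast
  qed
qed

text \<open>\<sigma> multiplies z/y, x/z and y/x by \<alpha> on the sides x = 0, y = 0 and z = 0.
  Cyclic permutations of the coordinates respect this, while a transposition inverts all three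
  ratios.\<close>

lemma type_S_Z_M:
  fixes E :: "'k::field_char_0 P2 set"
  assumes "type_S \<alpha> E \<sigma>"
  shows "\<sigma> [^]\<^bsub>BijGroup E\<^esub> (2::nat) \<noteq> \<one>\<^bsub>BijGroup E\<^esub> \<Longrightarrow> Z_set E \<sigma> = triangle_even"
    "\<sigma> [^]\<^bsub>BijGroup E\<^esub> (2::nat) = \<one>\<^bsub>BijGroup E\<^esub> \<Longrightarrow> Z_set E \<sigma> = Aut_down E"
    "\<sigma> [^]\<^bsub>BijGroup E\<^esub> (6::nat) \<noteq> \<one>\<^bsub>BijGroup E\<^esub> \<Longrightarrow> M_set E \<sigma> = triangle_even"
    "\<sigma> [^]\<^bsub>BijGroup E\<^esub> (6::nat) = \<one>\<^bsub>BijGroup E\<^esub> \<Longrightarrow> M_set E \<sigma> = Aut_down E"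
proof -
  have E: "E = zero_locus (\<lambda>x y z. x) \<union> zero_locus (\<lambda>x y z. y) \<union> zero_locus (\<lambda>x y z. z)"
    and \<sigma>: "\<sigma> \<in> Bij E" and \<alpha>: "\<alpha> \<noteq> 0"
    and act: "\<And>b c. b \<noteq> 0 \<or> c \<noteq> 0 \<Longrightarrow> \<sigma> (pt 0 b c) = pt 0 b (\<alpha> * c)"
     "\<And>a c. a \<noteq> 0 \<or> c \<noteq> 0 \<Longrightarrow> \<sigma> (pt a 0 c) = pt (\<alpha> * a) 0 c"
     "\<And>a b. a \<noteq> 0 \<or> b \<noteq> 0 \<Longrightarrow> \<sigma> (pt a b 0) = pt a (\<alpha> * b) 0"
    using assms by (auto simp: type_S_def intro: Aut_imp_Bij)
  note mem = triangle_mem[where ?'k = 'k, folded E]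
  have invs: "invertible (mat3 1 0 0  0 e 0  0 0 i)" "invertible (mat3 0 1 0  0 0 e  i 0 0)"
      "invertible (mat3 0 0 1  e 0 0  0 i 0)" "invertible (mat3 1 0 0  0 0 e  0 i 0)"
      "invertible (mat3 0 1 0  e 0 0  0 0 i)" "invertible (mat3 0 0 1  0 e 0  i 0 0)"
    if "e \<noteq> 0" "i \<noteq> 0" for e i :: 'k
    using that by (auto simp: invertible_mat3)
  have cases: thesis if "p \<in> E"
    "\<And>y z. y \<noteq> 0 \<or> z \<noteq> 0 \<Longrightarrow> p = pt 0 y z \<Longrightarrow> thesis"
    "\<And>x z. x \<noteq> 0 \<or> z \<noteq> 0 \<Longrightarrow> p = pt x 0 z \<Longrightarrow> thesis"
    "\<And>x y. x \<noteq> 0 \<or> y \<noteq> 0 \<Longrightarrow> p = pt x y 0 \<Longrightarrow> thesis" for p thesis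
  proof -
    obtain x y z where xyz: "(x, y, z) \<noteq> (0, 0, 0)" "p = pt x y z"
      by (rule pt_exhaust)
    with that(1) mem[of x y z] consider "x = 0" | "y = 0" | "z = 0"
      by auto
    then show thesis
      using xyz that(2)[of y z] that(3)[of x z] that(4)[of x y] by cases auto
  qed
  have even: thesis if "\<tau> \<in> triangle_even"
    "\<And>e i. e \<noteq> 0 \<Longrightarrow> i \<noteq> 0 \<Longrightarrow> \<tau> = proj_map (mat3 1 0 0  0 e 0  0 0 i) \<Longrightarrow> thesis"
    "\<And>e i. e \<noteq> 0 \<Longrightarrow> i \<noteq> 0 \<Longrightarrow> \<tau> = proj_map (mat3 0 1 0  0 0 e  i 0 0) \<Longrightarrow> thesis"
    "\<And>e i. e \<noteq> 0 \<Longrightarrow> i \<noteq> 0 \<Longrightarrow> \<tau> = proj_map (mat3 0 0 1  e 0 0  0 i 0) \<Longrightarrow> thesis" for \<tau> :: "'k P2 \<Rightarrow> 'k P2" and thesis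
    using that unfolding triangle_even_def by blast
  have odd: thesis if "\<tau> \<in> triangle_odd"
    "\<And>e i. e \<noteq> 0 \<Longrightarrow> i \<noteq> 0 \<Longrightarrow> \<tau> = proj_map (mat3 1 0 0  0 0 e  0 i 0) \<Longrightarrow> thesis"
    "\<And>e i. e \<noteq> 0 \<Longrightarrow> i \<noteq> 0 \<Longrightarrow> \<tau> = proj_map (mat3 0 1 0  e 0 0  0 0 i) \<Longrightarrow> thesis"
    "\<And>e i. e \<noteq> 0 \<Longrightarrow> i \<noteq> 0 \<Longrightarrow> \<tau> = proj_map (mat3 0 0 1  0 e 0  i 0 0) \<Longrightarrow> thesis" for \<tau> :: "'k P2 \<Rightarrow> 'k P2" and thesis
    using that unfolding triangle_odd_def by blast
  have K: "triangle_even \<subseteq> Aut_down E"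
  proof
    fix \<tau> :: "'k P2 \<Rightarrow> 'k P2"
    assume "\<tau> \<in> triangle_even"
    then show "\<tau> \<in> Aut_down E"
    proof (rule even)
      fix e i :: 'k
      assume ei: "e \<noteq> 0" "i \<noteq> 0"
      show "\<tau> \<in> Aut_down E" if \<tau>: "\<tau> = proj_map (mat3 1 0 0  0 e 0  0 0 i)"
        unfolding \<tau> by (rule proj_map_in_Aut_down[OF invs(1)[OF ei] mem]) (auto simp: ei)
      show "\<tau> \<in> Aut_down E" if \<tau>: "\<tau> = proj_map (mat3 0 1 0  0 0 e  i 0 0)"
        unfolding \<tau> by (rule proj_map_in_Aut_down[OF invs(2)[OF ei] mem]) (auto simp: ei)
      show "\<tau> \<in> Aut_down E" if \<tau>: "\<tau> = proj_map (mat3 0 0 1  e 0 0  0 i 0)"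
        unfolding \<tau> by (rule proj_map_in_Aut_down[OF invs(3)[OF ei] mem]) (auto simp: ei)
    qed
  qed
  have comm: "\<sigma> (\<tau> p) = \<tau> (\<sigma> p)" if \<tau>: "\<tau> \<in> triangle_even" and p: "p \<in> E" for \<tau> p
    by (rule even[OF \<tau>]; rule cases[OF p]) (auto simp: proj_map_pt invs act \<alpha> mult.left_commute)
  have inverts: "\<sigma> (\<tau> (\<sigma> p)) = \<tau> p" if \<tau>: "\<tau> \<in> Aut_down E - triangle_even" and p: "p \<in> E" for \<tau> p
  proof -
    have \<tau>: "\<tau> \<in> triangle_odd"
      using Aut_down_triangle[of \<tau>] \<tau> by (auto simp: E)
    show ?thesis
      by (rule odd[OF \<tau>]; rule cases[OF p]) (auto simp: proj_map_pt invs act \<alpha> pt_eq_iff)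
  qed
  have pow: "y \<noteq> 0 \<or> z \<noteq> 0 \<Longrightarrow> (\<sigma> ^^ n) (pt 0 y z) = pt 0 y (\<alpha> ^ n * z)"
    "x \<noteq> 0 \<or> z \<noteq> 0 \<Longrightarrow> (\<sigma> ^^ n) (pt x 0 z) = pt (\<alpha> ^ n * x) 0 z"
    "x \<noteq> 0 \<or> y \<noteq> 0 \<Longrightarrow> (\<sigma> ^^ n) (pt x y 0) = pt x (\<alpha> ^ n * y) 0" for n x y z
    by (induction n) (auto simp: act \<alpha> mult.assoc)
  have six: "\<sigma> [^]\<^bsub>BijGroup E\<^esub> (6::nat) = \<one>\<^bsub>BijGroup E\<^esub> \<longleftrightarrow> \<alpha> ^ 6 = 1"
    unfolding BijGroup_pow_eq_one_iff[OF \<sigma>]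
  proof
    assume "\<forall>p\<in>E. (\<sigma> ^^ 6) p = p"
    then have "(\<sigma> ^^ 6) (pt 0 1 1) = pt 0 1 1"
      by (simp add: mem)
    then show "\<alpha> ^ 6 = 1"
      by (simp add: pow pt_eq_iff)
  next
    assume \<alpha>6: "\<alpha> ^ 6 = 1"
    show "\<forall>p\<in>E. (\<sigma> ^^ 6) p = p"
    proof
      fix p
      assume "p \<in> E"
      then show "(\<sigma> ^^ 6) p = p"
        by (rule cases) (simp_all add: pow \<alpha>6)
    qed
  qed
  have lin: "(\<exists>\<rho>\<in>Aut_down E. \<forall>p\<in>E. \<rho> p = \<sigma> (\<sigma> p)) \<longleftrightarrow> \<alpha> ^ 6 = 1"
  proof
    assume "\<exists>\<rho>\<in>Aut_down E. \<forall>p\<in>E. \<rho> p = \<sigma> (\<sigma> p)"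
    then obtain \<rho> where \<rho>: "\<rho> \<in> Aut_down E" "\<forall>p\<in>E. \<rho> p = \<sigma> (\<sigma> p)"
      by blast
    \<comment> \<open>\<sigma> fixes the vertices, so a linear map equal to \<sigma>^2 cannot
      permute them; the other three points measure the ratios on the sides.\<close>
    then have *: "\<rho> (pt 1 0 0) = \<sigma> (\<sigma> (pt 1 0 0))" "\<rho> (pt 0 1 0) = \<sigma> (\<sigma> (pt 0 1 0))"
      "\<rho> (pt 0 1 1) = \<sigma> (\<sigma> (pt 0 1 1))" "\<rho> (pt 1 0 1) = \<sigma> (\<sigma> (pt 1 0 1))" "\<rho> (pt 1 1 0) = \<sigma> (\<sigma> (pt 1 1 0))"
      by (simp_all add: mem)
    consider "\<rho> \<in> triangle_even" | "\<rho> \<in> triangle_odd"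
      using Aut_down_triangle[of \<rho>] \<rho> by (auto simp: E)
    then show "\<alpha> ^ 6 = 1"
    proof cases
      case 1
      then show ?thesis
      proof (rule even)
        fix e i
        assume "e \<noteq> 0" "i \<noteq> 0" "\<rho> = proj_map (mat3 1 0 0  0 e 0  0 0 i)"
        with *(3-5) \<alpha> have "i = e * (\<alpha> * \<alpha>)" "i * (\<alpha> * \<alpha>) = 1" "e = \<alpha> * \<alpha>"
          by (auto simp: proj_map_pt invs act pt_eq_iff mult.commute)
        then show ?thesis
          by algebra
      qed (use *(1,2) \<alpha> in \<open>auto simp: proj_map_pt invs act pt_eq_iff\<close>)
    next
      case 2
      then show ?thesis
        by (rule odd) (use *(1,2) \<alpha> in \<open>auto simp: proj_map_pt invs act pt_eq_iff\<close>)
    qed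
  next
    assume \<alpha>6: "\<alpha> ^ 6 = 1"
    \<comment> \<open>The ratios y/x and z/y are multiplied by \<alpha>^2 by choice; x/z is then
      multiplied by \<alpha>^-4, which equals \<alpha>^2.\<close>
    let ?\<rho> = "proj_map (mat3 1 0 0  0 (\<alpha> * \<alpha>) 0  0 0 (\<alpha> ^ 4))"
    have "\<alpha> * \<alpha> \<noteq> 0" "\<alpha> ^ 4 \<noteq> 0"
      using \<alpha> by simp_all
    then have "?\<rho> \<in> triangle_even"
      unfolding triangle_even_def by blast
    then have "?\<rho> \<in> Aut_down E"
      using K by blast
    moreover have "?\<rho> p = \<sigma> (\<sigma> p)" if "p \<in> E" for p
    proof -
      have inv: "invertible (mat3 1 0 0  0 (\<alpha> * \<alpha>) 0  0 0 (\<alpha> ^ 4))"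
        using \<alpha> by (intro invs) simp_all
      have \<alpha>4: "\<alpha> * (\<alpha> * (\<alpha> * \<alpha>)) = \<alpha> ^ 4" "\<alpha> ^ 4 * (\<alpha> * \<alpha>) = 1"
        using \<alpha>6 by (simp_all add: numeral_eq_Suc mult.assoc)
      show ?thesis
        using that
        by (rule cases) (auto simp: proj_map_pt inv act \<alpha> pt_eq_iff \<alpha>4 mult.assoc)
    qed
    ultimately show "\<exists>\<rho>\<in>Aut_down E. \<forall>p\<in>E. \<rho> p = \<sigma> (\<sigma> p)"
      by blast
  qed
  show "\<sigma> [^]\<^bsub>BijGroup E\<^esub> (2::nat) \<noteq> \<one>\<^bsub>BijGroup E\<^esub> \<Longrightarrow> Z_set E \<sigma> = triangle_even"
    "\<sigma> [^]\<^bsub>BijGroup E\<^esub> (2::nat) = \<one>\<^bsub>BijGroup E\<^esub> \<Longrightarrow> Z_set E \<sigma> = Aut_down E"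
    "\<sigma> [^]\<^bsub>BijGroup E\<^esub> (6::nat) \<noteq> \<one>\<^bsub>BijGroup E\<^esub> \<Longrightarrow> M_set E \<sigma> = triangle_even"
    "\<sigma> [^]\<^bsub>BijGroup E\<^esub> (6::nat) = \<one>\<^bsub>BijGroup E\<^esub> \<Longrightarrow> M_set E \<sigma> = Aut_down E"
    using Z_M_if_commute_or_invert[OF \<sigma> K comm inverts lin[folded six]] by blast+
qed

text \<open>The generator has order 3, so its inverse is its square and conjugation by it is
  computed with products only.\<close>

lemma semidirect_triangle:
  "semidirect PGL3 (triangle_even :: ('k::field P2 \<Rightarrow> 'k P2) set) D_set
    (generate PGL3 {proj_map (mat3 0 1 0  0 0 1  1 0 0)})"
proof -
  interpret group "PGL3 :: ('k P2 \<Rightarrow> 'k P2) monoid"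
    by (rule group_PGL3)
  let ?d = "\<lambda>e i. mat3 1 0 0  0 e 0  0 0 (i :: 'k)" and ?C = "mat3 0 1 0  0 0 1  1 0 (0 :: 'k)"
  let ?c = "proj_map ?C"
  have D: "D_set = {proj_map (?d e i) | e i. e \<noteq> 0 \<and> i \<noteq> 0}"
    by (simp add: D_set_def)
  have inv: "invertible (?d e i)" if "e \<noteq> 0" "i \<noteq> 0" for e i
    using that by (simp add: invertible_mat3)
  have invC: "invertible ?C" "invertible (mat3 0 0 1  1 0 0  0 1 (0 :: 'k))"
    by (simp_all add: invertible_mat3)
  have cC: "?c \<in> carrier PGL3"
    using invC by (auto simp: carrier_PGL3)
  have c2: "?c \<circ> ?c = proj_map (mat3 0 0 1  1 0 0  0 1 0)"
    by (simp add: proj_map_comp invC mat3_mult)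
  have c3: "?c \<circ> ?c \<circ> ?c = id"
    unfolding c2 by (simp add: proj_map_comp invC mat3_mult)
  have mult: "proj_map (?d e i) \<circ> proj_map (?d e' i') = proj_map (?d (e * e') (i * i'))"
    if "e \<noteq> 0" "i \<noteq> 0" "e' \<noteq> 0" "i' \<noteq> 0" for e e' i i'
    using that by (simp add: proj_map_comp inv mat3_mult)
  have N: "subgroup D_set (PGL3 :: ('k P2 \<Rightarrow> 'k P2) monoid)"
  proof (rule subgroup_PGL3I)
    show "D_set \<subseteq> carrier (PGL3 :: ('k P2 \<Rightarrow> 'k P2) monoid)"
      using inv by (auto simp: D carrier_PGL3)
    show "(id :: 'k P2 \<Rightarrow> 'k P2) \<in> D_set"
      unfolding D by (intro CollectI exI[of _ 1]) simp
  next
    fix x y :: "'k P2 \<Rightarrow> 'k P2"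
    assume "x \<in> D_set" "y \<in> D_set"
    then obtain e i e' i' where x: "e \<noteq> 0" "i \<noteq> 0" "x = proj_map (?d e i)"
      "e' \<noteq> 0" "i' \<noteq> 0" "y = proj_map (?d e' i')"
      unfolding D by blast
    then have "e * e' \<noteq> 0" "i * i' \<noteq> 0"
      by simp_all
    then show "x \<circ> y \<in> D_set"
      unfolding x(3,6) mult[OF x(1,2,4,5)] D by blast
  next
    fix x :: "'k P2 \<Rightarrow> 'k P2"
    assume "x \<in> D_set"
    then obtain e i where x: "e \<noteq> 0" "i \<noteq> 0" "x = proj_map (?d e i)"
      unfolding D by blast
    then have "proj_map (?d (inverse e) (inverse i)) \<circ> x = id"
      by (simp add: mult)
    moreover have "proj_map (?d (inverse e) (inverse i)) \<in> D_set"
      unfolding D using x nonzero_imp_inverse_nonzero by blast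
    ultimately show "\<exists>y\<in>D_set. y \<circ> x = id"
      by blast
  qed
  have H: "generate PGL3 {?c} = {id, ?c, ?c \<circ> ?c}"
    using generate_order_3[OF cC] c3 by simp
  have dc: "proj_map (?d e i) \<circ> ?c = proj_map (mat3 0 1 0  0 0 e  i 0 0)"
    "proj_map (?d e i) \<circ> (?c \<circ> ?c) = proj_map (mat3 0 0 1  e 0 0  0 i 0)" if "e \<noteq> 0" "i \<noteq> 0" for e i
    unfolding c2 using that by (simp_all add: proj_map_comp inv invC mat3_mult)
  have conj: "?c \<circ> n \<circ> (?c \<circ> ?c) \<in> D_set" if "n \<in> D_set" for n
  proof -
    from \<open>n \<in> D_set\<close> obtain e i where n: "e \<noteq> 0" "i \<noteq> 0" "n = proj_map (?d e i)"
      unfolding D by blast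
    \<comment> \<open>Conjugation shifts the diagonal entries cyclically; dividing by the new first
      entry restores the normal form.\<close>
    have "?c \<circ> n \<circ> (?c \<circ> ?c) = proj_map (mat3 e 0 0  0 i 0  0 0 1)"
      unfolding c2 n(3) using n(1,2) by (simp add: proj_map_comp invertible_mat3 mat3_mult)
    also have "\<dots> = proj_map (?d (i / e) (1 / e))"
      using n(1,2) by (subst proj_map_normalize[of e]) (simp_all add: invertible_mat3)
    also have "\<dots> \<in> D_set"
      unfolding D using n(1,2) by (intro CollectI exI[of _ "i / e"] exI[of _ "1 / e"]) simp
    finally show ?thesis .
  qed
  show ?thesis
  proof (rule semidirectI)
    show "subgroup D_set (PGL3 :: ('k P2 \<Rightarrow> 'k P2) monoid)"
      by (rule N)
    show "subgroup (generate PGL3 {?c}) PGL3"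
      using cC by (intro generate_is_subgroup) simp
    have "?c \<notin> D_set" "?c \<circ> ?c \<notin> D_set"
    proof -
      have "proj_map (?d e i) (pt 1 0 0) \<noteq> ?c (pt 1 0 0)"
        "proj_map (?d e i) (pt 1 0 0) \<noteq> (?c \<circ> ?c) (pt 1 0 0)" if "e \<noteq> 0" "i \<noteq> 0" for e i
        unfolding c2 using that by (simp_all add: proj_map_pt inv invC pt_eq_iff)
      then show "?c \<notin> D_set" "?c \<circ> ?c \<notin> D_set"
        unfolding D by (smt (verit) mem_Collect_eq)+
    qed
    moreover have "(id :: 'k P2 \<Rightarrow> 'k P2) \<in> D_set"
      using subgroup.one_closed[OF N] by simp
    ultimately show "D_set \<inter> generate PGL3 {?c} = {\<one>\<^bsub>PGL3\<^esub>}"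
      unfolding H by auto
    have "D_set <#>\<^bsub>PGL3\<^esub> {id, ?c, ?c \<circ> ?c} =
        D_set \<union> (\<lambda>n. n \<circ> ?c) ` D_set \<union> (\<lambda>n. n \<circ> (?c \<circ> ?c)) ` D_set"
      by (auto simp: set_mult_def)
    also have "(\<lambda>n. n \<circ> ?c) ` D_set = {proj_map (mat3 0 1 0  0 0 e  i 0 0) | e i. e \<noteq> 0 \<and> i \<noteq> 0}"
      unfolding D using dc(1) by (auto simp: image_iff) metis+
    also have "(\<lambda>n. n \<circ> (?c \<circ> ?c)) ` D_set = {proj_map (mat3 0 0 1  e 0 0  0 i 0) | e i. e \<noteq> 0 \<and> i \<noteq> 0}"
      unfolding D using dc(2) by (auto simp: image_iff) metis+
    finally show "triangle_even = D_set <#>\<^bsub>PGL3\<^esub> generate PGL3 {?c}"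
      unfolding H D triangle_even_def by (rule sym)
  next
    fix n k :: "'k P2 \<Rightarrow> 'k P2"
    assume n: "n \<in> D_set" and "k \<in> generate PGL3 {?c}"
    then consider "k = id" | "k = ?c" | "k = ?c \<circ> ?c"
      unfolding H by blast
    then show "k \<otimes>\<^bsub>PGL3\<^esub> n \<otimes>\<^bsub>PGL3\<^esub> inv\<^bsub>PGL3\<^esub> k \<in> D_set"
    proof cases
      case 1
      with inv_one n show ?thesis
        by simp
    next
      case 2
      have "inv\<^bsub>PGL3\<^esub> ?c = ?c \<circ> ?c"
        using cC c3 m_closed[OF cC cC] by (intro inv_equality) simp_all
      with conj[OF n] 2 show ?thesis
        by simp
    next
      case 3
      have "inv\<^bsub>PGL3\<^esub> (?c \<circ> ?c) = ?c"
        using cC c3 m_closed[OF cC cC] by (intro inv_equality) (simp_all add: comp_assoc)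
      moreover have "?c \<circ> ?c \<circ> n \<circ> ?c = ?c \<circ> (?c \<circ> n \<circ> (?c \<circ> ?c)) \<circ> (?c \<circ> ?c)"
        using c3 by (simp add: comp_assoc)
      ultimately show ?thesis
        using conj[OF conj[OF n]] 3 by simp
    qed
  qed
qed

section \<open>Type NC\<close>

lemma nodal_cubic_mem:
  fixes \<mu> :: "'k::field"
  assumes "(x, y, z) \<noteq> (0, 0, 0)"
  shows "pt x y z \<in> zero_locus (\<lambda>x y z. x ^ 3 + y ^ 3 - \<mu> * x * y * z) \<longleftrightarrow> x ^ 3 + y ^ 3 - \<mu> * x * y * z = 0"
  using assms by (intro pt_mem_zero_locus[where n = 3])
    (simp_all add: algebra_simps power2_eq_square power3_eq_cube)

text \<open>The branches of the node have tangents y = 0 and x = 0. Once the node is known to be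
  fixed, they are fixed or exchanged, which gives the two cases.\<close>

lemma Aut_down_nodal:
  fixes \<tau> :: "'k::field_char_0 P2 \<Rightarrow> 'k P2"
  assumes \<mu>: "\<mu> \<noteq> 0"
    and "\<tau> \<in> Aut_down (zero_locus (\<lambda>x y z. x ^ 3 + y ^ 3 - \<mu> * x * y * z))"
  obtains e where "e ^ 3 = 1" "\<tau> = proj_map (mat3 1 0 0  0 e 0  0 0 (e ^ 2))"
    | e where "e ^ 3 = 1" "\<tau> = proj_map (mat3 0 1 0  e 0 0  0 0 (e ^ 2))"
proof -
  obtain a b c d e f g h i where
    inv: "invertible (mat3 a b c d e f g h (i :: 'k))" and \<tau>: "\<tau> = proj_map (mat3 a b c d e f g h i)"
    and P: "\<And>x y z. (x, y, z) \<noteq> (0, 0, 0) \<Longrightarrow> x ^ 3 + y ^ 3 - \<mu> * x * y * z = 0 \<Longrightarrow>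
      (a * x + b * y + c * z) ^ 3 + (d * x + e * y + f * z) ^ 3 -
        \<mu> * (a * x + b * y + c * z) * (d * x + e * y + f * z) * (g * x + h * y + i * z) = 0"
    using assms(2) nodal_cubic_mem
    by (rule Aut_downE[where P = "\<lambda>x y z. x ^ 3 + y ^ 3 - \<mu> * x * y * z = 0"]) blast+
  \<comment> \<open>Images of the points (\<mu> t : \<mu> t^2 : 1 + t^3). Both t = 0 and t =
    infinity give the node, so its image coordinates c, f, i appear as lowest and as highest
    coefficients.\<close>
  define X Y Z where "X = [:c, \<mu> * a, \<mu> * b, c:]" and "Y = [:f, \<mu> * d, \<mu> * e, f:]" and "Z = [:i, \<mu> * g, \<mu> * h, i:]"
  define F where "F = X ^ 3 + Y ^ 3 - smult \<mu> (X * (Y * Z))"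
  have "poly F t = 0" for t
  proof -
    have "(\<mu> * t, \<mu> * t ^ 2, 1 + t ^ 3) \<noteq> (0, 0, 0)"
      using \<mu> by auto
    moreover have "(\<mu> * t) ^ 3 + (\<mu> * t ^ 2) ^ 3 - \<mu> * (\<mu> * t) * (\<mu> * t ^ 2) * (1 + t ^ 3) = 0"
      by algebra
    ultimately have "(a * (\<mu> * t) + b * (\<mu> * t ^ 2) + c * (1 + t ^ 3)) ^ 3 + (d * (\<mu> * t) + e * (\<mu> * t ^ 2) + f * (1 + t ^ 3)) ^ 3 -
        \<mu> * (a * (\<mu> * t) + b * (\<mu> * t ^ 2) + c * (1 + t ^ 3)) * (d * (\<mu> * t) + e * (\<mu> * t ^ 2) + f * (1 + t ^ 3)) *
          (g * (\<mu> * t) + h * (\<mu> * t ^ 2) + i * (1 + t ^ 3)) = 0"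
      by (rule P)
    moreover have "poly X t = a * (\<mu> * t) + b * (\<mu> * t ^ 2) + c * (1 + t ^ 3)"
      "poly Y t = d * (\<mu> * t) + e * (\<mu> * t ^ 2) + f * (1 + t ^ 3)"
      "poly Z t = g * (\<mu> * t) + h * (\<mu> * t ^ 2) + i * (1 + t ^ 3)"
      by (simp_all add: X_def Y_def Z_def algebra_simps power2_eq_square power3_eq_cube)
    ultimately show ?thesis
      by (simp add: F_def mult.assoc)
  qed
  then have F: "coeff F n = 0" for n
    using poly_all_0_iff_0[of F] by simp
  note coeffs = F_def X_def Y_def Z_def power2_eq_square power3_eq_cube coeff_pCons numeral_eq_Suc
  have F0: "c ^ 3 + f ^ 3 - \<mu> * c * f * i = 0"
    using F[of 0] by (simp add: coeffs algebra_simps)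
  txt \<open>The gradient of the cubic at the image \<open>(c, f, i)\<close> of the node is orthogonal to the images of the
    tangents of both branches (the coefficients of \<open>t\<close> and \<open>t\<^sup>8\<close>) and, by Euler, to \<open>(c, f, i)\<close> itself;
    hence it vanishes and the node is fixed.\<close>
  have "\<mu> * ((3 * c ^ 2 - \<mu> * f * i) * a + (3 * f ^ 2 - \<mu> * c * i) * d + (- \<mu> * c * f) * g) = 0"
    using F[of 1] by (simp add: coeffs algebra_simps)
  then have F1: "(3 * c ^ 2 - \<mu> * f * i) * a + (3 * f ^ 2 - \<mu> * c * i) * d + (- \<mu> * c * f) * g = 0"
    using \<mu> by (simp only: mult_eq_0_iff) simp
  have "\<mu> * ((3 * c ^ 2 - \<mu> * f * i) * b + (3 * f ^ 2 - \<mu> * c * i) * e + (- \<mu> * c * f) * h) = 0"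
    using F[of 8] by (simp add: coeffs algebra_simps)
  then have F8: "(3 * c ^ 2 - \<mu> * f * i) * b + (3 * f ^ 2 - \<mu> * c * i) * e + (- \<mu> * c * f) * h = 0"
    using \<mu> by (simp only: mult_eq_0_iff) simp
  have "(3 * c ^ 2 - \<mu> * f * i) * c + (3 * f ^ 2 - \<mu> * c * i) * f + (- \<mu> * c * f) * i = 0"
    using F0 by algebra
  from invertible_mat3_rows[OF inv F1 F8 this] \<mu> have [simp]: "c = 0" "f = 0"
    by auto
  have nz: "i \<noteq> 0" "a * e - b * d \<noteq> 0"
    using inv by (auto simp: invertible_mat3)
  \<comment> \<open>ad = 0 and be = 0 say that each nodal tangent goes to a nodal tangent.\<close>
  have "\<mu> ^ 3 * (a * (d * i)) = 0" "\<mu> ^ 3 * (b * (e * i)) = 0"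
    using F[of 2] F[of 7] by (simp_all add: coeffs algebra_simps)
  with \<mu> nz consider "b = 0" "d = 0" "a \<noteq> 0" "e \<noteq> 0" | "a = 0" "e = 0" "b \<noteq> 0" "d \<noteq> 0"
    by auto
  then show thesis
  proof cases
    case 1
    have "\<mu> ^ 3 * (a ^ 3 - a * (e * i)) = 0" "\<mu> ^ 4 * (a * (e * g)) = 0" "\<mu> ^ 4 * (a * (e * h)) = 0"
      "\<mu> ^ 3 * (e ^ 3 - a * (e * i)) = 0"
      using F[of 3] F[of 4] F[of 5] F[of 6] 1 by (simp_all add: coeffs algebra_simps)
    with \<mu> 1 have 2: "a ^ 3 = a * (e * i)" "e ^ 3 = a * (e * i)" "g = 0" "h = 0"
      by simp_all
    then have "e ^ 3 = a ^ 3"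
      by simp
    then have "(e / a) ^ 3 = 1"
      using 1 by (simp add: power_divide)
    moreover have "i / a = (e / a) ^ 2"
      using 1 2 by (simp add: field_simps power2_eq_square power3_eq_cube)
    ultimately have "\<tau> = proj_map (mat3 1 0 0  0 (e / a) 0  0 0 ((e / a) ^ 2))"
      unfolding \<tau> using 1 2 inv by (subst proj_map_normalize[of a]) simp_all
    with \<open>(e / a) ^ 3 = 1\<close> show thesis
      by (rule that(1))
  next
    case 2
    have "\<mu> ^ 3 * (d ^ 3 - b * (d * i)) = 0" "\<mu> ^ 4 * (b * (d * g)) = 0" "\<mu> ^ 4 * (b * (d * h)) = 0"
      "\<mu> ^ 3 * (b ^ 3 - b * (d * i)) = 0"
      using F[of 3] F[of 4] F[of 5] F[of 6] 2 by (simp_all add: coeffs algebra_simps)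
    with \<mu> 2 have 3: "d ^ 3 = b * (d * i)" "b ^ 3 = b * (d * i)" "g = 0" "h = 0"
      by simp_all
    then have "d ^ 3 = b ^ 3"
      by simp
    then have "(d / b) ^ 3 = 1"
      using 2 by (simp add: power_divide)
    moreover have "i / b = (d / b) ^ 2"
      using 2 3 by (simp add: field_simps power2_eq_square power3_eq_cube)
    ultimately have "\<tau> = proj_map (mat3 0 1 0  (d / b) 0 0  0 0 ((d / b) ^ 2))"
      unfolding \<tau> using 2 3 inv by (subst proj_map_normalize[of b]) simp_all
    with \<open>(d / b) ^ 3 = 1\<close> show thesis
      by (rule that(2))
  qed
qed

text \<open>Everything acts on the parameter t: \<sigma> by \<alpha> t, the diagonal automorphisms
  by e t and the others by e/t, with e^3 = 1. Multiplications commute, and inversion turns \<alpha>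
  into \<alpha>^-1.\<close>

lemma type_NC_Z_M:
  fixes E :: "'k::field_char_0 P2 set"
  assumes "type_NC \<alpha> E \<sigma>"
  defines "K \<equiv> {proj_map (mat3 1 0 0  0 e 0  0 0 (e ^ 2)) | e. e ^ 3 = 1}"
  shows "\<sigma> [^]\<^bsub>BijGroup E\<^esub> (2::nat) \<noteq> \<one>\<^bsub>BijGroup E\<^esub> \<Longrightarrow> Z_set E \<sigma> = K"
    "\<sigma> [^]\<^bsub>BijGroup E\<^esub> (2::nat) = \<one>\<^bsub>BijGroup E\<^esub> \<Longrightarrow> Z_set E \<sigma> = Aut_down E"
    "\<sigma> [^]\<^bsub>BijGroup E\<^esub> (6::nat) \<noteq> \<one>\<^bsub>BijGroup E\<^esub> \<Longrightarrow> M_set E \<sigma> = K"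
    "\<sigma> [^]\<^bsub>BijGroup E\<^esub> (6::nat) = \<one>\<^bsub>BijGroup E\<^esub> \<Longrightarrow> M_set E \<sigma> = Aut_down E"
proof -
  define \<mu> where "\<mu> = (\<alpha> ^ 3 - 1) / \<alpha>"
  have E: "E = zero_locus (\<lambda>x y z. x ^ 3 + y ^ 3 - \<mu> * x * y * z)" and \<sigma>: "\<sigma> \<in> Bij E"
    and \<alpha>: "\<alpha> \<noteq> 0" and \<mu>: "\<mu> \<noteq> 0"
    and act: "\<And>a b c. a ^ 3 + b ^ 3 - \<mu> * a * b * c = 0 \<Longrightarrow> b \<noteq> 0 \<Longrightarrow>
        \<sigma> (pt a b c) = pt a (\<alpha> * b) (- (a ^ 2 / b) + \<alpha> ^ 2 * c)"
    and node: "\<sigma> (pt 0 0 1) = pt 0 0 1"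
    using assms by (auto simp: type_NC_def Let_def \<mu>_def intro: Aut_imp_Bij)
  have \<mu>\<alpha>: "\<mu> * \<alpha> = \<alpha> ^ 3 - 1"
    using \<alpha> by (simp add: \<mu>_def)
  note mem = nodal_cubic_mem[of _ _ _ \<mu>, folded E]
  txt \<open>The normalization of the nodal cubic; \<open>t = 0\<close> and \<open>t = \<infinity>\<close> are the two branches at the node.
    Since \<open>e / 0 = 0\<close>, the formula \<open>N t \<mapsto> N (e / t)\<close> below is also right at the node.\<close>
  define N where "N t = pt (\<mu> * t) (\<mu> * t ^ 2) (1 + t ^ 3)" for t
  have nz: "(\<mu> * t, \<mu> * t ^ 2, 1 + t ^ 3) \<noteq> (0, 0, 0)" for t
    using \<mu> by auto
  have N_mem: "N t \<in> E" for t
    unfolding N_def mem[OF nz] by algebra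
  have cases: "\<exists>t. p = N t" if "p \<in> E" for p
  proof -
    obtain x y z where xyz: "(x, y, z) \<noteq> (0, 0, 0)" "p = pt x y z"
      by (rule pt_exhaust)
    with that mem have eq: "x ^ 3 + y ^ 3 - \<mu> * x * y * z = 0"
      by blast
    show ?thesis
    proof (cases "x = 0")
      case True
      with eq xyz have "p = N 0"
        by (simp add: N_def pt_eq_iff)
      then show ?thesis ..
    next
      case False
      \<comment> \<open>The parameter is the slope of the line joining the point to the
        node.\<close>
      define t where "t = y / x"
      have y: "y = t * x"
        using False by (simp add: t_def)
      have "x ^ 2 * (x * (1 + t ^ 3) - z * (\<mu> * t)) = 0"
        using eq y by algebra
      with False have "x * (1 + t ^ 3) = z * (\<mu> * t)"
        by simp
      moreover from this have "x * (\<mu> * t ^ 2) = y * (\<mu> * t)" "y * (1 + t ^ 3) = z * (\<mu> * t ^ 2)"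
        using y by algebra+
      ultimately have "p = N t"
        unfolding N_def xyz(2) pt_eq_iff[OF xyz(1) nz] by blast
      then show ?thesis ..
    qed
  qed
  have N_eq: "N s = N t \<longleftrightarrow> s = t" for s t
  proof
    assume "N s = N t"
    then have *: "\<mu> * s * (\<mu> * t ^ 2) = \<mu> * s ^ 2 * (\<mu> * t)" "\<mu> * s * (1 + t ^ 3) = (1 + s ^ 3) * (\<mu> * t)"
      unfolding N_def pt_eq_iff[OF nz nz] by auto
    \<comment> \<open>This settles nonzero parameters; if one is zero, the second equation makes the
      other zero as well.\<close>
    then have "\<mu> ^ 2 * (s * (t * (t - s))) = 0"
      by algebra
    with * \<mu> show "s = t"
      by auto
  qed simp
  have \<sigma>N: "\<sigma> (N t) = N (\<alpha> * t)" for t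
  proof (cases "t = 0")
    case True
    then show ?thesis
      by (simp add: N_def node)
  next
    case False
    have "\<sigma> (N t) = pt (\<mu> * t) (\<alpha> * (\<mu> * t ^ 2)) (- ((\<mu> * t) ^ 2 / (\<mu> * t ^ 2)) + \<alpha> ^ 2 * (1 + t ^ 3))"
      unfolding N_def using \<mu> False by (intro act) (algebra, simp)
    also have "(\<mu> * t) ^ 2 / (\<mu> * t ^ 2) = \<mu>"
      using \<mu> False by (simp add: power2_eq_square)
    \<comment> \<open>Here the value of \<mu> enters: \<alpha> times the third coordinate is 1 +
      (\<alpha> t)^3 because \<mu> \<alpha> = \<alpha>^3 - 1.\<close>
    also have "pt (\<mu> * t) (\<alpha> * (\<mu> * t ^ 2)) (- \<mu> + \<alpha> ^ 2 * (1 + t ^ 3)) = N (\<alpha> * t)"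
    proof -
      have "\<mu> * t * (1 + (\<alpha> * t) ^ 3) = (- \<mu> + \<alpha> ^ 2 * (1 + t ^ 3)) * (\<mu> * (\<alpha> * t))"
        "\<alpha> * (\<mu> * t ^ 2) * (1 + (\<alpha> * t) ^ 3) = (- \<mu> + \<alpha> ^ 2 * (1 + t ^ 3)) * (\<mu> * (\<alpha> * t) ^ 2)"
        using \<mu>\<alpha> by algebra+
      moreover have "\<mu> * t * (\<mu> * (\<alpha> * t) ^ 2) = \<alpha> * (\<mu> * t ^ 2) * (\<mu> * (\<alpha> * t))"
        by algebra
      ultimately show ?thesis
        unfolding N_def using \<mu> False by (subst pt_eq_iff[OF _ nz]) auto
    qed
    finally show ?thesis .
  qed
  have e0: "e \<noteq> 0" if "e ^ 3 = 1" for e :: 'k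
    using that by auto
  have invs: "invertible (mat3 1 0 0  0 e 0  0 0 (e ^ 2))" "invertible (mat3 0 1 0  e 0 0  0 0 (e ^ 2))"
    if "e ^ 3 = 1" for e :: 'k
    using e0[OF that] by (auto simp: invertible_mat3)
  have diagN: "proj_map (mat3 1 0 0  0 e 0  0 0 (e ^ 2)) (N t) = N (e * t)" if e: "e ^ 3 = 1" for e t
  proof -
    have "\<mu> * t * (1 + (e * t) ^ 3) = e ^ 2 * (1 + t ^ 3) * (\<mu> * (e * t))"
      "e * (\<mu> * t ^ 2) * (1 + (e * t) ^ 3) = e ^ 2 * (1 + t ^ 3) * (\<mu> * (e * t) ^ 2)"
      using e by algebra+
    moreover have "\<mu> * t * (\<mu> * (e * t) ^ 2) = e * (\<mu> * t ^ 2) * (\<mu> * (e * t))"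
      by algebra
    ultimately show ?thesis
      unfolding N_def using \<mu> e0[OF e]
      by (subst proj_map_pt[OF invs(1)[OF e] nz], subst pt_eq_iff[OF _ nz]) auto
  qed
  have swapN: "proj_map (mat3 0 1 0  e 0 0  0 0 (e ^ 2)) (N t) = N (e / t)" if e: "e ^ 3 = 1" for e t
  proof (cases "t = 0")
    case True
    then show ?thesis
      unfolding N_def using e0[OF e]
      by (subst proj_map_pt[OF invs(2)[OF e] nz], subst pt_eq_iff) auto
  next
    case False
    define s where "s = e / t"
    have "e = s * t"
      using False by (simp add: s_def)
    then have "\<mu> * t ^ 2 * (1 + s ^ 3) = e ^ 2 * (1 + t ^ 3) * (\<mu> * s)"
      "e * (\<mu> * t) * (1 + s ^ 3) = e ^ 2 * (1 + t ^ 3) * (\<mu> * s ^ 2)"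
      "\<mu> * t ^ 2 * (\<mu> * s ^ 2) = e * (\<mu> * t) * (\<mu> * s)"
      using e by algebra+
    then show ?thesis
      unfolding N_def s_def[symmetric] using \<mu> e0[OF e] False
      by (subst proj_map_pt[OF invs(2)[OF e] nz], subst pt_eq_iff[OF _ nz]) auto
  qed
  have K: "K \<subseteq> Aut_down E"
    unfolding K_def
  proof safe
    fix e :: 'k
    assume e: "e ^ 3 = 1"
    then have [simp]: "x ^ 3 + (e * y) ^ 3 - \<mu> * x * (e * y) * (e ^ 2 * z) = x ^ 3 + y ^ 3 - \<mu> * x * y * z" for x y z
      by algebra
    show "proj_map (mat3 1 0 0  0 e 0  0 0 (e ^ 2)) \<in> Aut_down E"
      by (intro proj_map_in_Aut_down[OF invs(1)[OF e] mem]) simp_all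
  qed
  have comm: "\<sigma> (\<tau> p) = \<tau> (\<sigma> p)" if \<tau>: "\<tau> \<in> K" and p: "p \<in> E" for \<tau> p
  proof -
    obtain e where "e ^ 3 = 1" "\<tau> = proj_map (mat3 1 0 0  0 e 0  0 0 (e ^ 2))"
      using \<tau> by (auto simp: K_def)
    moreover obtain t where "p = N t"
      using cases[OF p] by blast
    ultimately show ?thesis
      by (simp add: \<sigma>N diagN mult.left_commute)
  qed
  have inverts: "\<sigma> (\<tau> (\<sigma> p)) = \<tau> p" if \<tau>: "\<tau> \<in> Aut_down E - K" and p: "p \<in> E" for \<tau> p
  proof -
    have "\<tau> \<in> Aut_down (zero_locus (\<lambda>x y z. x ^ 3 + y ^ 3 - \<mu> * x * y * z))"
      using \<tau> E by simp
    with \<mu> have "\<exists>e. e ^ 3 = 1 \<and> \<tau> = proj_map (mat3 0 1 0  e 0 0  0 0 (e ^ 2))"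
      by (rule Aut_down_nodal) (use \<tau> in \<open>auto simp: K_def\<close>)
    then obtain e where "e ^ 3 = 1" "\<tau> = proj_map (mat3 0 1 0  e 0 0  0 0 (e ^ 2))"
      by blast
    moreover obtain t where "p = N t"
      using cases[OF p] by blast
    ultimately show ?thesis
      using \<alpha> by (simp add: \<sigma>N swapN)
  qed
  have pow: "(\<sigma> ^^ n) (N t) = N (\<alpha> ^ n * t)" for n t
    by (induction n) (simp_all add: \<sigma>N mult.assoc)
  have six: "\<sigma> [^]\<^bsub>BijGroup E\<^esub> (6::nat) = \<one>\<^bsub>BijGroup E\<^esub> \<longleftrightarrow> \<alpha> ^ 6 = 1"
    unfolding BijGroup_pow_eq_one_iff[OF \<sigma>]
  proof
    assume "\<forall>p\<in>E. (\<sigma> ^^ 6) p = p"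
    then have "N (\<alpha> ^ 6 * 1) = N 1"
      using N_mem pow by metis
    then show "\<alpha> ^ 6 = 1"
      by (simp add: N_eq)
  next
    assume \<alpha>6: "\<alpha> ^ 6 = 1"
    show "\<forall>p\<in>E. (\<sigma> ^^ 6) p = p"
    proof
      fix p
      assume "p \<in> E"
      then obtain t where "p = N t"
        using cases by blast
      then show "(\<sigma> ^^ 6) p = p"
        by (simp add: pow \<alpha>6)
    qed
  qed
  have lin: "(\<exists>\<rho>\<in>Aut_down E. \<forall>p\<in>E. \<rho> p = \<sigma> (\<sigma> p)) \<longleftrightarrow> \<alpha> ^ 6 = 1"
  proof
    assume "\<exists>\<rho>\<in>Aut_down E. \<forall>p\<in>E. \<rho> p = \<sigma> (\<sigma> p)"
    then obtain \<rho> where \<rho>: "\<rho> \<in> Aut_down E" "\<And>t. \<rho> (N t) = \<sigma> (\<sigma> (N t))"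
      using N_mem by blast
    from \<mu> \<rho>(1)[unfolded E] show "\<alpha> ^ 6 = 1"
    proof (rule Aut_down_nodal)
      fix e
      assume e: "e ^ 3 = 1" "\<rho> = proj_map (mat3 1 0 0  0 e 0  0 0 (e ^ 2))"
      with \<rho>(2)[of 1] have "e = \<alpha> * \<alpha>"
        by (simp add: \<sigma>N diagN N_eq)
      with e(1) show "\<alpha> ^ 6 = 1"
        by algebra
    next
      fix e
      assume e: "e ^ 3 = 1" "\<rho> = proj_map (mat3 0 1 0  e 0 0  0 0 (e ^ 2))"
      \<comment> \<open>Two parameters suffice to tell e/t from a scaling: t = 1 and t = 2 give
        \<alpha>^2 = 4 \<alpha>^2.\<close>
      with \<rho>(2)[of 1] \<rho>(2)[of 2] have "e = \<alpha> * \<alpha>" "e / 2 = \<alpha> * (\<alpha> * 2)"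
        by (simp_all add: \<sigma>N swapN N_eq)
      then have "3 * \<alpha> ^ 2 = 0"
        by (simp add: power2_eq_square)
      with \<alpha> show "\<alpha> ^ 6 = 1"
        by simp
    qed
  next
    assume \<alpha>6: "\<alpha> ^ 6 = 1"
    then have 3: "(\<alpha> ^ 2) ^ 3 = 1"
      by simp
    \<comment> \<open>Multiplication of t by \<alpha>^2 is linear because \<alpha>^2 is a cube root
      of unity.\<close>
    let ?\<rho> = "proj_map (mat3 1 0 0  0 (\<alpha> ^ 2) 0  0 0 ((\<alpha> ^ 2) ^ 2))"
    have "?\<rho> \<in> K"
      unfolding K_def using 3 by blast
    then have "?\<rho> \<in> Aut_down E"
      using K by blast
    moreover have "?\<rho> p = \<sigma> (\<sigma> p)" if p: "p \<in> E" for p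
    proof -
      obtain t where "p = N t"
        using cases[OF p] by blast
      then show ?thesis
        using diagN[OF 3, of t] by (simp add: \<sigma>N power2_eq_square mult.assoc)
    qed
    ultimately show "\<exists>\<rho>\<in>Aut_down E. \<forall>p\<in>E. \<rho> p = \<sigma> (\<sigma> p)"
      by blast
  qed
  show "\<sigma> [^]\<^bsub>BijGroup E\<^esub> (2::nat) \<noteq> \<one>\<^bsub>BijGroup E\<^esub> \<Longrightarrow> Z_set E \<sigma> = K"
    "\<sigma> [^]\<^bsub>BijGroup E\<^esub> (2::nat) = \<one>\<^bsub>BijGroup E\<^esub> \<Longrightarrow> Z_set E \<sigma> = Aut_down E"
    "\<sigma> [^]\<^bsub>BijGroup E\<^esub> (6::nat) \<noteq> \<one>\<^bsub>BijGroup E\<^esub> \<Longrightarrow> M_set E \<sigma> = K"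
    "\<sigma> [^]\<^bsub>BijGroup E\<^esub> (6::nat) = \<one>\<^bsub>BijGroup E\<^esub> \<Longrightarrow> M_set E \<sigma> = Aut_down E"
    using Z_M_if_commute_or_invert[OF \<sigma> K comm inverts lin[folded six]] by blast+
qed

text \<open>The map e |-> diag(1, e, e^2) is multiplicative, and the cube roots of unity are the
  powers of \<epsilon>.\<close>

lemma generate_diag_cube_root:
  fixes \<epsilon> :: "'k::field"
  assumes \<epsilon>: "primitive_cube_root \<epsilon>"
  shows "generate PGL3 {proj_map (mat3 1 0 0  0 \<epsilon> 0  0 0 (\<epsilon> ^ 2))} =
    {proj_map (mat3 1 0 0  0 e 0  0 0 (e ^ 2)) | e. e ^ 3 = 1}"
proof -
  interpret group "PGL3 :: ('k P2 \<Rightarrow> 'k P2) monoid"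
    by (rule group_PGL3)
  let ?c = "\<lambda>e. proj_map (mat3 1 0 0  0 e 0  0 0 (e ^ 2)) :: 'k P2 \<Rightarrow> 'k P2"
  have \<epsilon>3: "\<epsilon> ^ 3 = 1"
    using \<epsilon> by (simp add: primitive_cube_root_def)
  have inv: "invertible (mat3 1 0 0  0 e 0  0 0 (e ^ 2 :: 'k))" if "e \<noteq> 0" for e
    using that by (simp add: invertible_mat3)
  have mult: "?c e \<circ> ?c e' = ?c (e * e')" if "e \<noteq> 0" "e' \<noteq> 0" for e e'
    using that by (simp add: proj_map_comp inv mat3_mult power_mult_distrib)
  have \<epsilon>0: "\<epsilon> \<noteq> 0"
    using \<epsilon>3 by auto
  have "?c \<epsilon> \<in> carrier PGL3"
    using inv[OF \<epsilon>0] by (auto simp: carrier_PGL3)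
  moreover have "?c \<epsilon> \<circ> ?c \<epsilon> \<circ> ?c \<epsilon> = id"
    using \<epsilon>0 \<epsilon>3 by (simp add: mult flip: power3_eq_cube)
  ultimately have "generate PGL3 {?c \<epsilon>} = {id, ?c \<epsilon>, ?c \<epsilon> \<circ> ?c \<epsilon>}"
    using generate_order_3 by simp
  also have "\<dots> = ?c ` {1, \<epsilon>, \<epsilon> ^ 2}"
    by (simp add: mult[OF \<epsilon>0 \<epsilon>0] flip: power2_eq_square)
  also have "\<dots> = {?c e | e. e ^ 3 = 1}"
    unfolding cube_eq_one_iff[OF \<epsilon>] by blast
  finally show ?thesis .
qed

section \<open>Classification of Z and M\<close>

theorem theorem4p8:
  fixes E :: "'k::{alg_closed_field, field_char_0} P2 set"
    and \<sigma> :: "'k P2 \<Rightarrow> 'k P2"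
    and \<epsilon> :: 'k
  assumes "primitive_cube_root \<epsilon>"
  shows
    "(type_P E \<sigma> \<longrightarrow>
        Z_set E \<sigma> = carrier PGL3 \<and> M_set E \<sigma> = carrier PGL3) \<and>
     (type_T \<epsilon> E \<sigma> \<longrightarrow>
        Z_set E \<sigma> = M_set E \<sigma> \<and>
        semidirect PGL3 (Z_set E \<sigma>)
          {proj_map (mat3 1 0 0  0 e 0  g h (e ^ 2)) | e g h. e ^ 3 = 1}
          (generate PGL3 {proj_map (mat3 0 1 0  1 0 0  0 0 (- 1))})) \<and>
     (type_T' E \<sigma> \<longrightarrow>
        Z_set E \<sigma> = M_set E \<sigma> \<and>
        Z_set E \<sigma> = {proj_map (mat3 1 0 0  d 1 0  (d ^ 2) (2 * d) 1) | d. True}) \<and>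
     (type_CC E \<sigma> \<longrightarrow>
        Z_set E \<sigma> = {id} \<and> M_set E \<sigma> = {id}) \<and>
     (\<forall>\<alpha>. type_S \<alpha> E \<sigma> \<longrightarrow>
        (\<sigma> [^]\<^bsub>BijGroup E\<^esub> (2::nat) \<noteq> \<one>\<^bsub>BijGroup E\<^esub> \<longrightarrow>
           semidirect PGL3 (Z_set E \<sigma>) D_set
             (generate PGL3 {proj_map (mat3 0 1 0  0 0 1  1 0 0)})) \<and>
        (\<sigma> [^]\<^bsub>BijGroup E\<^esub> (2::nat) = \<one>\<^bsub>BijGroup E\<^esub> \<longrightarrow> Z_set E \<sigma> = Aut_down E) \<and>
        (\<sigma> [^]\<^bsub>BijGroup E\<^esub> (6::nat) \<noteq> \<one>\<^bsub>BijGroup E\<^esub> \<longrightarrow>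
           semidirect PGL3 (M_set E \<sigma>) D_set
             (generate PGL3 {proj_map (mat3 0 1 0  0 0 1  1 0 0)})) \<and>
        (\<sigma> [^]\<^bsub>BijGroup E\<^esub> (6::nat) = \<one>\<^bsub>BijGroup E\<^esub> \<longrightarrow> M_set E \<sigma> = Aut_down E)) \<and>
     (\<forall>\<alpha>. type_S' \<alpha> E \<sigma> \<longrightarrow>
        (\<sigma> [^]\<^bsub>BijGroup E\<^esub> (2::nat) \<noteq> \<one>\<^bsub>BijGroup E\<^esub> \<longrightarrow>
           Z_set E \<sigma> = {proj_map (mat3 1 0 0  0 e 0  0 0 (inverse e)) | e. e \<noteq> 0}) \<and>
        (\<sigma> [^]\<^bsub>BijGroup E\<^esub> (2::nat) = \<one>\<^bsub>BijGroup E\<^esub> \<longrightarrow> Z_set E \<sigma> = Aut_down E) \<and>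
        (\<sigma> [^]\<^bsub>BijGroup E\<^esub> (6::nat) \<noteq> \<one>\<^bsub>BijGroup E\<^esub> \<longrightarrow>
           M_set E \<sigma> = {proj_map (mat3 1 0 0  0 e 0  0 0 (inverse e)) | e. e \<noteq> 0}) \<and>
        (\<sigma> [^]\<^bsub>BijGroup E\<^esub> (6::nat) = \<one>\<^bsub>BijGroup E\<^esub> \<longrightarrow> M_set E \<sigma> = Aut_down E)) \<and>
     (\<forall>\<alpha>. type_NC \<alpha> E \<sigma> \<longrightarrow>
        (\<sigma> [^]\<^bsub>BijGroup E\<^esub> (2::nat) \<noteq> \<one>\<^bsub>BijGroup E\<^esub> \<longrightarrow>
           Z_set E \<sigma> = generate PGL3 {proj_map (mat3 1 0 0  0 \<epsilon> 0  0 0 (\<epsilon> ^ 2))}) \<and>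
        (\<sigma> [^]\<^bsub>BijGroup E\<^esub> (2::nat) = \<one>\<^bsub>BijGroup E\<^esub> \<longrightarrow> Z_set E \<sigma> = Aut_down E) \<and>
        (\<sigma> [^]\<^bsub>BijGroup E\<^esub> (6::nat) \<noteq> \<one>\<^bsub>BijGroup E\<^esub> \<longrightarrow>
           M_set E \<sigma> = generate PGL3 {proj_map (mat3 1 0 0  0 \<epsilon> 0  0 0 (\<epsilon> ^ 2))}) \<and>
        (\<sigma> [^]\<^bsub>BijGroup E\<^esub> (6::nat) = \<one>\<^bsub>BijGroup E\<^esub> \<longrightarrow> M_set E \<sigma> = Aut_down E))"
proof (intro conjI allI)
  show "type_P E \<sigma> \<longrightarrow> Z_set E \<sigma> = carrier PGL3 \<and> M_set E \<sigma> = carrier PGL3"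
    using type_P_Z_M by blast
  show "type_CC E \<sigma> \<longrightarrow> Z_set E \<sigma> = {id} \<and> M_set E \<sigma> = {id}"
    using type_CC_Z_M by blast
  show "type_T \<epsilon> E \<sigma> \<longrightarrow> Z_set E \<sigma> = M_set E \<sigma> \<and>
      semidirect PGL3 (Z_set E \<sigma>) {proj_map (mat3 1 0 0  0 e 0  g h (e ^ 2)) | e g h. e ^ 3 = 1}
        (generate PGL3 {proj_map (mat3 0 1 0  1 0 0  0 0 (- 1))})"
    by (intro impI conjI) (simp_all only: type_T_Z_M[OF assms] semidirect_three_lines)
  show "type_T' E \<sigma> \<longrightarrow> Z_set E \<sigma> = M_set E \<sigma> \<and>
      Z_set E \<sigma> = {proj_map (mat3 1 0 0  d 1 0  (d ^ 2) (2 * d) 1) | d. True}"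
    using type_T'_Z_M by blast
qed (auto simp: type_S_Z_M semidirect_triangle type_S'_Z_M type_NC_Z_M generate_diag_cube_root[OF assms])

end
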